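(* Let $\chi\in\mathcal R^\infty(\mathbf C^d)$, $\sigma\in(\frac12,1)$ and $\sigma_0=\frac{\sigma}{2\sigma-1}$. Then the following is true: (i) For $F\in A(\mathbf C^d)$ the following conditions are equivalent: (1) $F\in\mathcal A_{\flat_\sigma}(\mathbf C^d)$ (respectively $F\in\mathcal A_{0,\flat_\sigma}(\mathbf C^d)$); (2) the estimate $|F(z)|\lesssim e^{r_1|z_1|^{2\sigma/(\sigma+1)}+\cdots+r_d|z_d|^{2\sigma/(\sigma+1)}}$, $z\in\mathbf C^d$, holds for some (respectively for every) $r\in\mathbf R_+^d$; (3) there exists $F_0\in\mathcal A_{0,\flat_{\sigma_0}}'(\mathbf C^d)$ (respectively $F_0\in\mathcal A_{\flat_{\sigma_0}}'(\mathbf C^d)$) such that $F=\Pi_A(F_0\cdot\chi)$. (ii) The mappings $F\mapsto\Pi_A(F\cdot\chi)$ from $\mathcal A_{0,\flat_{\sigma_0}}'(\mathbf C^d)$ to $\mathcal A_{\flat_\sigma}(\mathbf C^d)$ and from $\mathcal A_{\flat_{\sigma_0}}'(\mathbf C^d)$ to $\mathcal A_{0,\flat_\sigma}(\mathbf C^d)$ are homeomorphisms.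
   Context: Notation: $\mathbf R_+=(0,\infty)$, $\mathbf N=\{0,1,2,\dots\}$. Inequalities between vectors in $\mathbf R_+^d$ are coordinatewise. $D_r(0)=\{z\in\mathbf C^d: |z_j|<r_j,\ j=1,\dots,d\}$. $A(\mathbf C^d)$ is the set of entire functions. $g\lesssim h$ means $g\le Ch$ for a constant $C>0$ independent of the variable ($z$ or $\alpha$). Power series are written $F(z)=\sum_{\alpha\in\mathbf N^d}c(F,\alpha)e_\alpha(z)$ with $e_\alpha(z)=z^\alpha/\sqrt{\alpha!}$. For $\sigma>0$: $\mathcal A_{\flat_\sigma}(\mathbf C^d)$ (respectively $\mathcal A_{0,\flat_\sigma}(\mathbf C^d)$) is the set of $F$ with $|c(F,\alpha)|\lesssim r^\alpha\alpha!^{-1/(2\sigma)}$ for some (respectively every) $r\in\mathbf R_+^d$; $\mathcal A'_{\flat_\sigma}(\mathbf C^d)$ (respectively $\mathcal A'_{0,\flat_\sigma}(\mathbf C^d)$) is the set of $F$ with $|c(F,\alpha)|\lesssim r^\alpha\alpha!^{1/(2\sigma)}$ for every (respectively some) $r\in\mathbf R_+^d$. When $\sigma>1$ the elements of the latter two spaces are entire functions. Topologies: for a weight $w_r(\alpha)=r^\alpha\alpha!^{\mp1/(2\sigma)}$ consider the Banach space of power series with finite norm $\sup_\alpha|c(F,\alpha)|/w_r(\alpha)$; spaces defined by "for some $r$" carry the (locally convex) inductive limit topology of these Banach spaces, and spaces defined by "for every $r$" carry the projective limit topology. For $t_1\le t_2$ in $\mathbf R_+^d$, $\mathcal R^\infty_{t_1,t_2}(\mathbf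 C^d)$ is the set of non-negative $\chi\in L^\infty(\mathbf C^d)$ with support in $\overline{D_{t_2}(0)}$, of the form $\chi(z)=\chi_0(|z_1|,\dots,|z_d|)$ for some function $\chi_0$, and such that $\chi\ge c$ on $D_{t_1}(0)$ for some constant $c>0$. $\mathcal R^\infty(\mathbf C^d)=\bigcup_{t_1\le t_2}\mathcal R^\infty_{t_1,t_2}(\mathbf C^d)$. For compactly supported $F\in L^\infty(\mathbf C^d)$, $(\Pi_AF)(z)=\pi^{-d}\int_{\mathbf C^d}F(w)e^{(z,w)-|w|^2}\,d\lambda(w)$, where $(z,w)=\sum_jz_j\overline{w_j}$ and $d\lambda$ is the Lebesgue measure. *)

theory Defs
  imports "HOL-Analysis.Analysis"
begin

definition pos_vecs :: "(real ^ 'd) set"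
  where "pos_vecs = {r. \<forall>j. 0 < r $ j}"

definition lesssim :: "('x \<Rightarrow> real) \<Rightarrow> ('x \<Rightarrow> real) \<Rightarrow> bool"  (infix "\<lesssim>" 50)
  where "g \<lesssim> h \<longleftrightarrow> (\<exists>C>0. \<forall>x. g x \<le> C * h x)"

definition polydisc :: "real ^ 'd \<Rightarrow> (complex ^ 'd) set"
  where "polydisc r = {z. \<forall>j. norm (z $ j) < r $ j}"


section \<open>Entire functions and their power series\<close>

definition entire :: "(complex ^ 'd \<Rightarrow> complex) set"
  where "entire = {F. \<forall>z. \<exists>D. (F has_derivative D) (at z) \<and> (\<forall>a v. D (a *s v) = a * D v)}"

definition mpower :: "'a::comm_monoid_mult ^ 'd \<Rightarrow> nat ^ 'd \<Rightarrow> 'a"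
  where "mpower z \<alpha> = (\<Prod>j\<in>UNIV. (z $ j) ^ (\<alpha> $ j))"

definition mfact :: "nat ^ 'd \<Rightarrow> real"
  where "mfact \<alpha> = (\<Prod>j\<in>UNIV. fact (\<alpha> $ j))"

definition e_monom :: "nat ^ 'd \<Rightarrow> complex ^ 'd \<Rightarrow> complex"
  where "e_monom \<alpha> z = mpower z \<alpha> / complex_of_real (sqrt (mfact \<alpha>))"

text \<open>
  A formal power series \<open>\<Sum>\<alpha>. c \<alpha> * e_monom \<alpha> z\<close> is represented by its coefficient function \<open>c\<close>.
  An entire function \<open>F\<close> is identified with the series \<open>power_series F\<close>, whose coefficient at
  \<open>\<alpha>\<close> is $c(F,\alpha)$.
\<close>

type_synonym 'd pseries = "nat ^ 'd \<Rightarrow> complex"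

definition power_series :: "(complex ^ 'd \<Rightarrow> complex) \<Rightarrow> 'd pseries"
  where "power_series F = (THE c. \<forall>z. ((\<lambda>\<alpha>. c \<alpha> * e_monom \<alpha> z) has_sum F z) UNIV)"


section \<open>The Banach spaces and their limits\<close>

text \<open>
  The exponent \<open>s\<close> of $\alpha!$ in the weight is $-1/(2\sigma)$ for the unprimed and $1/(2\sigma)$
  for the primed spaces.
\<close>

definition weight :: "real \<Rightarrow> real ^ 'd \<Rightarrow> nat ^ 'd \<Rightarrow> real"
  where "weight s r \<alpha> = mpower r \<alpha> * mfact \<alpha> powr s"

definition banach :: "real \<Rightarrow> real ^ 'd \<Rightarrow> 'd pseries set"
  where "banach s r = {c. bdd_above (range (\<lambda>\<alpha>. norm (c \<alpha>) / weight s r \<alpha>))}"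

definition banach_norm :: "real \<Rightarrow> real ^ 'd \<Rightarrow> 'd pseries \<Rightarrow> real"
  where "banach_norm s r c = (SUP \<alpha>. norm (c \<alpha>) / weight s r \<alpha>)"

text \<open>
  The absolute value has no effect on the Banach space itself, where the norm is nonnegative; off the
  space the supremum is unspecified, and \<^locale>\<open>Metric_space\<close> asks for a globally nonnegative distance.
\<close>

definition banach_dist :: "real \<Rightarrow> real ^ 'd \<Rightarrow> 'd pseries \<Rightarrow> 'd pseries \<Rightarrow> real"
  where "banach_dist s r b c = \<bar>banach_norm s r (\<lambda>\<alpha>. b \<alpha> - c \<alpha>)\<bar>"

definition banach_topology :: "real \<Rightarrow> real ^ 'd \<Rightarrow> 'd pseries topology"
  where "banach_topology s r = Metric_space.mtopology (banach s r) (banach_dist s r)"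

definition absolutely_convex :: "('d::finite) pseries set \<Rightarrow> bool"
  where "absolutely_convex V \<longleftrightarrow>
    (\<forall>x\<in>V. \<forall>y\<in>V. \<forall>a b. norm a + norm b \<le> 1 \<longrightarrow> (\<lambda>\<alpha>. a * x \<alpha> + b * y \<alpha>) \<in> V)"

text \<open>
  A base of neighbourhoods of zero in the locally convex inductive limit consists of the absolutely
  convex subsets of the union whose trace on every step is a neighbourhood of zero in that step.
\<close>

definition inductive_nbhd :: "real \<Rightarrow> ('d::finite) pseries set \<Rightarrow> bool"
  where "inductive_nbhd s V \<longleftrightarrow>
    V \<subseteq> (\<Union>r\<in>pos_vecs. banach s r) \<and> absolutely_convex V \<and>
    (\<forall>r\<in>pos_vecs. \<exists>U. openin (banach_topology s r) U \<and> (\<lambda>\<alpha>. 0) \<in> U \<and> U \<subseteq> V)"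

definition inductive_limit_topology :: "real \<Rightarrow> ('d::finite) pseries topology"
  where "inductive_limit_topology s = topology (\<lambda>U.
    U \<subseteq> (\<Union>r\<in>pos_vecs. banach s r) \<and>
    (\<forall>x\<in>U. \<exists>V. inductive_nbhd s V \<and> (\<forall>v\<in>V. (\<lambda>\<alpha>. x \<alpha> + v \<alpha>) \<in> U)))"

lemma inductive_nbhd_Int:
  fixes V W :: "('d::finite) pseries set"
  assumes "inductive_nbhd s V" "inductive_nbhd s W"
  shows "inductive_nbhd s (V \<inter> W)"
  unfolding inductive_nbhd_def
proof (intro conjI ballI)
  show "V \<inter> W \<subseteq> (\<Union>r\<in>pos_vecs. banach s r)" "absolutely_convex (V \<inter> W)"
    using assms by (auto simp: inductive_nbhd_def absolutely_convex_def)
next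
  fix r :: "real ^ 'd" assume "r \<in> pos_vecs"
  then obtain A B where "openin (banach_topology s r) A" "(\<lambda>\<alpha>. 0) \<in> A" "A \<subseteq> V"
    and "openin (banach_topology s r) B" "(\<lambda>\<alpha>. 0) \<in> B" "B \<subseteq> W"
    using assms unfolding inductive_nbhd_def by blast
  then show "\<exists>U. openin (banach_topology s r) U \<and> (\<lambda>\<alpha>. 0) \<in> U \<and> U \<subseteq> V \<inter> W"
    by (intro exI[of _ "A \<inter> B"]) auto
qed

lemma openin_inductive_limit_topology:
  fixes U :: "('d::finite) pseries set"
  shows "openin (inductive_limit_topology s) U \<longleftrightarrow>
    U \<subseteq> (\<Union>r\<in>pos_vecs. banach s r) \<and>
    (\<forall>x\<in>U. \<exists>V. inductive_nbhd s V \<and> (\<forall>v\<in>V. (\<lambda>\<alpha>. x \<alpha> + v \<alpha>) \<in> U))"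
proof -
  let ?P = "\<lambda>U :: 'd pseries set. U \<subseteq> (\<Union>r\<in>pos_vecs. banach s r) \<and>
    (\<forall>x\<in>U. \<exists>V. inductive_nbhd s V \<and> (\<forall>v\<in>V. (\<lambda>\<alpha>. x \<alpha> + v \<alpha>) \<in> U))"
  have "istopology ?P"
    unfolding istopology_def
  proof (intro conjI allI impI)
    fix S T :: "'d pseries set" assume S: "?P S" and T: "?P T"
    show "S \<inter> T \<subseteq> (\<Union>r\<in>pos_vecs. banach s r)" using S by auto
    show "\<forall>x\<in>S \<inter> T. \<exists>V. inductive_nbhd s V \<and> (\<forall>v\<in>V. (\<lambda>\<alpha>. x \<alpha> + v \<alpha>) \<in> S \<inter> T)"
    proof
      fix x assume "x \<in> S \<inter> T"
      then obtain V W where "inductive_nbhd s V" "\<forall>v\<in>V. (\<lambda>\<alpha>. x \<alpha> + v \<alpha>) \<in> S"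
        and "inductive_nbhd s W" "\<forall>v\<in>W. (\<lambda>\<alpha>. x \<alpha> + v \<alpha>) \<in> T"
        using S T by blast
      moreover from this have "inductive_nbhd s (V \<inter> W)" by (intro inductive_nbhd_Int)
      ultimately show "\<exists>V. inductive_nbhd s V \<and> (\<forall>v\<in>V. (\<lambda>\<alpha>. x \<alpha> + v \<alpha>) \<in> S \<inter> T)"
        by (intro exI[of _ "V \<inter> W"]) simp
    qed
  next
    fix K :: "'d pseries set set" assume K: "\<forall>S\<in>K. ?P S"
    show "\<Union>K \<subseteq> (\<Union>r\<in>pos_vecs. banach s r)" using K by blast
    show "\<forall>x\<in>\<Union>K. \<exists>V. inductive_nbhd s V \<and> (\<forall>v\<in>V. (\<lambda>\<alpha>. x \<alpha> + v \<alpha>) \<in> \<Union>K)"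
    proof
      fix x assume "x \<in> \<Union>K"
      then obtain S where "S \<in> K" "x \<in> S" by blast
      with K obtain V where "inductive_nbhd s V" "\<forall>v\<in>V. (\<lambda>\<alpha>. x \<alpha> + v \<alpha>) \<in> S" by blast
      with \<open>S \<in> K\<close> show "\<exists>V. inductive_nbhd s V \<and> (\<forall>v\<in>V. (\<lambda>\<alpha>. x \<alpha> + v \<alpha>) \<in> \<Union>K)" by blast
    qed
  qed
  then show ?thesis
    unfolding inductive_limit_topology_def by (simp add: topology_inverse')
qed

definition projective_limit_topology :: "real \<Rightarrow> ('d::finite) pseries topology"
  where "projective_limit_topology s = topology_generated_by
    {U \<inter> (\<Inter>r\<in>pos_vecs. banach s r) | U r. r \<in> pos_vecs \<and> openin (banach_topology s r) U}"

lemma weight_pos: "r \<in> pos_vecs \<Longrightarrow> 0 < weight s r \<alpha>"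
  unfolding weight_def mpower_def mfact_def pos_vecs_def
  by (auto intro!: mult_pos_pos prod_pos simp: prod_pos less_imp_neq[symmetric] prod_zero_iff)

lemma banach_iff:
  assumes r: "r \<in> pos_vecs"
  shows "c \<in> banach s r \<longleftrightarrow> (\<lambda>\<alpha>. norm (c \<alpha>)) \<lesssim> weight s r"
proof
  assume "c \<in> banach s r"
  then obtain C where C: "\<And>\<alpha>. norm (c \<alpha>) / weight s r \<alpha> \<le> C"
    unfolding banach_def bdd_above_def by auto
  have "norm (c \<alpha>) \<le> max C 1 * weight s r \<alpha>" for \<alpha>
    using C[of \<alpha>] weight_pos[OF r, of s \<alpha>]
    by (simp add: divide_le_eq) (smt (verit) mult_right_mono)
  then show "(\<lambda>\<alpha>. norm (c \<alpha>)) \<lesssim> weight s r"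
    unfolding lesssim_def by (intro exI[of _ "max C 1"]) auto
next
  assume "(\<lambda>\<alpha>. norm (c \<alpha>)) \<lesssim> weight s r"
  then obtain C where C: "\<And>\<alpha>. norm (c \<alpha>) \<le> C * weight s r \<alpha>"
    unfolding lesssim_def by auto
  show "c \<in> banach s r" unfolding banach_def bdd_above_def
    using C weight_pos[OF r] by (auto intro!: exI[of _ C] simp: divide_le_eq)
qed

lemma banach_lincomb:
  assumes r: "r \<in> pos_vecs" and b: "b \<in> banach s r" and c: "c \<in> banach s r"
  shows "(\<lambda>\<alpha>. x * b \<alpha> + y * c \<alpha>) \<in> banach s r"
proof -
  from b c obtain B C where B: "\<And>\<alpha>. norm (b \<alpha>) / weight s r \<alpha> \<le> B"
    and C: "\<And>\<alpha>. norm (c \<alpha>) / weight s r \<alpha> \<le> C" unfolding banach_def bdd_above_def by auto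
  have "norm (x * b \<alpha> + y * c \<alpha>) / weight s r \<alpha> \<le> norm x * B + norm y * C" for \<alpha>
  proof -
    have "norm (x * b \<alpha> + y * c \<alpha>) / weight s r \<alpha>
      \<le> (norm x * norm (b \<alpha>) + norm y * norm (c \<alpha>)) / weight s r \<alpha>"
      using weight_pos[OF r, of s \<alpha>]
      by (intro divide_right_mono) (auto simp: norm_mult[symmetric] norm_triangle_ineq)
    also have "\<dots> = norm x * (norm (b \<alpha>) / weight s r \<alpha>) + norm y * (norm (c \<alpha>) / weight s r \<alpha>)"
      by (simp add: add_divide_distrib)
    also have "\<dots> \<le> norm x * B + norm y * C" by (intro add_mono mult_left_mono B C) auto
    finally show ?thesis .
  qed
  then show ?thesis unfolding banach_def bdd_above_def by auto
qed

lemma Metric_space_banach: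
  assumes r: "r \<in> pos_vecs"
  shows "Metric_space (banach s r) (banach_dist s r)"
proof -
  let ?q = "\<lambda>c \<alpha>. norm (c \<alpha>) / weight s r \<alpha>"
  have diff: "(\<lambda>\<alpha>. b \<alpha> - c \<alpha>) \<in> banach s r" if "b \<in> banach s r" "c \<in> banach s r" for b c
    using banach_lincomb[OF r that, of 1 "-1"] by simp
  have up: "?q c \<alpha> \<le> banach_norm s r c" if "c \<in> banach s r" for c \<alpha>
    unfolding banach_norm_def using that by (intro cSUP_upper) (auto simp: banach_def)
  have q0: "0 \<le> ?q c \<alpha>" for c \<alpha> using weight_pos[OF r, of s \<alpha>] by simp
  have n0: "0 \<le> banach_norm s r c" if "c \<in> banach s r" for c
    using up[OF that, of 0] q0[of c 0] by linarith
  have dist: "banach_dist s r b c = banach_norm s r (\<lambda>\<alpha>. b \<alpha> - c \<alpha>)"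
    if "b \<in> banach s r" "c \<in> banach s r" for b c
    using n0[OF diff[OF that]] by (simp add: banach_dist_def)
  show ?thesis
  proof
    show "0 \<le> banach_dist s r b c" for b c by (simp add: banach_dist_def)
    show "banach_dist s r b c = banach_dist s r c b" for b c
      by (simp add: banach_dist_def banach_norm_def norm_minus_commute)
    show "banach_dist s r b c = 0 \<longleftrightarrow> b = c" if bc: "b \<in> banach s r" "c \<in> banach s r" for b c
    proof
      assume "banach_dist s r b c = 0"
      then have "?q (\<lambda>\<alpha>. b \<alpha> - c \<alpha>) \<alpha> \<le> 0" for \<alpha>
        using up[OF diff[OF bc], of \<alpha>] dist[OF bc] by simp
      then have "norm (b \<alpha> - c \<alpha>) / weight s r \<alpha> \<le> 0" for \<alpha> .
      then have "norm (b \<alpha> - c \<alpha>) \<le> 0" for \<alpha>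
        using weight_pos[OF r, of s \<alpha>] by (meson divide_pos_pos not_le)
      then show "b = c" by (intro ext) simp
    qed (simp add: banach_dist_def banach_norm_def)
    show "banach_dist s r b d \<le> banach_dist s r b c + banach_dist s r c d"
      if b: "b \<in> banach s r" and c: "c \<in> banach s r" and d: "d \<in> banach s r" for b c d
      unfolding dist[OF b c] dist[OF b d] dist[OF c d]
    proof (subst (1) banach_norm_def, rule cSUP_least)
      fix \<alpha>
      have "?q (\<lambda>\<alpha>. b \<alpha> - d \<alpha>) \<alpha> \<le> (norm (b \<alpha> - c \<alpha>) + norm (c \<alpha> - d \<alpha>)) / weight s r \<alpha>"
        using weight_pos[OF r, of s \<alpha>] norm_triangle_ineq[of "b \<alpha> - c \<alpha>" "c \<alpha> - d \<alpha>"]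
        by (intro divide_right_mono) auto
      also have "\<dots> = ?q (\<lambda>\<alpha>. b \<alpha> - c \<alpha>) \<alpha> + ?q (\<lambda>\<alpha>. c \<alpha> - d \<alpha>) \<alpha>"
        by (simp add: add_divide_distrib)
      also have "\<dots> \<le> banach_norm s r (\<lambda>\<alpha>. b \<alpha> - c \<alpha>) + banach_norm s r (\<lambda>\<alpha>. c \<alpha> - d \<alpha>)"
        by (intro add_mono up diff b c d)
      finally show "?q (\<lambda>\<alpha>. b \<alpha> - d \<alpha>) \<alpha> \<le> \<dots>" .
    qed simp
  qed
qed

lemma topspace_banach_topology: "r \<in> pos_vecs \<Longrightarrow> topspace (banach_topology s r) = banach s r"
  unfolding banach_topology_def
  by (rule Metric_space.topspace_mtopology[OF Metric_space_banach])

lemma banach_mono: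
  assumes r: "r \<in> pos_vecs" and r': "r' \<in> pos_vecs" and "r \<le> r'"
  shows "banach s r \<subseteq> banach s r'"
proof
  fix c assume "c \<in> banach s r"
  then obtain C where C: "C > 0" "\<And>\<alpha>. norm (c \<alpha>) \<le> C * weight s r \<alpha>"
    using banach_iff[OF r] unfolding lesssim_def by auto
  have "weight s r \<alpha> \<le> weight s r' \<alpha>" for \<alpha>
    unfolding weight_def mpower_def
    using r \<open>r \<le> r'\<close> by (intro mult_right_mono prod_mono)
      (auto simp: pos_vecs_def less_eq_vec_def less_imp_le intro!: power_mono)
  then have "norm (c \<alpha>) \<le> C * weight s r' \<alpha>" for \<alpha>
    using C by (meson mult_left_mono less_imp_le order_trans)
  then show "c \<in> banach s r'" using banach_iff[OF r'] C(1) unfolding lesssim_def by blast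
qed

lemma topspace_inductive_limit_topology:
  "topspace (inductive_limit_topology s) = (\<Union>r\<in>pos_vecs. banach s (r :: real ^ 'd))" (is "_ = ?E")
proof -
  have sup: "(\<lambda>\<alpha>. x * b \<alpha> + y * c \<alpha>) \<in> ?E" if "b \<in> ?E" "c \<in> ?E" for b c :: "'d pseries" and x y
  proof -
    from that obtain r1 r2 where r: "r1 \<in> pos_vecs" "b \<in> banach s r1" "r2 \<in> pos_vecs" "c \<in> banach s r2"
      by blast
    define r :: "real ^ 'd" where "r = (\<chi> j. max (r1 $ j) (r2 $ j))"
    have "r \<in> pos_vecs" "r1 \<le> r" "r2 \<le> r"
      using r by (auto simp: r_def pos_vecs_def less_eq_vec_def less_max_iff_disj)
    then show ?thesis
      using banach_lincomb[of r b s c x y] banach_mono[of r1 r s] banach_mono[of r2 r s] r by blast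
  qed
  have zero: "(\<lambda>\<alpha>. 0) \<in> banach s r" for r :: "real ^ 'd"
    by (simp add: banach_def)
  have "inductive_nbhd s ?E"
    unfolding inductive_nbhd_def
  proof (intro conjI ballI)
    show "absolutely_convex ?E" unfolding absolutely_convex_def using sup by blast
    fix r :: "real ^ 'd" assume "r \<in> pos_vecs"
    then show "\<exists>U. openin (banach_topology s r) U \<and> (\<lambda>\<alpha>. 0) \<in> U \<and> U \<subseteq> ?E"
      using zero topspace_banach_topology[of r s]
      by (intro exI[of _ "banach s r"]) (metis UN_upper openin_topspace)
  qed simp
  moreover have "(\<lambda>\<alpha>. b \<alpha> + c \<alpha>) \<in> ?E" if "b \<in> ?E" "c \<in> ?E" for b c
    using sup[OF that, of 1 1] by simp
  ultimately have "openin (inductive_limit_topology s) ?E"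
    unfolding openin_inductive_limit_topology by blast
  moreover have "topspace (inductive_limit_topology s) \<subseteq> ?E"
    using openin_inductive_limit_topology openin_topspace by blast
  ultimately show ?thesis by (simp add: openin_subset subset_antisym)
qed

lemma topspace_projective_limit_topology:
  "topspace (projective_limit_topology s) = (\<Inter>r\<in>pos_vecs. banach s (r :: real ^ 'd))"
proof -
  have one: "(\<chi> j. 1) \<in> (pos_vecs :: (real ^ 'd) set)" by (simp add: pos_vecs_def)
  then have "openin (banach_topology s ((\<chi> j. 1) :: real ^ 'd)) (banach s (\<chi> j. 1))"
    using topspace_banach_topology by (metis openin_topspace)
  then show ?thesis
    unfolding projective_limit_topology_def topology_generated_by_topspace using one by blast
qed


section \<open>The spaces\<close>

definition A_flat :: "real \<Rightarrow> ('d::finite) pseries set"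
  where "A_flat \<sigma> = {c. \<exists>r\<in>pos_vecs.
    (\<lambda>\<alpha>. norm (c \<alpha>)) \<lesssim> (\<lambda>\<alpha>. mpower r \<alpha> * mfact \<alpha> powr (- 1 / (2 * \<sigma>)))}"

definition A0_flat :: "real \<Rightarrow> ('d::finite) pseries set"
  where "A0_flat \<sigma> = {c. \<forall>r\<in>pos_vecs.
    (\<lambda>\<alpha>. norm (c \<alpha>)) \<lesssim> (\<lambda>\<alpha>. mpower r \<alpha> * mfact \<alpha> powr (- 1 / (2 * \<sigma>)))}"

definition A_flat' :: "real \<Rightarrow> ('d::finite) pseries set"
  where "A_flat' \<sigma> = {c. \<forall>r\<in>pos_vecs.
    (\<lambda>\<alpha>. norm (c \<alpha>)) \<lesssim> (\<lambda>\<alpha>. mpower r \<alpha> * mfact \<alpha> powr (1 / (2 * \<sigma>)))}"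

definition A0_flat' :: "real \<Rightarrow> ('d::finite) pseries set"
  where "A0_flat' \<sigma> = {c. \<exists>r\<in>pos_vecs.
    (\<lambda>\<alpha>. norm (c \<alpha>)) \<lesssim> (\<lambda>\<alpha>. mpower r \<alpha> * mfact \<alpha> powr (1 / (2 * \<sigma>)))}"

text \<open>
  The spaces as topological spaces of entire functions. No series is lost for the primed spaces as
  long as $\sigma > 1$.
\<close>

definition entire_topology :: "'d pseries topology \<Rightarrow> (complex ^ 'd \<Rightarrow> complex) topology"
  where "entire_topology T = pullback_topology entire power_series T"

definition A_flat_space :: "real \<Rightarrow> (complex ^ 'd \<Rightarrow> complex) topology"
  where "A_flat_space \<sigma> = entire_topology (inductive_limit_topology (- 1 / (2 * \<sigma>)))"

definition A0_flat_space :: "real \<Rightarrow> (complex ^ 'd \<Rightarrow> complex) topology"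
  where "A0_flat_space \<sigma> = entire_topology (projective_limit_topology (- 1 / (2 * \<sigma>)))"

definition A_flat'_space :: "real \<Rightarrow> (complex ^ 'd \<Rightarrow> complex) topology"
  where "A_flat'_space \<sigma> = entire_topology (projective_limit_topology (1 / (2 * \<sigma>)))"

definition A0_flat'_space :: "real \<Rightarrow> (complex ^ 'd \<Rightarrow> complex) topology"
  where "A0_flat'_space \<sigma> = entire_topology (inductive_limit_topology (1 / (2 * \<sigma>)))"

lemma topspace_entire_topology: "topspace (entire_topology T) = {F \<in> entire. power_series F \<in> topspace T}"
  by (auto simp: entire_topology_def topspace_pullback_topology)

lemma topspace_spaces:
  "topspace (A_flat_space \<sigma>) = {F \<in> entire. power_series F \<in> A_flat \<sigma>}"
  "topspace (A0_flat_space \<sigma>) = {F \<in> entire. power_series F \<in> A0_flat \<sigma>}"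
  "topspace (A_flat'_space \<sigma>) = {F \<in> entire. power_series F \<in> A_flat' \<sigma>}"
  "topspace (A0_flat'_space \<sigma>) = {F \<in> entire. power_series F \<in> A0_flat' \<sigma>}"
  by (auto simp: A_flat_space_def A0_flat_space_def A_flat'_space_def A0_flat'_space_def
      topspace_entire_topology topspace_inductive_limit_topology topspace_projective_limit_topology
      A_flat_def A0_flat_def A_flat'_def A0_flat'_def banach_iff weight_def[abs_def])

section \<open>Radial cutoffs and the Bargmann projection\<close>

text \<open>
  Elements of $L^\infty$ are represented by Lebesgue measurable functions, and all conditions on
  them are understood almost everywhere.
\<close>

definition R_inf_on :: "real ^ 'd \<Rightarrow> real ^ 'd \<Rightarrow> (complex ^ 'd \<Rightarrow> real) set"
  where "R_inf_on t1 t2 = {h.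
    h \<in> borel_measurable lebesgue \<and>
    (\<exists>B. AE z in lebesgue. \<bar>h z\<bar> \<le> B) \<and>
    (AE z in lebesgue. 0 \<le> h z) \<and>
    (AE z in lebesgue. z \<notin> closure (polydisc t2) \<longrightarrow> h z = 0) \<and>
    (\<exists>f. AE z in lebesgue. h z = f (\<chi> j. norm (z $ j) :: real ^ 'd)) \<and>
    (\<exists>c>0. AE z in lebesgue. z \<in> polydisc t1 \<longrightarrow> c \<le> h z)}"

definition R_inf :: "(complex ^ 'd \<Rightarrow> real) set"
  where "R_inf = (\<Union>t1\<in>pos_vecs. \<Union>t2\<in>{t2\<in>pos_vecs. t1 \<le> t2}. R_inf_on t1 t2)"

definition Pi_A :: "(complex ^ 'd \<Rightarrow> complex) \<Rightarrow> complex ^ 'd \<Rightarrow> complex"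
  where "Pi_A F z = 1 / of_real (pi ^ CARD('d)) *
    (LINT w|lebesgue. F w * exp ((\<Sum>j\<in>UNIV. z $ j * cnj (w $ j)) - of_real ((norm w)\<^sup>2)))"

end

theory Submission
  imports Defs "HOL-Complex_Analysis.Cauchy_Integral_Formula"
begin

text \<open>
  Since \<open>h\<close> and the Gaussian are radial, the monomials \<open>e_monom \<alpha>\<close> are orthogonal for the measure
  \<open>h w * exp (- |w|^2) d\<lambda>(w)\<close>. Expanding both \<open>F\<close> and the reproducing kernel \<open>exp (z, w)\<close> therefore shows that
  $F \mapsto \Pi_A(F h)$ multiplies the coefficient at \<open>\<alpha>\<close> by the moment \<open>m \<alpha>\<close>, the normalised integral of
  $|e_\alpha|^2$. As \<open>h\<close> is bounded below near the origin and supported in a polydisc, \<open>m \<alpha>\<close> lies between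
  two multiples of \<open>q^\<alpha> / \<alpha>!\<close> with different \<open>q\<close>. Such a multiplier shifts the exponent of \<open>\<alpha>!\<close> in the weights by
  exactly \<open>-1\<close>, and $1/(2\sigma_0) - 1 = -1/(2\sigma)$; the ambiguity in \<open>q\<close> is absorbed by the limits over \<open>r\<close>.
  The growth condition is equivalent to the coefficient bounds by summing the series in one direction and by
  Cauchy's estimates with optimised radii in the other.
\<close>

section \<open>Multi-indexed sums of products\<close>

text \<open>The function \<open>h\<close> is radial only almost everywhere and through a profile
  that may fail to be measurable, so polar coordinates are replaced by the action of the torus:
  rotating one coordinate by a suitable angle changes the sign of an off-diagonal integral I, and
  invariance of Lebesgue measure gives I = -I. The dictionary between entire functions and
  coefficients is needed in full: existence of the expansion (one coordinate at a time, with
  Cauchy's estimates carried along), entirety of every convergent series, and uniqueness. Uniqueness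
  comes from the same orthogonality, with the indicator of the unit polydisc as kernel. The relation
  of \<sigma> and its companion says that the primed exponent is 1 - 1/(2\<sigma>). It is below 1/2
  because \<sigma> < 1, so every series in the primed spaces is an entire function, and condition
  (3) becomes surjectivity of the maps in (ii). In the growth condition, the decay of the
  coefficients and the factor 1/sqrt(\<alpha>!) of the monomials combine to \<alpha>!^(-p) with p =
  (\<sigma>+1)/(2\<sigma>) >= 1, whose reciprocal is the order of growth.\<close>

lemma bij_betw_vec_nth_PiE:
  "bij_betw vec_nth (UNIV :: ('a ^ 'd) set) (PiE UNIV (\<lambda>_. UNIV))"
  by (rule bij_betwI[where g = vec_lambda]) auto

text \<open>A finite set of multi-indices lies in the box spanned by its coordinate projections, and
  a sum of products over a box factors into one-variable sums.\<close>

lemma abs_summable_prod_vec: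
  fixes f :: "'d::finite \<Rightarrow> 'b \<Rightarrow> 'c :: {banach, real_normed_field}"
  assumes "\<And>j. f j abs_summable_on UNIV"
  shows "(\<lambda>\<alpha>::'b ^ 'd. \<Prod>j\<in>UNIV. f j (\<alpha> $ j)) abs_summable_on UNIV"
  unfolding abs_summable_iff_bdd_above
proof (rule bdd_aboveI2)
  fix X :: "('b ^ 'd) set" assume "X \<in> {F. F \<subseteq> UNIV \<and> finite F}"
  then have X: "finite X" by simp
  let ?Y = "\<lambda>j. (\<lambda>\<alpha>. \<alpha> $ j) ` X"
  have "(\<Sum>\<alpha>\<in>X. norm (\<Prod>j\<in>UNIV. f j (\<alpha> $ j))) = (\<Sum>g\<in>vec_nth ` X. \<Prod>j\<in>UNIV. norm (f j (g j)))"
    by (subst sum.reindex) (auto simp: inj_on_def vec_eq_iff fun_eq_iff prod_norm)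
  also have "\<dots> \<le> (\<Sum>g\<in>PiE UNIV ?Y. \<Prod>j\<in>UNIV. norm (f j (g j)))"
    using X by (intro sum_mono2 finite_PiE) (auto intro: prod_nonneg)
  also have "\<dots> = (\<Prod>j\<in>UNIV. \<Sum>n\<in>?Y j. norm (f j n))"
    by (rule prod_sum_PiE[symmetric]) (use X in auto)
  also have "\<dots> \<le> (\<Prod>j\<in>UNIV. infsum (\<lambda>n. norm (f j n)) UNIV)"
    using X assms by (intro prod_mono conjI finite_sum_le_infsum sum_nonneg) auto
  finally show "(\<Sum>\<alpha>\<in>X. norm (\<Prod>j\<in>UNIV. f j (\<alpha> $ j))) \<le> (\<Prod>j\<in>UNIV. infsum (\<lambda>n. norm (f j n)) UNIV)" .
qed

lemma has_sum_prod_vec: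
  fixes f :: "'d::finite \<Rightarrow> 'b \<Rightarrow> 'c :: {banach, real_normed_field}"
  assumes f: "\<And>j. f j abs_summable_on UNIV" and s: "\<And>j. (f j has_sum s j) UNIV"
  shows "((\<lambda>\<alpha>::'b ^ 'd. \<Prod>j\<in>UNIV. f j (\<alpha> $ j)) has_sum (\<Prod>j\<in>UNIV. s j)) UNIV"
proof -
  have "infsum (\<lambda>\<alpha>::'b ^ 'd. \<Prod>j\<in>UNIV. f j (\<alpha> $ j)) UNIV
      = infsum (\<lambda>g. \<Prod>j\<in>UNIV. f j (g j)) (PiE UNIV (\<lambda>_. UNIV))"
    by (rule infsum_reindex_bij_betw[OF bij_betw_vec_nth_PiE])
  also have "\<dots> = (\<Prod>j\<in>UNIV. infsum (f j) UNIV)"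
    by (subst infsum_prod_PiE_abs) (simp_all add: f)
  also have "\<dots> = (\<Prod>j\<in>UNIV. s j)"
    by (simp add: infsumI[OF s])
  \<comment> \<open>\<open>infsum\<close> has the default value 0 on families that are not summable,
    so the equation of sums yields \<open>has_sum\<close> only together with summability.\<close>
  finally show ?thesis
    using abs_summable_summable[OF abs_summable_prod_vec[of f, OF f]]
    by (metis has_sum_infsum)
qed

section \<open>Power series expansion of entire functions\<close>

text \<open>The counterpart of function update for vectors. It serves points and multi-indices
  alike; \<open>vec_upd \<alpha> j 0\<close> removes the j-th exponent.\<close>

definition vec_upd :: "'a ^ 'd \<Rightarrow> 'd \<Rightarrow> 'a \<Rightarrow> 'a ^ 'd"
  where "vec_upd z j x = (\<chi> i. if i = j then x else z $ i)"

lemma vec_upd_nth: "vec_upd z j x $ i = (if i = j then x else z $ i)"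
  by (simp add: vec_upd_def)

lemma vec_upd_nth_same [simp]: "vec_upd z j x $ j = x"
  by (simp add: vec_upd_nth)

lemma vec_upd_upd [simp]: "vec_upd (vec_upd z j x) j y = vec_upd z j y"
  by (simp add: vec_upd_def vec_eq_iff)

lemma vec_upd_commute: "i \<noteq> j \<Longrightarrow> vec_upd (vec_upd z i x) j y = vec_upd (vec_upd z j y) i x"
  by (simp add: vec_upd_def vec_eq_iff)

lemma vec_upd_triv [simp]: "vec_upd z j (z $ j) = z"
  by (simp add: vec_upd_def vec_eq_iff)

lemma continuous_on_vec_upd [continuous_intros]:
  fixes f :: "'a::topological_space \<Rightarrow> ('b::topological_space) ^ 'd"
  assumes "continuous_on S f" "continuous_on S g"
  shows "continuous_on S (\<lambda>x. vec_upd (f x) j (g x))"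
proof -
  have "continuous_on S (\<lambda>x. if i = j then g x else f x $ i)" for i
    using assms by (cases "i = j") (auto intro!: continuous_intros)
  then show ?thesis unfolding vec_upd_def by (intro continuous_on_vec_lambda)
qed

lemma mpower_upd:
  fixes z :: "'a::comm_monoid_mult ^ 'd"
  shows "mpower z \<alpha> = z $ j ^ (\<alpha> $ j) * mpower z (vec_upd \<alpha> j 0)"
proof -
  have "mpower z \<alpha> = z $ j ^ (\<alpha> $ j) * (\<Prod>i\<in>UNIV - {j}. z $ i ^ (\<alpha> $ i))"
    unfolding mpower_def by (subst prod.remove[of _ j]) auto
  also have "(\<Prod>i\<in>UNIV - {j}. z $ i ^ (\<alpha> $ i)) = mpower z (vec_upd \<alpha> j 0)"
    unfolding mpower_def by (subst prod.remove[of UNIV j]) (auto simp: vec_upd_nth intro!: prod.cong)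
  finally show ?thesis .
qed

lemma mpower_cong: "(\<And>j. \<alpha> $ j \<noteq> 0 \<Longrightarrow> z $ j = w $ j) \<Longrightarrow> mpower z \<alpha> = mpower w \<alpha>"
  unfolding mpower_def by (intro prod.cong refl) (metis power_0)

lemma norm_mpower: "norm (mpower z \<alpha>) = mpower (\<chi> j. norm (z $ j)) \<alpha>"
  for z :: "'a::{real_normed_field} ^ 'd"
  by (simp add: mpower_def prod_norm[symmetric] norm_power)

lemma mpower_pos: "r \<in> pos_vecs \<Longrightarrow> 0 < mpower r \<alpha>"
  unfolding mpower_def pos_vecs_def by (intro prod_pos) auto

text \<open>The induction invariant for the expansion: unlike total differentiability it passes
  easily to Taylor coefficients in one variable. Joint continuity is included because parameter
  integrals and the exchange of contour integrals rest on it.\<close>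

definition sep_holomorphic :: "(complex ^ 'd \<Rightarrow> complex) \<Rightarrow> bool"
  where "sep_holomorphic F \<longleftrightarrow> continuous_on UNIV F \<and>
    (\<forall>z j. (\<lambda>x. F (vec_upd z j x)) holomorphic_on UNIV)"

lemma sep_holomorphic_imp_holomorphic_on:
  assumes "sep_holomorphic F"
  shows "(\<lambda>x. F (vec_upd z j x)) holomorphic_on S"
proof (rule holomorphic_on_subset)
  show "(\<lambda>x. F (vec_upd z j x)) holomorphic_on UNIV"
    using assms by (simp add: sep_holomorphic_def)
qed simp

lemma entire_imp_continuous_on:
  assumes "F \<in> entire" shows "continuous_on S F"
proof -
  have "isCont F z" for z using assms has_derivative_continuous unfolding entire_def by blast
  then show ?thesis by (simp add: continuous_at_imp_continuous_on)
qed

text \<open>By the chain rule along the complex line in direction j the derivative is x -> D(x e_j);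
  complex homogeneity of D makes it multiplication by D(e_j).\<close>

lemma entire_imp_sep_holomorphic:
  assumes F: "F \<in> entire" shows "sep_holomorphic F"
  unfolding sep_holomorphic_def
proof (intro conjI allI)
  show "continuous_on UNIV F" by (rule entire_imp_continuous_on[OF F])
  fix z :: "complex ^ 'a" and j
  have eq: "vec_upd z j x = vec_upd z j 0 + x *s axis j 1" for x
    by (auto simp: vec_eq_iff vec_upd_nth axis_def)
  have bl: "bounded_linear (\<lambda>x::complex. x *s (axis j 1 :: complex ^ 'a))"
  proof (rule linear_conv_bounded_linear[THEN iffD1], rule linearI)
    fix b1 b2 :: complex
    show "(b1 + b2) *s axis j 1 = b1 *s axis j 1 + b2 *s (axis j 1 :: complex ^ 'a)"
      by (simp add: vec_eq_iff algebra_simps)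
  next
    fix r :: real and b :: complex
    show "(r *\<^sub>R b) *s axis j 1 = r *\<^sub>R (b *s (axis j 1 :: complex ^ 'a))"
      by (simp add: vec_eq_iff)
  qed
  have "(\<lambda>x. F (vec_upd z j x)) field_differentiable at x" for x
  proof -
    obtain D where D: "(F has_derivative D) (at (vec_upd z j x))" "\<And>a v. D (a *s v) = a * D v"
      using F unfolding entire_def by blast
    have "((\<lambda>x. vec_upd z j 0 + x *s axis j 1) has_derivative (\<lambda>x. x *s axis j 1)) (at x)"
      using bounded_linear_imp_has_derivative[OF bl] by (auto intro!: derivative_eq_intros)
    then have "((\<lambda>x. vec_upd z j x) has_derivative (\<lambda>x. x *s axis j 1)) (at x)"
      by (simp add: eq[symmetric])
    from has_derivative_compose[OF this D(1)]
    have "((\<lambda>x. F (vec_upd z j x)) has_derivative (\<lambda>x. D (axis j 1) * x)) (at x)"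
      by (simp add: D(2) mult.commute)
    then show ?thesis
      unfolding field_differentiable_def has_field_derivative_def by blast
  qed
  then show "(\<lambda>x. F (vec_upd z j x)) holomorphic_on UNIV"
    by (simp add: holomorphic_on_def field_differentiable_at_within)
qed

section \<open>Taylor coefficients in a single variable\<close>

text \<open>The coefficient remains a function on the whole space that ignores coordinate j, so that
  it can be expanded again without a change of type.\<close>

definition coord_coeff :: "'d \<Rightarrow> nat \<Rightarrow> (complex ^ 'd \<Rightarrow> complex) \<Rightarrow> complex ^ 'd \<Rightarrow> complex"
  where "coord_coeff j n F z = (deriv ^^ n) (\<lambda>x. F (vec_upd z j x)) 0 / fact n"

lemma coord_coeff_vec_upd [simp]: "coord_coeff j n F (vec_upd z j x) = coord_coeff j n F z"
  by (simp add: coord_coeff_def)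

lemma coord_coeff_sums:
  assumes "sep_holomorphic F"
  shows "(\<lambda>n. coord_coeff j n F z * z $ j ^ n) sums F z"
proof -
  from holomorphic_power_series[OF sep_holomorphic_imp_holomorphic_on[OF assms, of z j "ball 0 (norm (z $ j) + 1)"], of "z $ j"]
  show ?thesis
    by (simp add: coord_coeff_def)
qed

lemma norm_coord_coeff_le:
  assumes F: "sep_holomorphic F" and r: "0 < r" and M: "\<And>x. norm x = r \<Longrightarrow> norm (F (vec_upd z j x)) \<le> M"
  shows "norm (coord_coeff j n F z) \<le> M / r ^ n"
proof -
  note h = sep_holomorphic_imp_holomorphic_on[OF F]
  have "norm ((deriv ^^ n) (\<lambda>x. F (vec_upd z j x)) 0) \<le> fact n * M / r ^ n"
    by (rule Cauchy_inequality[OF h holomorphic_on_imp_continuous_on[OF h] r]) (simp add: M)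
  then show ?thesis by (simp add: coord_coeff_def norm_divide field_simps)
qed

lemma continuous_on_contour_integral_param:
  fixes f :: "'a::topological_space \<Rightarrow> complex \<Rightarrow> complex"
  assumes f: "continuous_on (U \<times> path_image g) (\<lambda>(x, u). f x u)"
    and g: "path g" "continuous_on {0..1} (\<lambda>t. vector_derivative g (at t))"
  shows "continuous_on U (\<lambda>x. contour_integral g (f x))"
proof -
  have "continuous_on (U \<times> {0..1}) (\<lambda>(x, t). f x (g t) * vector_derivative g (at t))"
  proof -
    have "continuous_on (U \<times> {0..1}) (\<lambda>p. (fst p, g (snd p)))"
      by (intro continuous_on_Pair continuous_on_fst continuous_on_snd continuous_on_id
          continuous_on_compose2[OF g(1)[unfolded path_def]]) auto
    moreover have "(\<lambda>p. (fst p, g (snd p))) ` (U \<times> {0..1}) \<subseteq> U \<times> path_image g"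
      by (auto simp: path_image_def)
    ultimately have 1: "continuous_on (U \<times> {0..1}) (\<lambda>p. f (fst p) (g (snd p)))"
      using continuous_on_compose2[OF f] by fastforce
    have 2: "continuous_on (U \<times> {0..1}) (\<lambda>p. vector_derivative g (at (snd p)))"
      by (intro continuous_on_compose2[OF g(2)] continuous_on_snd continuous_on_id) auto
    show ?thesis using continuous_on_mult[OF 1 2] by (simp add: case_prod_unfold)
  qed
  then show ?thesis
    unfolding contour_integral_integral
    using integral_continuous_on_param[of U 0 "1::real" "\<lambda>x t. f x (g t) * vector_derivative g (at t)"]
    by simp
qed

text \<open>The iterated derivative hides how the coefficient depends on \<open>z\<close>; as an
  integral over the unit circle it is visibly continuous in \<open>z\<close> and accessible to
  Morera's theorem.\<close>

lemma coord_coeff_eq_contour_integral: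
  assumes "sep_holomorphic F"
  shows "coord_coeff j n F z =
    contour_integral (circlepath 0 1) (\<lambda>u. F (vec_upd z j u) / u ^ Suc n) / (2 * of_real pi * \<i>)"
proof -
  note h = sep_holomorphic_imp_holomorphic_on[OF assms]
  have "contour_integral (circlepath 0 1) (\<lambda>u. F (vec_upd z j u) / (u - 0) ^ Suc n)
      = (2 * pi * \<i>) * (deriv ^^ n) (\<lambda>x. F (vec_upd z j x)) 0 / fact n"
    by (rule Cauchy_contour_integral_circlepath[OF holomorphic_on_imp_continuous_on[OF h] h]) simp
  then show ?thesis by (simp add: coord_coeff_def)
qed

lemma continuous_on_vector_derivative_circlepath:
  "continuous_on {0..1} (\<lambda>t. vector_derivative (circlepath 0 1) (at t))"
  by (simp add: vector_derivative_circlepath) (intro continuous_intros)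

text \<open>Holomorphy in the remaining variables follows from Morera's theorem by swapping two contour integrals.\<close>

lemma sep_holomorphic_coord_coeff:
  fixes F :: "complex ^ 'd \<Rightarrow> complex"
  assumes F: "sep_holomorphic F"
  shows "sep_holomorphic (coord_coeff j n F)"
proof -
  let ?c = "circlepath 0 1" and ?C = "2 * of_real pi * \<i> :: complex"
  let ?G = "\<lambda>z. contour_integral ?c (\<lambda>u. F (vec_upd z j u) / u ^ Suc n)"
  have Fc: "continuous_on UNIV F"
    using F by (simp add: sep_holomorphic_def)
  have nz: "u \<noteq> 0" if "u \<in> path_image ?c" for u using that by auto
  have cc: "coord_coeff j n F = (\<lambda>z. ?G z / ?C)"
    using coord_coeff_eq_contour_integral[OF F] by blast
  have contG: "continuous_on UNIV ?G"
  proof (rule continuous_on_contour_integral_param)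
    show "continuous_on (UNIV \<times> path_image ?c) (\<lambda>(z, u). F (vec_upd z j u) / u ^ Suc n)"
      unfolding case_prod_unfold
      by (intro continuous_intros continuous_on_compose2[OF Fc]) (auto simp: nz)
  qed (auto intro: continuous_on_vector_derivative_circlepath)
  have holG: "(\<lambda>x. ?G (vec_upd z k x)) holomorphic_on UNIV" for z k
  proof (cases "k = j")
    case False
    let ?f = "\<lambda>x u. F (vec_upd (vec_upd z k x) j u) / u ^ Suc n"
    let ?T = "\<lambda>a b u. contour_integral (linepath a b) (\<lambda>x. ?f x u)"
    have fc: "continuous_on (UNIV \<times> path_image ?c) (\<lambda>(x, u). ?f x u)"
      unfolding case_prod_unfold
      by (intro continuous_intros continuous_on_compose2[OF Fc]) (auto simp: nz)
    have fc': "continuous_on (path_image ?c \<times> UNIV) (\<lambda>(u, x). ?f x u)"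
      unfolding case_prod_unfold
      by (intro continuous_intros continuous_on_compose2[OF Fc]) (auto simp: nz)
    have swap: "contour_integral (linepath a b) (\<lambda>x. contour_integral ?c (?f x)) = contour_integral ?c (?T a b)" for a b
    proof (rule contour_integral_swap)
      show "continuous_on (path_image (linepath a b) \<times> path_image ?c) (\<lambda>(x, u). ?f x u)"
        by (rule continuous_on_subset[OF fc]) auto
    qed (auto intro: continuous_on_vector_derivative_circlepath)
    have Tint: "?T a b contour_integrable_on ?c" for a b
    proof (rule contour_integrable_continuous_circlepath)
      show "continuous_on (path_image ?c) (?T a b)"
      proof (rule continuous_on_contour_integral_param)
        show "continuous_on (path_image ?c \<times> path_image (linepath a b)) (\<lambda>(u, x). ?f x u)"
          by (rule continuous_on_subset[OF fc']) auto
      qed auto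
    qed
    have hol: "(\<lambda>x. ?f x u) holomorphic_on S" for u S
    proof -
      have "(\<lambda>x. F (vec_upd (vec_upd z j u) k x)) holomorphic_on S"
        by (rule sep_holomorphic_imp_holomorphic_on[OF F])
      then have "(\<lambda>x. F (vec_upd (vec_upd z j u) k x) * (1 / u ^ Suc n)) holomorphic_on S"
        by (intro holomorphic_intros)
      then show ?thesis using False by (simp add: vec_upd_commute divide_inverse)
    qed
    \<comment> \<open>For fixed u on the circle the integrand is holomorphic in x, so Cauchy's
      theorem makes the triangle integral vanish before the integration over u.\<close>
    have T0: "?T a b u + ?T b c u + ?T c a u = 0" for a b c u
    proof -
      have *: "(\<lambda>x. ?f x u) contour_integrable_on linepath a b" for a b
        by (rule contour_integrable_continuous_linepath[OF holomorphic_on_imp_continuous_on[OF hol]])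
      have "((\<lambda>x. ?f x u) has_contour_integral 0) (linepath a b +++ linepath b c +++ linepath c a)"
        by (rule Cauchy_theorem_triangle[OF hol])
      then have "contour_integral (linepath a b +++ linepath b c +++ linepath c a) (\<lambda>x. ?f x u) = 0"
        by (rule contour_integral_unique)
      then show ?thesis using * by (simp add: contour_integrable_joinI add.assoc)
    qed
    have "(\<lambda>x. contour_integral ?c (?f x)) analytic_on UNIV"
    proof (rule Morera_triangle)
      show "continuous_on UNIV (\<lambda>x. contour_integral ?c (?f x))"
        by (rule continuous_on_contour_integral_param[OF fc])
          (auto intro: continuous_on_vector_derivative_circlepath)
      fix a b c
      have "contour_integral ?c (?T a b) + contour_integral ?c (?T b c) + contour_integral ?c (?T c a)
          = contour_integral ?c (\<lambda>u. ?T a b u + ?T b c u + ?T c a u)"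
        by (simp only: contour_integral_add Tint contour_integrable_add)
      also have "\<dots> = 0" by (simp only: T0) simp
      finally have *: "contour_integral ?c (?T a b) + contour_integral ?c (?T b c) + contour_integral ?c (?T c a) = 0" .
      show "convex hull {a, b, c} \<subseteq> UNIV \<longrightarrow>
          contour_integral (linepath a b) (\<lambda>x. contour_integral ?c (?f x)) +
          contour_integral (linepath b c) (\<lambda>x. contour_integral ?c (?f x)) +
          contour_integral (linepath c a) (\<lambda>x. contour_integral ?c (?f x)) = 0"
        unfolding swap by (rule impI) (rule *)
    qed simp
    then show ?thesis by (rule analytic_imp_holomorphic)
  \<comment> \<open>The remaining case is k = j, where the function is constant because the second
    update overwrites the first.\<close>
  qed simp
  show ?thesis
    unfolding sep_holomorphic_def cc
  proof (intro conjI allI)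
    show "continuous_on UNIV (\<lambda>z. ?G z / ?C)"
      by (intro continuous_on_divide contG continuous_on_const) simp
    show "(\<lambda>x. ?G (vec_upd z k x) / ?C) holomorphic_on UNIV" for z k
      by (intro holomorphic_on_divide holG holomorphic_on_const) simp
  qed
qed

lemma has_sum_only:
  fixes f :: "'a \<Rightarrow> 'b::{comm_monoid_add, topological_space}"
  assumes "\<And>x. x \<noteq> a \<Longrightarrow> f x = 0"
  shows "(f has_sum f a) UNIV"
proof -
  have "(f has_sum sum f {a}) {a}" by (rule has_sum_finite) simp
  moreover have "(f has_sum sum f {a}) {a} \<longleftrightarrow> (f has_sum sum f {a}) UNIV"
    by (rule has_sum_cong_neutral) (use assms in auto)
  ultimately show ?thesis by simp
qed

section \<open>Joint expansion in all variables\<close>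

lemma compact_closed_polydisc:
  "compact {w :: complex ^ 'd. \<forall>j. norm (w $ j) \<le> R $ j}"
proof -
  let ?K = "{w :: complex ^ 'd. \<forall>j. norm (w $ j) \<le> R $ j}"
  have "norm w \<le> (\<Sum>j\<in>UNIV. R $ j)" if "w \<in> ?K" for w
    using that unfolding norm_vec_def by (intro order_trans[OF L2_set_le_sum] sum_mono) auto
  then have "bounded ?K" unfolding bounded_iff by blast
  moreover have "closed ?K"
    by (intro closed_Collect_all closed_Collect_le continuous_intros)
  ultimately show ?thesis by (simp add: compact_eq_bounded_closed)
qed

lemma bounded_on_closed_polydisc:
  fixes F :: "complex ^ 'd \<Rightarrow> complex"
  assumes "continuous_on UNIV F"
  obtains M where "0 < M" "\<And>w. (\<And>j. norm (w $ j) \<le> R $ j) \<Longrightarrow> norm (F w) \<le> M"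
proof -
  have "bounded (F ` {w. \<forall>j. norm (w $ j) \<le> R $ j})"
    using compact_continuous_image[OF continuous_on_subset[OF assms] compact_closed_polydisc[of R]]
    by (simp add: compact_imp_bounded)
  then obtain M where "0 < M" "\<forall>x\<in>F ` {w. \<forall>j. norm (w $ j) \<le> R $ j}. norm x \<le> M"
    unfolding bounded_pos by blast
  then show thesis by (intro that[of M]) auto
qed

text \<open>Doubling |z_j| in the radius yields a geometric factor 1/2 in each coordinate; the added
  1 keeps the radius positive where z_j = 0.\<close>

lemma abs_summable_Cauchy_bound:
  fixes c :: "nat ^ 'd \<Rightarrow> complex"
  assumes bd: "\<And>\<alpha>. norm (c \<alpha>) * mpower (\<chi> j. 2 * norm (z $ j) + 1) \<alpha> \<le> M"
  shows "(\<lambda>\<alpha>. norm (c \<alpha> * mpower z \<alpha>)) summable_on UNIV"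
proof -
  let ?R = "\<chi> j. 2 * norm (z $ j) + 1"
  have R: "?R \<in> pos_vecs" by (auto simp: pos_vecs_def add_nonneg_pos)
  have "0 \<le> M" using bd[of 0] mpower_pos[OF R, of 0] by (meson less_imp_le norm_ge_zero order_trans zero_le_mult_iff)
  have "(\<lambda>\<alpha>. norm (\<Prod>j\<in>UNIV. (1/2::real) ^ (\<alpha> $ j))) summable_on (UNIV :: (nat ^ 'd) set)"
    by (rule abs_summable_prod_vec) (simp add: norm_power summable_on_UNIV_nonneg_real_iff)
  then have *: "(\<lambda>\<alpha>. norm (M * (\<Prod>j\<in>UNIV. (1/2::real) ^ (\<alpha> $ j)))) summable_on (UNIV :: (nat ^ 'd) set)"
    unfolding norm_mult by (rule summable_on_cmult_right)
  show ?thesis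
  proof (rule Infinite_Sum.abs_summable_on_comparison_test[OF *])
    fix \<alpha> :: "nat ^ 'd"
    have le: "mpower (\<chi> j. norm (z $ j)) \<alpha> \<le> mpower ?R \<alpha> * (\<Prod>j\<in>UNIV. (1/2) ^ (\<alpha> $ j))"
      unfolding mpower_def prod.distrib[symmetric] power_mult_distrib[symmetric]
      by (intro prod_mono conjI power_mono) auto
    have "norm (c \<alpha> * mpower z \<alpha>) = norm (c \<alpha>) * mpower (\<chi> j. norm (z $ j)) \<alpha>"
      by (simp add: norm_mult norm_mpower)
    also have "\<dots> \<le> norm (c \<alpha>) * (mpower ?R \<alpha> * (\<Prod>j\<in>UNIV. (1/2) ^ (\<alpha> $ j)))"
      by (intro mult_left_mono le) auto
    also have "\<dots> = norm (c \<alpha>) * mpower ?R \<alpha> * (\<Prod>j\<in>UNIV. (1/2) ^ (\<alpha> $ j))"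
      by (simp only: mult.assoc)
    also have "\<dots> \<le> M * (\<Prod>j\<in>UNIV. (1/2) ^ (\<alpha> $ j))"
      by (intro mult_right_mono bd prod_nonneg) auto
    finally show "norm (c \<alpha> * mpower z \<alpha>) \<le> norm (M * (\<Prod>j\<in>UNIV. (1/2) ^ (\<alpha> $ j)))"
      by (rule order_trans) simp
  qed
qed

text \<open>Cauchy's estimates for the candidate coefficients \<open>c\<close> on every closed
  polydisc. Quantifying over all bounds \<open>M\<close> avoids a supremum.\<close>

definition Cauchy_bounded :: "(complex ^ 'd \<Rightarrow> complex) \<Rightarrow> (nat ^ 'd \<Rightarrow> complex) \<Rightarrow> bool"
  where "Cauchy_bounded F c \<longleftrightarrow> (\<forall>R\<in>pos_vecs. \<forall>M.
    (\<forall>w. (\<forall>j. norm (w $ j) \<le> R $ j) \<longrightarrow> norm (F w) \<le> M) \<longrightarrow> (\<forall>\<alpha>. norm (c \<alpha>) * mpower R \<alpha> \<le> M))"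

text \<open>Induction on the set of coordinates that may be nonzero: each Taylor coefficient in the
  new variable is expanded in the old ones. The Cauchy bounds are proved along with the expansion
  because they give absolute summability of the joint family, without which the iterated sums could
  not be merged.\<close>

lemma sep_holomorphic_expansion_on:
  fixes F :: "complex ^ 'd \<Rightarrow> complex"
  assumes "finite S" and "sep_holomorphic F"
  shows "\<exists>c. (\<forall>\<alpha> j. j \<notin> S \<longrightarrow> \<alpha> $ j \<noteq> 0 \<longrightarrow> c \<alpha> = 0) \<and> Cauchy_bounded F c \<and>
    (\<forall>z. (\<forall>j. j \<notin> S \<longrightarrow> z $ j = 0) \<longrightarrow> ((\<lambda>\<alpha>. c \<alpha> * mpower z \<alpha>) has_sum F z) UNIV)"
  using assms
proof (induction S arbitrary: F rule: finite_induct)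
  case empty
  let ?c = "\<lambda>\<alpha> :: nat ^ 'd. if \<alpha> = 0 then F 0 else 0"
  have [simp]: "mpower z 0 = 1" for z :: "'b::comm_monoid_mult ^ 'd" by (simp add: mpower_def)
  show ?case
  proof (intro exI[of _ ?c] conjI allI impI)
    show "Cauchy_bounded F ?c" unfolding Cauchy_bounded_def
    proof (intro ballI allI impI)
      fix R :: "real ^ 'd" and M \<alpha>
      assume R: "R \<in> pos_vecs" and M: "\<forall>w. (\<forall>j. norm (w $ j) \<le> R $ j) \<longrightarrow> norm (F w) \<le> M"
      have "norm (F 0) \<le> M" using M R by (simp add: pos_vecs_def less_imp_le)
      moreover from this have "0 \<le> M" using norm_ge_zero order_trans by blast
      ultimately show "norm (?c \<alpha>) * mpower R \<alpha> \<le> M" by simp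
    qed
    fix z :: "complex ^ 'd" assume "\<forall>j. j \<notin> {} \<longrightarrow> z $ j = 0"
    then have "z = 0" by (simp add: vec_eq_iff)
    have "((\<lambda>\<alpha>. ?c \<alpha> * mpower z \<alpha>) has_sum (?c 0 * mpower z 0)) UNIV"
      by (rule has_sum_only) simp
    then show "((\<lambda>\<alpha>. ?c \<alpha> * mpower z \<alpha>) has_sum F z) UNIV" using \<open>z = 0\<close> by simp
  qed (auto simp: vec_eq_iff)
next
  case (insert j S)
  have "\<forall>n. \<exists>c. (\<forall>\<alpha> i. i \<notin> S \<longrightarrow> \<alpha> $ i \<noteq> 0 \<longrightarrow> c \<alpha> = 0) \<and> Cauchy_bounded (coord_coeff j n F) c \<and>
    (\<forall>z. (\<forall>i. i \<notin> S \<longrightarrow> z $ i = 0) \<longrightarrow> ((\<lambda>\<alpha>. c \<alpha> * mpower z \<alpha>) has_sum coord_coeff j n F z) UNIV)"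
    using insert.IH sep_holomorphic_coord_coeff[OF insert.prems] by blast
  then obtain c where c0: "\<And>n \<alpha> i. i \<notin> S \<Longrightarrow> \<alpha> $ i \<noteq> 0 \<Longrightarrow> c n \<alpha> = 0"
    and cb: "\<And>n. Cauchy_bounded (coord_coeff j n F) (c n)"
    and cs: "\<And>n z. (\<And>i. i \<notin> S \<Longrightarrow> z $ i = 0) \<Longrightarrow>
      ((\<lambda>\<alpha>. c n \<alpha> * mpower z \<alpha>) has_sum coord_coeff j n F z) UNIV"
    by metis
  define C where "C \<alpha> = c (\<alpha> $ j) (vec_upd \<alpha> j 0)" for \<alpha>
  have bounded: "Cauchy_bounded F C"
    unfolding Cauchy_bounded_def
  proof (intro ballI allI impI)
    fix R :: "real ^ 'd" and M and \<alpha> :: "nat ^ 'd"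
    assume R: "R \<in> pos_vecs" and M: "\<forall>w. (\<forall>j. norm (w $ j) \<le> R $ j) \<longrightarrow> norm (F w) \<le> M"
    let ?n = "\<alpha> $ j"
    have Rj: "0 < R $ j" using R by (simp add: pos_vecs_def)
    have "norm (coord_coeff j ?n F w) \<le> M / R $ j ^ ?n" if w: "\<And>i. norm (w $ i) \<le> R $ i" for w
      \<comment> \<open>The circle |x| = R_j replaces only coordinate j, so it stays in the polydisc
        where \<open>F\<close> is bounded by \<open>M\<close>. The induction hypothesis then bounds
        the coefficients of this coefficient.\<close>
      by (rule norm_coord_coeff_le[OF insert.prems Rj]) (use M w in \<open>auto simp: vec_upd_nth\<close>)
    then have "norm (C \<alpha>) * mpower R (vec_upd \<alpha> j 0) \<le> M / R $ j ^ ?n"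
      using cb[of ?n] R unfolding Cauchy_bounded_def C_def by blast
    then have "norm (C \<alpha>) * mpower R (vec_upd \<alpha> j 0) * R $ j ^ ?n \<le> M"
      using Rj by (simp add: field_simps)
    then show "norm (C \<alpha>) * mpower R \<alpha> \<le> M"
      by (subst mpower_upd[of R \<alpha> j]) (simp add: mult_ac)
  qed
  have Fc: "continuous_on UNIV F" using insert.prems by (simp add: sep_holomorphic_def)
  have sums: "((\<lambda>\<alpha>. C \<alpha> * mpower z \<alpha>) has_sum F z) UNIV"
    if z: "\<forall>i. i \<notin> insert j S \<longrightarrow> z $ i = 0" for z
  proof -
    let ?R = "\<chi> j. 2 * norm (z $ j) + 1" and ?f = "\<lambda>\<alpha>. C \<alpha> * mpower z \<alpha>"
    obtain M where M: "\<And>w. (\<And>j. norm (w $ j) \<le> ?R $ j) \<Longrightarrow> norm (F w) \<le> M"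
      by (rule bounded_on_closed_polydisc[OF Fc, of ?R]) blast
    have R: "?R \<in> pos_vecs" by (auto simp: pos_vecs_def add_nonneg_pos)
    have "norm (C \<alpha>) * mpower ?R \<alpha> \<le> M" for \<alpha>
      by (rule bounded[unfolded Cauchy_bounded_def, THEN bspec, OF R, THEN spec, THEN mp, THEN spec])
        (intro allI impI M, erule spec)
    then have "(\<lambda>\<alpha>. norm (?f \<alpha>)) summable_on UNIV" by (rule abs_summable_Cauchy_bound)
    \<comment> \<open>At this point only the existence of a sum \<open>s\<close> is known; that it
      equals \<open>F z\<close> follows from summing over the other exponents first.\<close>
    from has_sum_infsum[OF abs_summable_summable[OF this]]
    obtain s where s: "(?f has_sum s) UNIV" by (rule that)
    let ?P = "Sigma UNIV (\<lambda>_::nat. {\<beta> :: nat ^ 'd. \<beta> $ j = 0})"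
    have bij: "bij_betw (\<lambda>(n, \<beta>). vec_upd \<beta> j n) ?P UNIV"
      by (rule bij_betwI[where g = "\<lambda>\<alpha>. (\<alpha> $ j, vec_upd \<alpha> j 0)"]) (auto, metis vec_upd_triv)
    have "((\<lambda>p. ?f (case p of (n, \<beta>) \<Rightarrow> vec_upd \<beta> j n)) has_sum s) ?P"
      using s by (subst has_sum_reindex_bij_betw[OF bij])
    then have P: "((\<lambda>(n, \<beta>). ?f (vec_upd \<beta> j n)) has_sum s) ?P"
      by (simp add: case_prod_unfold)
    let ?z = "vec_upd z j 0"
    have inner: "((\<lambda>\<beta>. ?f (vec_upd \<beta> j n)) has_sum (coord_coeff j n F z * z $ j ^ n)) {\<beta>. \<beta> $ j = 0}" for n
    proof -
      have "((\<lambda>\<beta>. c n \<beta> * mpower ?z \<beta>) has_sum coord_coeff j n F ?z) UNIV"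
        by (rule cs) (use z in \<open>auto simp: vec_upd_nth\<close>)
      \<comment> \<open>Restricting the index set loses nothing: \<open>j\<close> is not in
        \<open>S\<close>, so coefficients with a nonzero j-th exponent vanish.\<close>
      then have "((\<lambda>\<beta>. c n \<beta> * mpower ?z \<beta>) has_sum coord_coeff j n F z) {\<beta>. \<beta> $ j = 0}"
        by (subst has_sum_cong_neutral[where T = UNIV and g = "\<lambda>\<beta>. c n \<beta> * mpower ?z \<beta>"])
          (use c0 insert.hyps in auto)
      then have "((\<lambda>\<beta>. c n \<beta> * mpower ?z \<beta> * z $ j ^ n) has_sum (coord_coeff j n F z * z $ j ^ n)) {\<beta>. \<beta> $ j = 0}"
        by (rule has_sum_cmult_left)
      moreover have "c n \<beta> * mpower ?z \<beta> * z $ j ^ n = ?f (vec_upd \<beta> j n)" if "\<beta> $ j = 0" for \<beta>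
      proof -
        have \<beta>: "vec_upd \<beta> j 0 = \<beta>" using that by (metis vec_upd_triv)
        have "mpower ?z \<beta> = mpower z \<beta>" using that by (intro mpower_cong) (auto simp: vec_upd_nth)
        moreover have "mpower z (vec_upd \<beta> j n) = z $ j ^ n * mpower z \<beta>"
          by (subst mpower_upd[of _ _ j]) (simp add: \<beta>)
        ultimately show ?thesis by (simp add: C_def \<beta>)
      qed
      ultimately show ?thesis by (subst (asm) has_sum_cong) auto
    qed
    have "((\<lambda>n. coord_coeff j n F z * z $ j ^ n) has_sum s) UNIV"
      using has_sum_Sigma'[OF P] inner by simp
    then have "(\<lambda>n. coord_coeff j n F z * z $ j ^ n) sums s" by (rule has_sum_imp_sums)
    then have "s = F z" using coord_coeff_sums[OF insert.prems] sums_unique2 by blast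
    with s show ?thesis by simp
  qed
  have "C \<alpha> = 0" if "i \<notin> insert j S" "\<alpha> $ i \<noteq> 0" for \<alpha> i
    unfolding C_def using that by (intro c0[of i]) (auto simp: vec_upd_nth)
  with bounded sums show ?case by (intro exI[of _ C]) blast
qed

theorem entire_expansion:
  assumes "F \<in> entire"
  obtains c where "\<And>z. ((\<lambda>\<alpha>. c \<alpha> * mpower z \<alpha>) has_sum F z) UNIV" and "Cauchy_bounded F c"
  using sep_holomorphic_expansion_on[OF finite entire_imp_sep_holomorphic[OF assms], of UNIV] by auto

section \<open>Invariance of Lebesgue measure under isometries\<close>

text \<open>By Vitali's theorem an open set is, up to a null set, a disjoint union of balls, and isometries preserve balls.\<close>

lemma emeasure_lebesgue_orthogonal_image_open:
  fixes V :: "'a::euclidean_space \<Rightarrow> 'a"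
  assumes V: "orthogonal_transformation V" and W: "open W"
  shows "emeasure lebesgue (V ` W) = emeasure lebesgue W"
proof -
  let ?K = "{(x, r). 0 < r \<and> ball x r \<subseteq> W}"
  have "\<exists>i. i \<in> ?K \<and> x \<in> ball (fst i) (snd i) \<and> snd i < d" if x: "x \<in> W" and d: "0 < d" for x d
  proof -
    obtain e where "0 < e" "ball x e \<subseteq> W" using W x openE by blast
    then show ?thesis using d
      by (intro exI[of _ "(x, min e (d / 2))"]) (auto simp: subset_eq)
  qed
  then obtain C where C: "countable C" "C \<subseteq> ?K"
    and dj: "pairwise (\<lambda>i j. disjnt (ball (fst i) (snd i)) (ball (fst j) (snd j))) C"
    and neg: "negligible (W - (\<Union>i\<in>C. ball (fst i) (snd i)))"
    by (rule Vitali_covering_theorem_balls[of W ?K fst snd])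
  let ?B = "\<lambda>i. ball (fst i) (snd i)"
  have inj: "inj V" by (rule orthogonal_transformation_inj[OF V])
  have VB: "V ` ball x r = ball (V x) r" for x r
    by (rule image_orthogonal_transformation_ball[OF V])
  \<comment> \<open>An isometry is Lipschitz with constant 1 and therefore preserves null
    sets.\<close>
  have negV: "negligible (V ` (W - (\<Union>i\<in>C. ?B i)))"
  proof (rule negligible_locally_Lipschitz_image[OF order_refl neg])
    fix x
    show "\<exists>T B. open T \<and> x \<in> T \<and>
        (\<forall>y\<in>(W - (\<Union>i\<in>C. ?B i)) \<inter> T. norm (V y - V x) \<le> B * norm (y - x))"
      using V unfolding orthogonal_transformation_isometry
      by (intro exI[of _ UNIV] exI[of _ 1]) (simp add: dist_norm[symmetric])
  qed
  have split: "emeasure lebesgue (f ` W) = (\<integral>\<^sup>+ i. emeasure lebesgue (f ` ?B i) \<partial>count_space C)"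
    if f: "inj f" "\<And>x r. f ` ball x r \<in> sets lebesgue"
      "negligible (f ` (W - (\<Union>i\<in>C. ?B i)))" for f :: "'a \<Rightarrow> 'a"
  proof -
    have "f ` W = (\<Union>i\<in>C. f ` ?B i) \<union> f ` (W - (\<Union>i\<in>C. ?B i))"
      using C(2) by (fastforce simp: subset_eq)
    moreover have "(\<Union>i\<in>C. f ` ?B i) \<in> sets lebesgue"
      using f(2) C(1) by (intro sets.countable_UN') auto
    ultimately have "emeasure lebesgue (f ` W) = emeasure lebesgue (\<Union>i\<in>C. f ` ?B i)"
      using f(3) emeasure_Un_null_set[of "\<Union>i\<in>C. f ` ?B i" lebesgue "f ` (W - (\<Union>i\<in>C. ?B i))"]
      by (simp only: negligible_iff_null_sets)
    also have "\<dots> = (\<integral>\<^sup>+ i. emeasure lebesgue (f ` ?B i) \<partial>count_space C)"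
    proof (rule emeasure_UN_countable)
      show "disjoint_family_on (\<lambda>i. f ` ?B i) C"
        using dj f(1) by (auto simp: disjoint_family_on_def pairwise_def disjnt_def image_Int[symmetric])
    qed (use f C in auto)
    finally show ?thesis .
  qed
  have "emeasure lebesgue (V ` W) = (\<integral>\<^sup>+ i. emeasure lebesgue (V ` ?B i) \<partial>count_space C)"
    by (rule split) (simp_all add: inj VB negV)
  also have "\<dots> = (\<integral>\<^sup>+ i. emeasure lebesgue (id ` ?B i) \<partial>count_space C)"
    using C(2) by (intro nn_integral_cong) (auto simp: VB emeasure_ball)
  also have "\<dots> = emeasure lebesgue (id ` W)"
    by (rule split[symmetric]) (use neg in auto)
  finally show ?thesis by simp
qed

text \<open>Lebesgue measure is determined by its values on boxes. The preimage of a box is its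
  image under the inverse isometry, an open set but in general no box, whence the detour through
  open sets.\<close>

lemma distr_lborel_orthogonal_transformation:
  fixes U :: "'a::euclidean_space \<Rightarrow> 'a"
  assumes U: "orthogonal_transformation U"
  shows "distr lborel borel U = lborel"
proof (rule lborel_eqI[symmetric])
  have lin: "linear U" and bij: "bij U"
    using U orthogonal_transformation_linear orthogonal_transformation_bij by auto
  have [measurable]: "U \<in> borel_measurable borel"
    using lin by (intro borel_measurable_continuous_onI linear_continuous_on linear_conv_bounded_linear[THEN iffD1])
  have inv: "orthogonal_transformation (inv U)"
    by (rule orthogonal_transformation_inv[OF U])
  fix l u :: 'a assume lu: "\<And>b. b \<in> Basis \<Longrightarrow> l \<bullet> b \<le> u \<bullet> b"
  have "emeasure (distr lborel borel U) (box l u) = emeasure lborel (U -` box l u)"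
    by (subst emeasure_distr) auto
  also have "\<dots> = emeasure lebesgue (U -` box l u)"
    using measurable_sets[of U borel borel "box l u"] by simp
  also have "U -` box l u = inv U ` box l u"
    using bij by (simp add: bij_vimage_eq_inv_image)
  also have "emeasure lebesgue \<dots> = emeasure lebesgue (box l u)"
    by (rule emeasure_lebesgue_orthogonal_image_open[OF inv open_box])
  finally show "emeasure (distr lborel borel U) (box l u) = (\<Prod>b\<in>Basis. (u - l) \<bullet> b)"
    using lu by simp
qed simp

section \<open>Convergent power series are entire\<close>

lemma infinite_UNIV_nat_vec: "infinite (UNIV :: (nat ^ 'd) set)"
proof
  assume "finite (UNIV :: (nat ^ 'd) set)"
  then have "finite (range (\<lambda>n. \<chi> j. n :: nat ^ 'd))" by (rule finite_subset[rotated]) simp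
  moreover have "inj (\<lambda>n. \<chi> j. n :: nat ^ 'd)" by (auto simp: inj_on_def vec_eq_iff)
  ultimately show False using finite_imageD infinite_UNIV_nat by blast
qed

text \<open>Turns unconditional sums over multi-indices into ordinary series, for which termwise
  differentiation and integration are available.\<close>

lemma enumeration_nat_vec:
  obtains \<phi> :: "nat \<Rightarrow> nat ^ 'd" where "bij \<phi>"
  using bij_betw_from_nat_into[OF countableI_type infinite_UNIV_nat_vec] by blast

text \<open>Termwise differentiation on a unit ball. The series converges absolutely at every point,
  in particular at one whose coordinates are twice a bound for the ball, and this dominates all
  differentiated terms.\<close>

lemma entire_of_has_sum:
  fixes a :: "nat ^ 'd \<Rightarrow> complex"
  assumes F: "\<And>z. ((\<lambda>\<alpha>. a \<alpha> * mpower z \<alpha>) has_sum F z) UNIV"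
  shows "F \<in> entire"
  unfolding entire_def
proof (intro CollectI allI)
  fix z\<^sub>0 :: "complex ^ 'd"
  obtain \<phi> :: "nat \<Rightarrow> nat ^ 'd" where \<phi>: "bij \<phi>" by (rule enumeration_nat_vec)
  define S where "S = ball z\<^sub>0 1"
  define B where "B = norm z\<^sub>0 + 1"
  have B1: "1 \<le> B" by (simp add: B_def)
  have zB: "norm (z $ j) \<le> B" if "z \<in> S" for z j
  proof -
    have "norm (z $ j) \<le> norm z" by (rule Finite_Cartesian_Product.norm_nth_le)
    also have "\<dots> \<le> norm z\<^sub>0 + dist z\<^sub>0 z"
      using norm_triangle_sub[of z z\<^sub>0] by (simp add: dist_norm norm_minus_commute)
    finally show ?thesis using that by (simp add: S_def B_def)
  qed
  \<comment> \<open>The dimension counts the terms of the product rule; the factor 2 absorbs the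
    exponent produced by differentiation, via n <= 2^n.\<close>
  define b where "b \<alpha> = real CARD('d) * (norm (a \<alpha>) * mpower (\<chi> j. 2 * B) \<alpha>)" for \<alpha>
  have "(\<lambda>\<alpha>. norm (a \<alpha> * mpower (\<chi> j. of_real (2 * B)) \<alpha>)) summable_on UNIV"
    by (rule summable_on_iff_abs_summable_on_complex[THEN iffD1, OF has_sum_imp_summable[OF F]])
  then have "(\<lambda>\<alpha>. norm (a \<alpha>) * mpower (\<chi> j. 2 * B) \<alpha>) summable_on UNIV"
    using B1 by (simp add: norm_mult mpower_def prod_norm[symmetric] norm_power)
  then have "b summable_on UNIV" unfolding b_def by (rule summable_on_cmult_right)
  then have "(\<lambda>i. b (\<phi> i)) summable_on UNIV"
    using \<phi> by (simp add: summable_on_reindex_bij_betw)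
  then have bsum: "summable (\<lambda>i. b (\<phi> i))" by (rule summable_on_imp_summable)
  have sumsF: "(\<lambda>i. a (\<phi> i) * mpower x (\<phi> i)) sums F x" for x
    by (intro has_sum_imp_sums F
        has_sum_reindex_bij_betw[OF \<phi>, of "\<lambda>\<alpha>. a \<alpha> * mpower x \<alpha>", THEN iffD2])
  define f' where "f' \<alpha> z v = a \<alpha> * (\<Sum>j\<in>UNIV. v $ j *
      (of_nat (\<alpha> $ j) * z $ j ^ (\<alpha> $ j - 1) * (\<Prod>k\<in>UNIV - {j}. z $ k ^ (\<alpha> $ k))))" for \<alpha> z v
  have der: "((\<lambda>z. a \<alpha> * mpower z \<alpha>) has_derivative f' \<alpha> z) (at z within S)" for \<alpha> z
  proof -
    have p: "((\<lambda>z. z $ j ^ n) has_derivative (\<lambda>v. v $ j * (of_nat n * z $ j ^ (n - 1)))) (at z within S)" for j n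
      by (auto intro!: derivative_eq_intros bounded_linear_imp_has_derivative simp: mult_ac)
    have "((\<lambda>z. \<Prod>j\<in>UNIV. z $ j ^ (\<alpha> $ j)) has_derivative
        (\<lambda>v. \<Sum>j\<in>UNIV. v $ j * (of_nat (\<alpha> $ j) * z $ j ^ (\<alpha> $ j - 1)) * (\<Prod>k\<in>UNIV - {j}. z $ k ^ (\<alpha> $ k)))) (at z within S)"
      by (rule has_derivative_prod) (rule p)
    then show ?thesis
      unfolding mpower_def f'_def by (auto intro!: has_derivative_mult_right simp: mult.assoc)
  qed
  have bound: "norm (f' \<alpha> z v) \<le> b \<alpha> * norm v" if z: "z \<in> S" for \<alpha> z v
  proof -
    have term_le: "norm (v $ j * (of_nat (\<alpha> $ j) * z $ j ^ (\<alpha> $ j - 1) * (\<Prod>k\<in>UNIV - {j}. z $ k ^ (\<alpha> $ k))))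
        \<le> norm v * mpower (\<chi> j. 2 * B) \<alpha>" for j
    proof -
      have 1: "real (\<alpha> $ j) * norm (z $ j) ^ (\<alpha> $ j - 1) \<le> (2 * B) ^ (\<alpha> $ j)"
      proof -
        have "norm (z $ j) ^ (\<alpha> $ j - 1) \<le> B ^ (\<alpha> $ j - 1)" using zB[OF z] by (intro power_mono) auto
        \<comment> \<open>\<open>B >= 1\<close> makes up for the lost power, also for exponent 0,
          where the subtraction is truncated.\<close>
        also have "\<dots> \<le> B ^ (\<alpha> $ j)" using B1 by (intro power_increasing) auto
        finally have "real (\<alpha> $ j) * norm (z $ j) ^ (\<alpha> $ j - 1) \<le> 2 ^ (\<alpha> $ j) * B ^ (\<alpha> $ j)"
          using of_nat_less_two_power[of "\<alpha> $ j", where ?'a = real] by (intro mult_mono) auto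
        then show ?thesis by (simp add: power_mult_distrib)
      qed
      have 2: "(\<Prod>k\<in>UNIV - {j}. norm (z $ k) ^ (\<alpha> $ k)) \<le> (\<Prod>k\<in>UNIV - {j}. (2 * B) ^ (\<alpha> $ k))"
      proof (intro prod_mono conjI power_mono)
        show "norm (z $ k) \<le> 2 * B" for k using zB[OF z, of k] B1 by simp
      qed auto
      have "norm (v $ j * (of_nat (\<alpha> $ j) * z $ j ^ (\<alpha> $ j - 1) * (\<Prod>k\<in>UNIV - {j}. z $ k ^ (\<alpha> $ k))))
        = norm (v $ j) * ((real (\<alpha> $ j) * norm (z $ j) ^ (\<alpha> $ j - 1)) * (\<Prod>k\<in>UNIV - {j}. norm (z $ k) ^ (\<alpha> $ k)))"
        by (simp add: norm_mult norm_power prod_norm[symmetric])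
      also have "\<dots> \<le> norm v * ((2 * B) ^ (\<alpha> $ j) * (\<Prod>k\<in>UNIV - {j}. (2 * B) ^ (\<alpha> $ k)))"
        using B1 by (intro mult_mono 1 2 Finite_Cartesian_Product.norm_nth_le) (auto intro!: prod_nonneg mult_nonneg_nonneg)
      also have "(2 * B) ^ (\<alpha> $ j) * (\<Prod>k\<in>UNIV - {j}. (2 * B) ^ (\<alpha> $ k)) = mpower (\<chi> j. 2 * B) \<alpha>"
        unfolding mpower_def by (subst prod.remove[of UNIV j]) auto
      finally show ?thesis .
    qed
    have "norm (f' \<alpha> z v) \<le> norm (a \<alpha>) * (\<Sum>j\<in>(UNIV :: 'd set). norm v * mpower (\<chi> j. 2 * B) \<alpha>)"
      unfolding f'_def norm_mult[of "a \<alpha>"]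
      by (intro mult_left_mono order_trans[OF norm_sum] sum_mono term_le) auto
    then show ?thesis by (simp add: b_def mult_ac)
  qed
  have summ: "summable (\<lambda>i. norm (f' (\<phi> i) z v))" if "z \<in> S" for z v
    by (rule summable_comparison_test'[OF summable_mult2[OF bsum, of "norm v"], of 0])
      (use bound[OF that] in auto)
  define D where "D z v = (\<Sum>i. f' (\<phi> i) z v)" for z v
  have "\<exists>g. \<forall>x\<in>S. (\<lambda>i. a (\<phi> i) * mpower x (\<phi> i)) sums g x \<and> (g has_derivative D x) (at x within S)"
  proof (rule has_derivative_series)
    show "convex S" by (simp add: S_def)
    show "\<And>i x. x \<in> S \<Longrightarrow> ((\<lambda>x. a (\<phi> i) * mpower x (\<phi> i)) has_derivative f' (\<phi> i) x) (at x within S)"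
      by (rule der)
    show "z\<^sub>0 \<in> S" by (simp add: S_def)
    show "(\<lambda>i. a (\<phi> i) * mpower z\<^sub>0 (\<phi> i)) sums F z\<^sub>0" by (rule sumsF)
    fix e :: real assume "0 < e"
    \<comment> \<open>The tails of the majorant depend neither on the point nor on the direction,
      which gives the uniform convergence of the derivatives.\<close>
    then obtain N where N: "\<And>n. n \<ge> N \<Longrightarrow> norm (\<Sum>i. b (\<phi> (i + n))) < e"
      using suminf_exist_split[OF _ bsum, of e] by blast
    have "norm ((\<Sum>i<n. f' (\<phi> i) x v) - D x v) \<le> e * norm v" if n: "n \<ge> N" and x: "x \<in> S" for n x v
    proof -
      have s: "summable (\<lambda>i. f' (\<phi> i) x v)" by (rule summable_norm_cancel[OF summ[OF x]])
      have sb: "summable (\<lambda>i. b (\<phi> (i + n)) * norm v)"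
        by (intro summable_mult2 summable_ignore_initial_segment[OF bsum])
      have "norm ((\<Sum>i<n. f' (\<phi> i) x v) - D x v) = norm (\<Sum>i. f' (\<phi> (i + n)) x v)"
        unfolding D_def suminf_split_initial_segment[OF s, of n] by simp
      also have "\<dots> \<le> (\<Sum>i. b (\<phi> (i + n)) * norm v)"
        by (rule norm_suminf_le[OF bound[OF x] sb])
      also have "\<dots> = (\<Sum>i. b (\<phi> (i + n))) * norm v"
        by (rule suminf_mult2[symmetric]) (rule summable_ignore_initial_segment[OF bsum])
      also have "\<dots> \<le> e * norm v"
        using N[OF n] by (intro mult_right_mono) auto
      finally show ?thesis .
    qed
    then show "\<forall>\<^sub>F n in sequentially. \<forall>x\<in>S. \<forall>h. norm ((\<Sum>i<n. f' (\<phi> i) x h) - D x h) \<le> e * norm h"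
      unfolding eventually_sequentially by blast
  qed
  then obtain g where g: "\<And>x. x \<in> S \<Longrightarrow> (\<lambda>i. a (\<phi> i) * mpower x (\<phi> i)) sums g x"
    "\<And>x. x \<in> S \<Longrightarrow> (g has_derivative D x) (at x within S)" by blast
  have gF: "g x = F x" if "x \<in> S" for x
    by (rule sums_unique2[OF g(1)[OF that] sumsF])
  have z0: "z\<^sub>0 \<in> S" and S: "open S" by (auto simp: S_def)
  have "(g has_derivative D z\<^sub>0) (at z\<^sub>0)"
    using g(2)[OF z0] at_within_open[OF z0 S] by simp
  then have "(F has_derivative D z\<^sub>0) (at z\<^sub>0)"
    by (rule has_derivative_transform_within_open[OF _ S z0 gF])
  moreover have "D z\<^sub>0 (x *s v) = x * D z\<^sub>0 v" for x v
  proof -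
    have "f' \<alpha> z\<^sub>0 (x *s v) = x * f' \<alpha> z\<^sub>0 v" for \<alpha>
      by (simp add: f'_def sum_distrib_left mult_ac)
    then show ?thesis
      unfolding D_def using suminf_mult[OF summable_norm_cancel[OF summ[OF z0]]] by simp
  qed
  ultimately show "\<exists>D. (F has_derivative D) (at z\<^sub>0) \<and> (\<forall>a v. D (a *s v) = a * D v)" by blast
qed

section \<open>Diagonal multipliers on the sequence spaces\<close>

lemma mfact_pos: "0 < mfact \<alpha>"
  unfolding mfact_def by (intro prod_pos) auto

lemma mpower_vec_times: "mpower (\<chi> j. a $ j * b $ j) \<alpha> = mpower a \<alpha> * mpower b \<alpha>"
  by (simp add: mpower_def power_mult_distrib prod.distrib)

lemma weight_mult:
  "weight s r \<alpha> * (mpower q \<alpha> * mfact \<alpha> powr u) = weight (s + u) (\<chi> j. r $ j * q $ j) \<alpha>"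
  using mfact_pos[of \<alpha>] by (simp add: weight_def mpower_vec_times powr_add mult_ac)

lemma pos_vecs_times: "r \<in> pos_vecs \<Longrightarrow> q \<in> pos_vecs \<Longrightarrow> (\<chi> j. r $ j * q $ j) \<in> pos_vecs"
  by (simp add: pos_vecs_def)

text \<open>The exponent \<open>u\<close> is a parameter because the moments (\<open>u = -1\<close>)
  and their inverses (\<open>u = 1\<close>) are both instances.\<close>

locale diagonal_multiplier =
  fixes m :: "'d::finite pseries" and C :: real and q :: "real ^ 'd" and u :: real
  assumes C: "0 < C" and q: "q \<in> pos_vecs"
    and m: "\<And>\<alpha>. norm (m \<alpha>) \<le> C * (mpower q \<alpha> * mfact \<alpha> powr u)"
begin

definition L :: "'d pseries \<Rightarrow> 'd pseries"
  where "L c = (\<lambda>\<alpha>. m \<alpha> * c \<alpha>)"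

lemma norm_L_le:
  assumes r: "r \<in> pos_vecs"
  shows "norm (L c \<alpha>) / weight (s + u) (\<chi> j. r $ j * q $ j) \<alpha> \<le> C * (norm (c \<alpha>) / weight s r \<alpha>)"
proof -
  have w: "0 < weight s r \<alpha>" and w': "0 < weight (s + u) (\<chi> j. r $ j * q $ j) \<alpha>"
    using r q by (auto intro: weight_pos pos_vecs_times)
  have "norm (L c \<alpha>) \<le> C * (mpower q \<alpha> * mfact \<alpha> powr u) * norm (c \<alpha>)"
    unfolding L_def norm_mult by (intro mult_right_mono m) auto
  then have "norm (L c \<alpha>) * weight s r \<alpha> \<le> C * (mpower q \<alpha> * mfact \<alpha> powr u) * norm (c \<alpha>) * weight s r \<alpha>"
    using w by (intro mult_right_mono) auto
  also have "\<dots> = C * norm (c \<alpha>) * (weight s r \<alpha> * (mpower q \<alpha> * mfact \<alpha> powr u))"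
    by (simp only: mult_ac)
  also have "\<dots> = C * norm (c \<alpha>) * weight (s + u) (\<chi> j. r $ j * q $ j) \<alpha>"
    by (simp only: weight_mult)
  finally show ?thesis using w w' by (simp add: field_simps)
qed

lemma L_banach:
  assumes r: "r \<in> pos_vecs" and c: "c \<in> banach s r"
  shows "L c \<in> banach (s + u) (\<chi> j. r $ j * q $ j)"
    and "banach_norm (s + u) (\<chi> j. r $ j * q $ j) (L c) \<le> C * banach_norm s r c"
proof -
  have bd: "bdd_above (range (\<lambda>\<alpha>. norm (c \<alpha>) / weight s r \<alpha>))" using c by (simp add: banach_def)
  have le: "norm (L c \<alpha>) / weight (s + u) (\<chi> j. r $ j * q $ j) \<alpha> \<le> C * banach_norm s r c" for \<alpha>
  proof -
    have "norm (c \<alpha>) / weight s r \<alpha> \<le> banach_norm s r c"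
      unfolding banach_norm_def by (rule cSUP_upper[OF _ bd]) simp
    then have "C * (norm (c \<alpha>) / weight s r \<alpha>) \<le> C * banach_norm s r c"
      using C by (intro mult_left_mono) auto
    with norm_L_le[OF r, of c \<alpha> s] show ?thesis by (rule order_trans)
  qed
  then show "L c \<in> banach (s + u) (\<chi> j. r $ j * q $ j)" unfolding banach_def by (auto intro!: bdd_aboveI2)
  show "banach_norm (s + u) (\<chi> j. r $ j * q $ j) (L c) \<le> C * banach_norm s r c"
    by (subst banach_norm_def) (rule cSUP_least, use le in auto)
qed

lemma L_add: "L (\<lambda>\<alpha>. x \<alpha> + y \<alpha>) = (\<lambda>\<alpha>. L x \<alpha> + L y \<alpha>)"
  by (simp add: L_def algebra_simps)

lemma continuous_map_banach:
  assumes r: "r \<in> pos_vecs"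
  shows "continuous_map (banach_topology s r) (banach_topology (s + u) (\<chi> j. r $ j * q $ j)) L"
proof -
  let ?r = "\<chi> j. r $ j * q $ j"
  have r': "?r \<in> pos_vecs" using r q by (rule pos_vecs_times)
  interpret X: Metric_space "banach s r" "banach_dist s r" by (rule Metric_space_banach[OF r])
  interpret Y: Metric_space "banach (s + u) ?r" "banach_dist (s + u) ?r" by (rule Metric_space_banach[OF r'])
  have L: "L x \<in> banach (s + u) ?r" if "x \<in> banach s r" for x by (rule L_banach(1)[OF r that])
  have lip: "banach_dist (s + u) ?r (L x) (L y) \<le> C * banach_dist s r x y"
    if "x \<in> banach s r" "y \<in> banach s r" for x y
  proof -
    \<comment> \<open>Nonnegativity on the space removes the absolute value in
      \<open>banach_dist\<close>; the quotient at index 0 is a nonnegative lower bound of the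
      supremum.\<close>
    have nn: "0 \<le> banach_norm s r c" if "c \<in> banach s r" for c
      using that cSUP_upper2[of "\<lambda>\<alpha>. norm (c \<alpha>) / weight s r \<alpha>" UNIV 0 0] weight_pos[OF r, of s 0]
      unfolding banach_norm_def banach_def by auto
    have nn': "0 \<le> banach_norm (s + u) ?r c" if "c \<in> banach (s + u) ?r" for c
      using that cSUP_upper2[of "\<lambda>\<alpha>. norm (c \<alpha>) / weight (s + u) ?r \<alpha>" UNIV 0 0] weight_pos[OF r', of "s + u" 0]
      unfolding banach_norm_def banach_def by auto
    have d: "(\<lambda>\<alpha>. x \<alpha> - y \<alpha>) \<in> banach s r"
      using banach_lincomb[OF r that, of 1 "-1"] by simp
    have "(\<lambda>\<alpha>. L x \<alpha> - L y \<alpha>) = L (\<lambda>\<alpha>. x \<alpha> - y \<alpha>)" by (simp add: L_def algebra_simps)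
    then show ?thesis unfolding banach_dist_def using L_banach[OF r d] nn[OF d] nn' by auto
  qed
  show ?thesis
    unfolding continuous_map_def banach_topology_def
  proof (intro conjI allI impI)
    show "L \<in> topspace X.mtopology \<rightarrow> topspace Y.mtopology" using L by auto
    fix U assume U: "openin Y.mtopology U"
    show "openin X.mtopology {x \<in> topspace X.mtopology. L x \<in> U}"
      unfolding X.openin_mtopology
    proof (intro conjI allI impI)
      fix x assume x: "x \<in> {x \<in> topspace X.mtopology. L x \<in> U}"
      then obtain e where e: "0 < e" "Y.mball (L x) e \<subseteq> U" using U unfolding Y.openin_mtopology by auto
      have "X.mball x (e / C) \<subseteq> {x \<in> topspace X.mtopology. L x \<in> U}"
      proof
        fix y assume y: "y \<in> X.mball x (e / C)"
        then have "C * banach_dist s r x y < e" using C by (auto simp: field_simps)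
        then have "L y \<in> Y.mball (L x) e" using y L lip[of x y] by (auto simp: Y.in_mball)
        then show "y \<in> {x \<in> topspace X.mtopology. L x \<in> U}" using e y by auto
      qed
      then show "\<exists>r>0. X.mball x r \<subseteq> {x \<in> topspace X.mtopology. L x \<in> U}"
        using e C by (intro exI[of _ "e / C"]) auto
    qed auto
  qed
qed

text \<open>Linearity of \<open>L\<close> preserves absolute convexity, and the trace on the step
  \<open>r\<close> contains the preimage of a zero neighbourhood in the step r*q.\<close>

lemma inductive_nbhd_vimage:
  assumes V: "inductive_nbhd (s + u) V"
  shows "inductive_nbhd s {v \<in> (\<Union>r\<in>pos_vecs. banach s r). L v \<in> V}" (is "inductive_nbhd s ?W")
  unfolding inductive_nbhd_def
proof (intro conjI ballI)
  let ?E = "\<Union>r\<in>pos_vecs. banach s (r :: real ^ 'd)"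
  show "absolutely_convex ?W"
    unfolding absolutely_convex_def
  proof (intro ballI allI impI)
    fix x y and a b :: complex assume x: "x \<in> ?W" and y: "y \<in> ?W" and ab: "norm a + norm b \<le> 1"
    obtain r1 r2 where r: "r1 \<in> pos_vecs" "x \<in> banach s r1" "r2 \<in> pos_vecs" "y \<in> banach s r2"
      using x y by blast
    \<comment> \<open>The steps are directed: the coordinatewise maximum gives one that contains
      both series.\<close>
    define r :: "real ^ 'd" where "r = (\<chi> j. max (r1 $ j) (r2 $ j))"
    have "r \<in> pos_vecs" "r1 \<le> r" "r2 \<le> r"
      using r by (auto simp: r_def pos_vecs_def less_eq_vec_def less_max_iff_disj)
    then have "(\<lambda>\<alpha>. a * x \<alpha> + b * y \<alpha>) \<in> ?E"
      using banach_lincomb[of r x s y a b] banach_mono[of r1 r s] banach_mono[of r2 r s] r by blast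
    moreover have "L (\<lambda>\<alpha>. a * x \<alpha> + b * y \<alpha>) = (\<lambda>\<alpha>. a * L x \<alpha> + b * L y \<alpha>)"
      by (simp add: L_def algebra_simps)
    moreover have "(\<lambda>\<alpha>. a * L x \<alpha> + b * L y \<alpha>) \<in> V"
      using V x y ab unfolding inductive_nbhd_def absolutely_convex_def by blast
    ultimately show "(\<lambda>\<alpha>. a * x \<alpha> + b * y \<alpha>) \<in> ?W" by simp
  qed
  fix r :: "real ^ 'd" assume r: "r \<in> pos_vecs"
  then obtain U where U: "openin (banach_topology (s + u) (\<chi> j. r $ j * q $ j)) U" "(\<lambda>\<alpha>. 0) \<in> U" "U \<subseteq> V"
    using V pos_vecs_times[OF r q] unfolding inductive_nbhd_def by blast
  let ?U = "{x \<in> topspace (banach_topology s r). L x \<in> U}"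
  have "openin (banach_topology s r) ?U"
    using openin_continuous_map_preimage[OF continuous_map_banach[OF r] U(1)] .
  moreover have "(\<lambda>\<alpha>. 0) \<in> ?U"
    using U(2) by (simp add: topspace_banach_topology[OF r] banach_def L_def)
  moreover have "?U \<subseteq> ?W" using U(3) r by (auto simp: topspace_banach_topology[OF r])
  ultimately show "\<exists>U. openin (banach_topology s r) U \<and> (\<lambda>\<alpha>. 0) \<in> U \<and> U \<subseteq> ?W" by blast
qed auto

text \<open>By additivity of \<open>L\<close>, pulling back a neighbourhood of zero handles every
  base point at once.\<close>

lemma continuous_map_inductive:
  "continuous_map (inductive_limit_topology s) (inductive_limit_topology (s + u)) L"
  unfolding continuous_map_def
proof (intro conjI allI impI)
  show "L \<in> topspace (inductive_limit_topology s) \<rightarrow> topspace (inductive_limit_topology (s + u))"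
    using L_banach(1) pos_vecs_times[OF _ q] by (fastforce simp: topspace_inductive_limit_topology)
  fix U :: "'d pseries set" assume U: "openin (inductive_limit_topology (s + u)) U"
  let ?E = "\<Union>r\<in>pos_vecs. banach s (r :: real ^ 'd)"
  show "openin (inductive_limit_topology s) {x \<in> topspace (inductive_limit_topology s). L x \<in> U}"
    unfolding openin_inductive_limit_topology topspace_inductive_limit_topology
  proof (intro conjI ballI)
    fix x assume x: "x \<in> {x \<in> ?E. L x \<in> U}"
    then obtain V where V: "inductive_nbhd (s + u) V" "\<And>v. v \<in> V \<Longrightarrow> (\<lambda>\<alpha>. L x \<alpha> + v \<alpha>) \<in> U"
      using U unfolding openin_inductive_limit_topology by blast
    let ?W = "{v \<in> ?E. L v \<in> V}"
    have "(\<lambda>\<alpha>. x \<alpha> + v \<alpha>) \<in> {x \<in> ?E. L x \<in> U}" if v: "v \<in> ?W" for v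
    proof -
      obtain r1 r2 where r: "r1 \<in> pos_vecs" "x \<in> banach s r1" "r2 \<in> pos_vecs" "v \<in> banach s r2"
        using x v by blast
      define r :: "real ^ 'd" where "r = (\<chi> j. max (r1 $ j) (r2 $ j))"
      have "r \<in> pos_vecs" "r1 \<le> r" "r2 \<le> r"
        using r by (auto simp: r_def pos_vecs_def less_eq_vec_def less_max_iff_disj)
      then have "(\<lambda>\<alpha>. x \<alpha> + v \<alpha>) \<in> ?E"
        using banach_lincomb[of r x s v 1 1] banach_mono[of r1 r s] banach_mono[of r2 r s] r by auto
      then show ?thesis using v V(2) by (simp add: L_add)
    qed
    then show "\<exists>W. inductive_nbhd s W \<and> (\<forall>v\<in>W. (\<lambda>\<alpha>. x \<alpha> + v \<alpha>) \<in> {x \<in> ?E. L x \<in> U})"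
      using inductive_nbhd_vimage[OF V(1)] by blast
  qed auto
qed

text \<open>It suffices to pull back the generating sets. As \<open>L\<close> multiplies radii by q,
  a generator at radius r comes from one at radius r/q.\<close>

lemma continuous_map_projective:
  "continuous_map (projective_limit_topology s) (projective_limit_topology (s + u)) L"
proof -
  let ?E = "\<Inter>r\<in>pos_vecs. banach s (r :: real ^ 'd)" and ?E' = "\<Inter>r\<in>pos_vecs. banach (s + u) (r :: real ^ 'd)"
  let ?d = "\<lambda>r. (\<chi> j. r $ j / q $ j) :: real ^ 'd"
  have d: "?d r \<in> pos_vecs" "(\<chi> j. ?d r $ j * q $ j) = r" if "r \<in> pos_vecs" for r
    using that q by (auto simp: pos_vecs_def vec_eq_iff less_imp_neq[symmetric])
  have L: "L x \<in> ?E'" if "x \<in> ?E" for x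
  proof
    fix r :: "real ^ 'd" assume "r \<in> pos_vecs"
    then show "L x \<in> banach (s + u) r" using L_banach(1)[of "?d r" x s] d[of r] that by auto
  qed
  show ?thesis
    unfolding projective_limit_topology_def[of "s + u"]
  proof (rule continuous_on_generated_topo)
    fix U :: "'d pseries set" assume "U \<in> {U \<inter> ?E' |U r. r \<in> pos_vecs \<and> openin (banach_topology (s + u) r) U}"
    then obtain U' r where U: "U = U' \<inter> ?E'" "r \<in> pos_vecs" "openin (banach_topology (s + u) r) U'" by blast
    let ?W = "{x \<in> topspace (banach_topology s (?d r)). L x \<in> U'}"
    have "openin (banach_topology s (?d r)) ?W"
      using openin_continuous_map_preimage[OF continuous_map_banach[OF d(1)[OF U(2)], unfolded d(2)[OF U(2)]] U(3)] .
    then have "openin (projective_limit_topology s) (?W \<inter> ?E)"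
      unfolding projective_limit_topology_def using d(1)[OF U(2)]
      by (intro topology_generated_by_Basis) blast
    also have "?W \<inter> ?E = L -` U \<inter> topspace (projective_limit_topology s)"
      using U(1) L d(1)[OF U(2)] by (auto simp: topspace_projective_limit_topology topspace_banach_topology)
    finally show "openin (projective_limit_topology s) (L -` U \<inter> topspace (projective_limit_topology s))" .
  next
    \<comment> \<open>The generators must also cover the image; the whole space is itself a
      generator, obtained from any single step.\<close>
    have "?E' \<in> {U \<inter> ?E' |U r. r \<in> pos_vecs \<and> openin (banach_topology (s + u) r) U}"
    proof -
      have "q \<in> pos_vecs \<and> openin (banach_topology (s + u) q) (banach (s + u) q)"
        using q topspace_banach_topology[OF q, of "s + u"] by (metis openin_topspace)
      moreover have "?E' = banach (s + u) q \<inter> ?E'" using q by blast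
      ultimately show ?thesis by blast
    qed
    then show "L ` topspace (projective_limit_topology s)
        \<subseteq> \<Union> {U \<inter> ?E' |U r. r \<in> pos_vecs \<and> openin (banach_topology (s + u) r) U}"
      using L by (auto simp: topspace_projective_limit_topology)
  qed
qed

end

section \<open>Radial kernels and orthogonality of monomials\<close>

lemma mfact_powr_minus_one: "mfact \<alpha> powr (- 1) = 1 / mfact \<alpha>"
  using mfact_pos[of \<alpha>] by (simp only: powr_minus_divide powr_one less_imp_le)

lemma continuous_on_e_monom [continuous_intros]:
  fixes f :: "'a::topological_space \<Rightarrow> complex ^ 'd"
  assumes "continuous_on S f" shows "continuous_on S (\<lambda>x. e_monom \<alpha> (f x))"
  unfolding e_monom_def mpower_def using mfact_pos[of \<alpha>]
  by (intro continuous_intros assms) simp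

lemma borel_measurable_e_monom [measurable]: "e_monom \<alpha> \<in> borel_measurable borel"
  by (intro borel_measurable_continuous_onI continuous_on_e_monom continuous_on_id)

lemma borel_measurable_cnj_e_monom [measurable]: "(\<lambda>w. cnj (e_monom \<alpha> w)) \<in> borel_measurable borel"
  by (intro borel_measurable_continuous_onI continuous_intros)

lemma e_monom_times: "e_monom \<alpha> (\<omega> * w) = mpower \<omega> \<alpha> * e_monom \<alpha> w"
  by (simp add: e_monom_def mpower_def power_mult_distrib prod.distrib)

lemma norm_e_monom_power2:
  "norm (e_monom \<alpha> w) ^ 2 = mpower (\<chi> j. norm (w $ j) ^ 2) \<alpha> / mfact \<alpha>"
  using mfact_pos[of \<alpha>]
  by (simp add: e_monom_def norm_divide power_divide mpower_def prod_norm[symmetric] norm_power prod_power_distrib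
      power_mult[symmetric] mult.commute)

text \<open>This is the product of the exponential series of the coordinates; the two square roots
  of the normalised monomials multiply to \<alpha>!.\<close>

lemma has_sum_e_monom_kernel:
  "((\<lambda>\<beta>. e_monom \<beta> z * cnj (e_monom \<beta> w)) has_sum exp (\<Sum>j\<in>UNIV. z $ j * cnj (w $ j))) UNIV"
proof -
  let ?f = "\<lambda>j n. (z $ j * cnj (w $ j)) ^ n / fact n"
  have s: "summable (\<lambda>n. norm (x ^ n / fact n))" for x :: complex
    using summable_norm_exp[of x] by (simp add: norm_divide norm_power scaleR_conv_of_real divide_inverse mult.commute)
  have "(\<lambda>n. x ^ n / fact n) sums exp x" for x :: complex
    using exp_converges[of x] by (simp add: scaleR_conv_of_real divide_inverse mult.commute)
  then have h: "(?f j has_sum exp (z $ j * cnj (w $ j))) UNIV" for j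
    by (rule norm_summable_imp_has_sum[OF s])
  have s': "(\<lambda>n. norm (?f j n)) summable_on UNIV" for j
    using norm_summable_imp_summable_on[of "\<lambda>n. norm (?f j n)"] s by simp
  have "e_monom \<beta> z * cnj (e_monom \<beta> w) = (\<Prod>j\<in>UNIV. ?f j (\<beta> $ j))" for \<beta>
  proof -
    have "complex_of_real (sqrt (mfact \<beta>)) * complex_of_real (sqrt (mfact \<beta>)) = (\<Prod>j\<in>UNIV. fact (\<beta> $ j))"
      using mfact_pos[of \<beta>] by (simp add: mfact_def of_real_mult[symmetric] del: of_real_mult)
    then show ?thesis
      by (simp add: e_monom_def mpower_def prod_dividef power_mult_distrib prod.distrib)
  qed
  then show ?thesis
    using has_sum_prod_vec[OF s' h] by (simp add: exp_sum)
qed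

text \<open>The action of the torus: the product of vectors is componentwise.\<close>

lemma rotation_orthogonal:
  fixes \<omega> :: "complex ^ 'd"
  assumes "\<And>j. norm (\<omega> $ j) = 1"
  shows "orthogonal_transformation (\<lambda>w. \<omega> * w)"
  unfolding orthogonal_transformation
proof (intro conjI allI)
  show "linear (\<lambda>w. \<omega> * w)"
    by (rule linearI) (auto simp: vec_eq_iff algebra_simps)
  show "norm (\<omega> * w) = norm w" for w
    by (simp add: norm_vec_def norm_mult assms)
qed

text \<open>\<open>k\<close> stands for a Borel version of \<open>h\<close> times the normalised
  Gaussian. Of radiality only invariance under the torus is kept, with an exceptional null set that
  may depend on the rotation. A second instance, an indicator, yields uniqueness of
  coefficients.\<close>

locale radial_kernel =
  fixes k :: "complex ^ 'd \<Rightarrow> real" and t T :: "real ^ 'd" and lo B :: real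
  assumes k_meas [measurable]: "k \<in> borel_measurable borel"
    and k_nonneg: "AE w in lborel. 0 \<le> k w"
    and k_le: "AE w in lborel. k w \<le> B"
    and k_supp: "AE w in lborel. \<not> (\<forall>j. norm (w $ j) \<le> T $ j) \<longrightarrow> k w = 0"
    and k_ge: "AE w in lborel. (\<forall>j. norm (w $ j) < t $ j) \<longrightarrow> lo \<le> k w"
    and lo: "0 < lo" and t: "t \<in> pos_vecs" and T: "T \<in> pos_vecs"
    and k_rot: "\<And>\<omega>. (\<And>j. norm (\<omega> $ j) = 1) \<Longrightarrow> AE w in lborel. k (\<omega> * w) = k w"
begin

abbreviation K :: "(complex ^ 'd) set"
  where "K \<equiv> {w. \<forall>j. norm (w $ j) \<le> T $ j}"

lemma integrable_kernel_mult:
  fixes f :: "complex ^ 'd \<Rightarrow> 'b::{real_normed_algebra_1, banach, second_countable_topology}"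
  assumes f [measurable]: "f \<in> borel_measurable borel" and M: "\<And>w. w \<in> K \<Longrightarrow> norm (f w) \<le> M"
  shows "integrable lborel (\<lambda>w. of_real (k w) * f w)"
proof (rule integrableI_bounded_set)
  have K: "compact K" by (rule compact_closed_polydisc)
  then show "K \<in> sets lborel" by (simp add: compact_imp_closed)
  show "emeasure lborel K < \<infinity>" by (rule emeasure_bounded_finite[OF compact_imp_bounded[OF K]])
  show "AE w in lborel. w \<in> K \<longrightarrow> norm (of_real (k w) * f w) \<le> B * M"
    using k_nonneg k_le
  proof eventually_elim
    case (elim w)
    then show ?case using M[of w]
      by (auto simp del: mem_Collect_eq intro!: order_trans[OF norm_mult_ineq] mult_mono)
  qed
  show "AE w in lborel. w \<notin> K \<longrightarrow> of_real (k w) * f w = 0"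
    using k_supp by eventually_elim auto
qed measurable

lemma integrable_kernel: "integrable lborel k"
  using integrable_kernel_mult[of "\<lambda>_. 1 :: real" 1] by simp

lemma continuous_bounded_on_K:
  fixes f :: "complex ^ 'd \<Rightarrow> complex"
  assumes "continuous_on UNIV f"
  obtains M where "0 < M" "\<And>w. w \<in> K \<Longrightarrow> norm (f w) \<le> M"
  by (rule bounded_on_closed_polydisc[OF assms, of T]) auto

text \<open>Off \<open>K\<close> the kernel vanishes and on \<open>K\<close> the terms have a
  summable majorant, so sum and integral may be exchanged along an enumeration.\<close>

lemma has_sum_integral:
  fixes f :: "nat ^ 'd \<Rightarrow> complex ^ 'd \<Rightarrow> complex"
  assumes f [measurable]: "\<And>\<alpha>. f \<alpha> \<in> borel_measurable borel"
    and g [measurable]: "g \<in> borel_measurable borel"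
    and fg: "\<And>w. w \<in> K \<Longrightarrow> ((\<lambda>\<alpha>. f \<alpha> w) has_sum g w) UNIV"
    and fb: "\<And>\<alpha> w. w \<in> K \<Longrightarrow> norm (f \<alpha> w) \<le> b \<alpha>" and b: "b summable_on UNIV"
  shows "((\<lambda>\<alpha>. LINT w|lborel. of_real (k w) * f \<alpha> w) has_sum (LINT w|lborel. of_real (k w) * g w)) UNIV"
proof -
  obtain \<phi> :: "nat \<Rightarrow> nat ^ 'd" where \<phi>: "bij \<phi>" by (rule enumeration_nat_vec)
  let ?h = "\<lambda>i w. of_real (k w) * f (\<phi> i) w"
  have b\<phi>: "summable (\<lambda>i. b (\<phi> i))"
    using b \<phi> by (intro summable_on_imp_summable) (simp add: summable_on_reindex_bij_betw)
  have int: "integrable lborel (?h i)" for i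
    by (rule integrable_kernel_mult[OF f fb])
  have AE_sums: "AE w in lborel. summable (\<lambda>i. norm (?h i w)) \<and> (\<Sum>i. ?h i w) = of_real (k w) * g w"
    using k_supp
  proof eventually_elim
    case (elim w)
    show ?case
    proof (cases "w \<in> K")
      case True
      have "summable (\<lambda>i. norm (f (\<phi> i) w))"
        by (rule summable_comparison_test'[OF b\<phi>, of 0]) (use fb[OF True] in simp)
      then have "summable (\<lambda>i. norm (?h i w))" by (simp add: norm_mult summable_mult)
      moreover have "(\<lambda>i. f (\<phi> i) w) sums g w"
        by (intro has_sum_imp_sums fg True
            has_sum_reindex_bij_betw[OF \<phi>, of "\<lambda>\<alpha>. f \<alpha> w", THEN iffD2])
      then have "(\<Sum>i. ?h i w) = of_real (k w) * g w"
        by (intro sums_unique[symmetric] sums_mult)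
      ultimately show ?thesis by blast
    qed (use elim in simp)
  qed
  have summ_int: "summable (\<lambda>i. LINT w|lborel. norm (?h i w))"
  proof (rule summable_comparison_test'[of "\<lambda>i. integral\<^sup>L lborel k * b (\<phi> i)" 0])
    show "summable (\<lambda>i. integral\<^sup>L lborel k * b (\<phi> i))" by (intro summable_mult b\<phi>)
    fix i
    have "(LINT w|lborel. norm (?h i w)) \<le> (LINT w|lborel. k w * b (\<phi> i))"
    proof (rule integral_mono_AE)
      show "integrable lborel (\<lambda>w. k w * b (\<phi> i))" using integrable_kernel by simp
      show "AE w in lborel. norm (?h i w) \<le> k w * b (\<phi> i)"
        using k_nonneg k_supp
      proof eventually_elim
        case (elim w)
        then show ?case using fb[of w "\<phi> i"]
          by (cases "w \<in> K") (auto simp: norm_mult intro!: mult_left_mono)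
      qed
    qed (rule integrable_norm[OF int])
    then show "norm (LINT w|lborel. norm (?h i w)) \<le> integral\<^sup>L lborel k * b (\<phi> i)" by simp
  qed
  have "(\<lambda>i. integral\<^sup>L lborel (?h i)) sums (LINT w|lborel. (\<Sum>i. ?h i w))"
    by (rule sums_integral[OF int _ summ_int]) (use AE_sums in eventually_elim, simp)
  also have "(LINT w|lborel. (\<Sum>i. ?h i w)) = (LINT w|lborel. of_real (k w) * g w)"
    by (rule integral_cong_AE) (measurable, use AE_sums in eventually_elim, simp)
  finally have sums: "(\<lambda>i. integral\<^sup>L lborel (?h i)) sums (LINT w|lborel. of_real (k w) * g w)" .
  \<comment> \<open>Absolute convergence frees the result from the chosen enumeration.\<close>
  have "summable (\<lambda>i. norm (integral\<^sup>L lborel (?h i)))"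
    by (rule summable_comparison_test'[OF summ_int, of 0]) simp
  from norm_summable_imp_has_sum[OF this sums] show ?thesis
    using has_sum_reindex_bij_betw[OF \<phi>, of "\<lambda>\<alpha>. LINT w|lborel. of_real (k w) * f \<alpha> w"] by simp
qed

definition moment :: "nat ^ 'd \<Rightarrow> real"
  where "moment \<beta> = (LINT w|lborel. k w * norm (e_monom \<beta> w) ^ 2)"

lemma orthogonality:
  assumes "\<alpha> \<noteq> \<beta>"
  shows "(LINT w|lborel. of_real (k w) * (e_monom \<alpha> w * cnj (e_monom \<beta> w))) = 0" (is "?I = 0")
proof -
  obtain j where j: "\<alpha> $ j \<noteq> \<beta> $ j" using assms by (auto simp: vec_eq_iff)
  \<comment> \<open>Rotating coordinate j by this angle multiplies the integrand by cis pi = -1, so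
    the integral equals its own negative.\<close>
  define \<theta> where "\<theta> = pi / (real (\<alpha> $ j) - real (\<beta> $ j))"
  define \<omega> :: "complex ^ 'd" where "\<omega> = (\<chi> i. if i = j then cis \<theta> else 1)"
  have \<omega>1: "norm (\<omega> $ i) = 1" for i by (simp add: \<omega>_def)
  have mp: "mpower \<omega> \<gamma> = cis (real (\<gamma> $ j) * \<theta>)" for \<gamma>
  proof -
    have "mpower \<omega> \<gamma> = \<omega> $ j ^ (\<gamma> $ j) * (\<Prod>i\<in>UNIV - {j}. \<omega> $ i ^ (\<gamma> $ i))"
      unfolding mpower_def by (subst prod.remove[of _ j]) auto
    also have "(\<Prod>i\<in>UNIV - {j}. \<omega> $ i ^ (\<gamma> $ i)) = 1" by (intro prod.neutral) (auto simp: \<omega>_def)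
    finally show ?thesis by (simp add: \<omega>_def flip: Complex.DeMoivre)
  qed
  have "mpower \<omega> \<alpha> * cnj (mpower \<omega> \<beta>) = cis ((real (\<alpha> $ j) - real (\<beta> $ j)) * \<theta>)"
    unfolding mp cis_cnj cis_mult by (simp add: algebra_simps)
  also have "(real (\<alpha> $ j) - real (\<beta> $ j)) * \<theta> = pi" using j by (simp add: \<theta>_def)
  finally have \<zeta>: "mpower \<omega> \<alpha> * cnj (mpower \<omega> \<beta>) = - 1" by simp
  let ?f = "\<lambda>w. of_real (k w) * (e_monom \<alpha> w * cnj (e_monom \<beta> w))"
  have U: "orthogonal_transformation (\<lambda>w. \<omega> * w)" by (rule rotation_orthogonal[OF \<omega>1])
  have [measurable]: "(\<lambda>w. \<omega> * w) \<in> borel_measurable borel"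
    using orthogonal_transformation_linear[OF U]
    by (intro borel_measurable_continuous_onI linear_continuous_on linear_conv_bounded_linear[THEN iffD1])
  have "?I = integral\<^sup>L (distr lborel borel (\<lambda>w. \<omega> * w)) ?f"
    by (simp add: distr_lborel_orthogonal_transformation[OF U])
  also have "\<dots> = (LINT w|lborel. ?f (\<omega> * w))"
    by (rule integral_distr) measurable
  also have "\<dots> = (LINT w|lborel. - ?f w)"
  proof (rule integral_cong_AE)
    show "AE w in lborel. ?f (\<omega> * w) = - ?f w"
      using k_rot[OF \<omega>1]
    proof eventually_elim
      case (elim w)
      have "?f (\<omega> * w) = of_real (k w) * ((mpower \<omega> \<alpha> * cnj (mpower \<omega> \<beta>)) * (e_monom \<alpha> w * cnj (e_monom \<beta> w)))"
        by (simp add: elim e_monom_times)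
      then show ?case by (simp add: \<zeta>)
    qed
  qed measurable
  also have "\<dots> = - ?I" by simp
  finally show ?thesis by simp
qed

lemma diagonal:
  "(LINT w|lborel. of_real (k w) * (e_monom \<beta> w * cnj (e_monom \<beta> w))) = of_real (moment \<beta>)"
  unfolding moment_def integral_complex_of_real[symmetric]
  by (simp add: complex_norm_square[symmetric] del: integral_complex_of_real)

lemma norm_e_monom_le:
  assumes "w \<in> K" shows "norm (e_monom \<alpha> w) \<le> norm (e_monom \<alpha> (\<chi> j. of_real (T $ j)))"
proof -
  have "norm (mpower w \<alpha>) \<le> norm (mpower (\<chi> j. complex_of_real (T $ j)) \<alpha>)"
    unfolding norm_mpower unfolding mpower_def using assms T
    by (intro prod_mono conjI power_mono) (auto simp: pos_vecs_def abs_of_pos)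
  then show ?thesis unfolding e_monom_def norm_divide by (rule divide_right_mono) simp
qed

text \<open>Orthogonality leaves one term of the integrated series. Each monomial is largest on
  \<open>K\<close> in modulus at the corner \<open>T\<close>, and convergence of the series there
  supplies the majorant.\<close>

lemma coefficient_integral:
  assumes F: "\<And>w. ((\<lambda>\<alpha>. c \<alpha> * e_monom \<alpha> w) has_sum F w) UNIV" and cont: "continuous_on UNIV F"
  shows "(LINT w|lborel. of_real (k w) * (F w * cnj (e_monom \<beta> w))) = c \<beta> * of_real (moment \<beta>)"
proof -
  let ?T = "(\<chi> j. of_real (T $ j)) :: complex ^ 'd"
  have [measurable]: "F \<in> borel_measurable borel" by (rule borel_measurable_continuous_onI[OF cont])
  let ?f = "\<lambda>\<alpha> w. c \<alpha> * e_monom \<alpha> w * cnj (e_monom \<beta> w)"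
  have 1: "((\<lambda>\<alpha>. LINT w|lborel. of_real (k w) * ?f \<alpha> w) has_sum
    (LINT w|lborel. of_real (k w) * (F w * cnj (e_monom \<beta> w)))) UNIV"
  proof (rule has_sum_integral)
    show "((\<lambda>\<alpha>. ?f \<alpha> w) has_sum F w * cnj (e_monom \<beta> w)) UNIV" for w
      by (intro has_sum_cmult_left F)
    show "norm (?f \<alpha> w) \<le> norm (c \<alpha> * e_monom \<alpha> ?T) * norm (e_monom \<beta> ?T)" if "w \<in> K" for \<alpha> w
      using norm_e_monom_le[OF that] by (auto simp: norm_mult intro!: mult_mono)
    show "(\<lambda>\<alpha>. norm (c \<alpha> * e_monom \<alpha> ?T) * norm (e_monom \<beta> ?T)) summable_on UNIV"
      by (intro summable_on_cmult_left summable_on_iff_abs_summable_on_complex[THEN iffD1]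
          has_sum_imp_summable[OF F])
  qed measurable
  have eq: "(LINT w|lborel. of_real (k w) * ?f \<alpha> w) = (if \<alpha> = \<beta> then c \<beta> * of_real (moment \<beta>) else 0)" for \<alpha>
  proof -
    have "(LINT w|lborel. of_real (k w) * ?f \<alpha> w)
        = (LINT w|lborel. c \<alpha> * (of_real (k w) * (e_monom \<alpha> w * cnj (e_monom \<beta> w))))"
      by (simp add: mult_ac)
    also have "\<dots> = c \<alpha> * (LINT w|lborel. of_real (k w) * (e_monom \<alpha> w * cnj (e_monom \<beta> w)))"
      by (rule integral_mult_right_zero)
    finally show ?thesis using orthogonality diagonal by auto
  qed
  have "((\<lambda>\<alpha>. if \<alpha> = \<beta> then c \<beta> * of_real (moment \<beta>) else 0) has_sum (c \<beta> * of_real (moment \<beta>))) UNIV"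
    using has_sum_only[of \<beta> "\<lambda>\<alpha>. if \<alpha> = \<beta> then c \<beta> * of_real (moment \<beta>) else 0"] by simp
  with 1 show ?thesis unfolding eq by (rule has_sum_unique)
qed

text \<open>Only the exponential kernel is expanded here, \<open>F\<close> being merely bounded on
  \<open>K\<close>; the resulting integrals are those of
  \<open>coefficient_integral\<close>.\<close>

lemma has_sum_projection:
  assumes F: "\<And>w. ((\<lambda>\<alpha>. c \<alpha> * e_monom \<alpha> w) has_sum F w) UNIV" and cont: "continuous_on UNIV F"
  shows "((\<lambda>\<beta>. of_real (moment \<beta>) * c \<beta> * e_monom \<beta> z) has_sum
    (LINT w|lborel. of_real (k w) * (F w * exp (\<Sum>j\<in>UNIV. z $ j * cnj (w $ j))))) UNIV"
proof -
  let ?T = "(\<chi> j. of_real (T $ j)) :: complex ^ 'd"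
  have [measurable]: "F \<in> borel_measurable borel" by (rule borel_measurable_continuous_onI[OF cont])
  have [measurable]: "(\<lambda>w. exp (\<Sum>j\<in>UNIV. z $ j * cnj (w $ j))) \<in> borel_measurable borel"
    by (intro borel_measurable_continuous_onI continuous_intros)
  obtain M where M: "0 < M" "\<And>w. w \<in> K \<Longrightarrow> norm (F w) \<le> M"
    by (rule continuous_bounded_on_K[OF cont]) blast
  have "((\<lambda>\<beta>. LINT w|lborel. of_real (k w) * (F w * (e_monom \<beta> z * cnj (e_monom \<beta> w)))) has_sum
    (LINT w|lborel. of_real (k w) * (F w * exp (\<Sum>j\<in>UNIV. z $ j * cnj (w $ j))))) UNIV"
  proof (rule has_sum_integral)
    show "((\<lambda>\<beta>. F w * (e_monom \<beta> z * cnj (e_monom \<beta> w))) has_sum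
        F w * exp (\<Sum>j\<in>UNIV. z $ j * cnj (w $ j))) UNIV" for w
      by (intro has_sum_cmult_right has_sum_e_monom_kernel)
    show "norm (F w * (e_monom \<beta> z * cnj (e_monom \<beta> w))) \<le> M * norm (e_monom \<beta> z * cnj (e_monom \<beta> ?T))"
      if "w \<in> K" for \<beta> w
      using norm_e_monom_le[OF that] M that by (auto simp: norm_mult simp del: mem_Collect_eq intro!: mult_mono)
    show "(\<lambda>\<beta>. M * norm (e_monom \<beta> z * cnj (e_monom \<beta> ?T))) summable_on UNIV"
      by (intro summable_on_cmult_right summable_on_iff_abs_summable_on_complex[THEN iffD1]
          has_sum_imp_summable[OF has_sum_e_monom_kernel])
  qed measurable
  moreover have "(LINT w|lborel. of_real (k w) * (F w * (e_monom \<beta> z * cnj (e_monom \<beta> w))))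
      = of_real (moment \<beta>) * c \<beta> * e_monom \<beta> z" for \<beta>
  proof -
    have "(LINT w|lborel. of_real (k w) * (F w * (e_monom \<beta> z * cnj (e_monom \<beta> w))))
      = (LINT w|lborel. e_monom \<beta> z * (of_real (k w) * (F w * cnj (e_monom \<beta> w))))"
      by (simp add: mult_ac)
    also have "\<dots> = e_monom \<beta> z * (LINT w|lborel. of_real (k w) * (F w * cnj (e_monom \<beta> w)))"
      by (rule integral_mult_right_zero)
    also have "\<dots> = of_real (moment \<beta>) * c \<beta> * e_monom \<beta> z"
      by (simp add: coefficient_integral[OF F cont])
    finally show ?thesis .
  qed
  ultimately show ?thesis by simp
qed

section \<open>Two-sided bounds for the moments\<close>

lemma integrable_moment: "integrable lborel (\<lambda>w. k w * norm (e_monom \<beta> w) ^ 2)"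
  using integrable_kernel_mult[of "\<lambda>w. norm (e_monom \<beta> w) ^ 2" "norm (e_monom \<beta> (\<chi> j. of_real (T $ j))) ^ 2"]
    norm_e_monom_le by (simp add: power_mono)

lemma moment_upper:
  obtains C where "0 < C" "\<And>\<beta>. moment \<beta> \<le> C * (mpower (\<chi> j. T $ j ^ 2) \<beta> * mfact \<beta> powr (- 1))"
proof
  \<comment> \<open>Adding 1 makes the constant positive from nonnegativity of the integral
    alone.\<close>
  show "0 < integral\<^sup>L lborel k + 1" using integral_nonneg_AE[OF k_nonneg] by simp
  fix \<beta>
  let ?m = "mpower (\<chi> j. T $ j ^ 2) \<beta> / mfact \<beta>"
  have m0: "0 \<le> ?m" using mfact_pos[of \<beta>] by (auto simp: mpower_def intro!: prod_nonneg divide_nonneg_pos)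
  have "moment \<beta> \<le> (LINT w|lborel. k w * ?m)"
    unfolding moment_def
  proof (rule integral_mono_AE[OF integrable_moment])
    show "integrable lborel (\<lambda>w. k w * ?m)" using integrable_kernel by simp
    show "AE w in lborel. k w * norm (e_monom \<beta> w) ^ 2 \<le> k w * ?m"
      using k_nonneg k_supp
    proof eventually_elim
      case (elim w)
      have "norm (e_monom \<beta> w) ^ 2 \<le> ?m" if w: "w \<in> K"
        unfolding norm_e_monom_power2 mpower_def using w mfact_pos[of \<beta>]
        by (intro divide_right_mono prod_mono conjI power_mono) (auto intro!: power_mono)
      then show ?case using elim mult_left_mono[of "norm (e_monom \<beta> w) ^ 2" ?m "k w"]
        by (cases "w \<in> K") (blast, simp)
    qed
  qed
  also have "\<dots> = integral\<^sup>L lborel k * ?m" by simp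
  also have "\<dots> \<le> (integral\<^sup>L lborel k + 1) * ?m" using m0 by (intro mult_right_mono) auto
  also have "?m = mpower (\<chi> j. T $ j ^ 2) \<beta> * mfact \<beta> powr (- 1)"
    unfolding mfact_powr_minus_one by simp
  finally show "moment \<beta> \<le> (integral\<^sup>L lborel k + 1) * \<dots>" .
qed

text \<open>The integral is restricted to the product of annuli t_j/2 < |w_j| < t_j, where both the
  kernel and every monomial are bounded below. This set is open and nonempty, hence of positive
  measure.\<close>

lemma moment_lower:
  obtains C where "0 < C" "\<And>\<beta>. C * (mpower (\<chi> j. (t $ j / 2) ^ 2) \<beta> * mfact \<beta> powr (- 1)) \<le> moment \<beta>"
proof
  define A where "A = {w :: complex ^ 'd. \<forall>j. t $ j / 2 < norm (w $ j) \<and> norm (w $ j) < t $ j}"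
  have tj: "0 < t $ j" for j using t by (simp add: pos_vecs_def)
  have "open A"
  proof -
    have "A = (\<Inter>j. {w. t $ j / 2 < norm (w $ j)} \<inter> {w. norm (w $ j) < t $ j})" by (auto simp: A_def)
    also have "open \<dots>" by (intro open_INT ballI open_Int open_Collect_less continuous_intros finite)
    finally show ?thesis .
  qed
  moreover have "A \<subseteq> {w. \<forall>j. norm (w $ j) \<le> t $ j}" by (auto simp: A_def intro: less_imp_le)
  then have bA: "bounded A" using compact_imp_bounded[OF compact_closed_polydisc] bounded_subset by blast
  moreover have "(\<chi> j. of_real (3 / 4 * t $ j)) \<in> A" using tj by (auto simp: A_def norm_mult abs_of_pos)
  ultimately have A: "A \<in> lmeasurable" "\<not> negligible A" and [measurable]: "A \<in> sets borel"
    using lmeasurable_open open_not_negligible by auto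
  then have "measure lebesgue A \<noteq> 0" using negligible_iff_measure by blast
  then have mA: "0 < measure lborel A" by (simp add: zero_less_measure_iff)
  then show "0 < lo * measure lborel A" using lo by simp
  fix \<beta>
  let ?m = "mpower (\<chi> j. (t $ j / 2) ^ 2) \<beta> / mfact \<beta>"
  have fin: "emeasure lborel A < \<infinity>" using bA by (rule emeasure_bounded_finite)
  have "lo * measure lborel A * ?m = (LINT w|lborel. indicator A w * (lo * ?m))"
    by simp
  also have "\<dots> \<le> moment \<beta>"
    unfolding moment_def
  proof (rule integral_mono_AE[OF _ integrable_moment])
    show "integrable lborel (\<lambda>w. indicator A w * (lo * ?m))"
      using fin by (intro integrable_mult_left) simp
    show "AE w in lborel. indicator A w * (lo * ?m) \<le> k w * norm (e_monom \<beta> w) ^ 2"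
      using k_nonneg k_ge
    proof eventually_elim
      case (elim w)
      show ?case
      proof (cases "w \<in> A")
        case True
        have "?m \<le> norm (e_monom \<beta> w) ^ 2"
          unfolding norm_e_monom_power2 mpower_def using True mfact_pos[of \<beta>] tj
          by (intro divide_right_mono prod_mono conjI power_mono) (auto simp: A_def less_imp_le intro!: power_mono)
        moreover have "lo \<le> k w" using elim True by (auto simp: A_def)
        ultimately have "lo * ?m \<le> k w * norm (e_monom \<beta> w) ^ 2"
          using lo mfact_pos[of \<beta>] elim by (intro mult_mono) (auto simp: mpower_def intro!: prod_nonneg divide_nonneg_pos)
        then show ?thesis using True by simp
      qed (use elim in simp)
    qed
  qed
  finally show "lo * measure lborel A * (mpower (\<chi> j. (t $ j / 2) ^ 2) \<beta> * mfact \<beta> powr (- 1)) \<le> moment \<beta>"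
    unfolding mfact_powr_minus_one by simp
qed

lemma moment_pos: "0 < moment \<beta>"
proof -
  obtain C where "0 < C" "\<And>\<beta>. C * (mpower (\<chi> j. (t $ j / 2) ^ 2) \<beta> * mfact \<beta> powr (- 1)) \<le> moment \<beta>"
    by (rule moment_lower) blast
  moreover have "0 < mpower (\<chi> j. (t $ j / 2) ^ 2) \<beta> * mfact \<beta> powr (- 1)"
    using t mfact_pos[of \<beta>]
    by (intro mult_pos_pos mpower_pos) (simp_all add: pos_vecs_def, metis less_irrefl)
  ultimately show ?thesis by (meson less_le_trans mult_pos_pos)
qed

end

section \<open>Coefficient decay and growth\<close>

lemma power_over_fact_le_exp: "0 \<le> y \<Longrightarrow> y ^ n / fact n \<le> exp y" for y :: real
proof -
  assume y: "0 \<le> y"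
  have "(\<Sum>i\<in>{n}. y ^ i / fact i) \<le> (\<Sum>i. y ^ i / fact i)"
    using y summable_exp[of y] by (intro sum_le_suminf) (auto simp: field_simps)
  then show ?thesis by (simp add: exp_def field_simps)
qed

text \<open>Rewrites a term with a fractional power of the factorial as a power of a term of the
  exponential series.\<close>

lemma power_mult_fact_powr:
  fixes x p :: real
  assumes x: "0 \<le> x" and p: "0 < p"
  shows "x ^ n * fact n powr (- p) = ((x powr (1 / p)) ^ n / fact n) powr p"
proof -
  let ?y = "x powr (1 / p)"
  have y: "0 \<le> ?y" by simp
  have "x ^ n = (?y ^ n) powr p"
  proof (cases "x = 0")
    case True then show ?thesis by (cases n) auto
  next
    case False
    then have "0 < ?y" "?y powr p = x" using x p by (auto simp: powr_powr)
    then show ?thesis by (metis powr_powr_swap powr_realpow zero_less_power powr_gt_zero less_imp_neq)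
  qed
  then show ?thesis
    using y by (simp add: powr_divide powr_minus field_simps)
qed

text \<open>Split t^p into t * t^(p-1) and bound only the second factor by means of t <= exp y. The
  first factors still sum to exp y, so the total is exp (p * y).\<close>

lemma powr_term_le:
  fixes x p :: real
  assumes x: "0 \<le> x" and p: "1 \<le> p"
  defines "y \<equiv> x powr (1 / p)"
  shows "x ^ n * fact n powr (- p) \<le> y ^ n / fact n * exp y powr (p - 1)"
proof -
  let ?t = "y ^ n / fact n"
  have y: "0 \<le> y" by (simp add: y_def)
  have t: "0 \<le> ?t" using y by simp
  have "x ^ n * fact n powr (- p) = ?t powr p"
    unfolding y_def using p by (intro power_mult_fact_powr[OF x]) simp
  also have "\<dots> = ?t * ?t powr (p - 1)"
    using powr_mult_base[OF t, of "p - 1"] by simp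
  also have "\<dots> \<le> ?t * exp y powr (p - 1)"
    using t power_over_fact_le_exp[OF y, of n] p by (intro mult_left_mono powr_mono2) auto
  finally show ?thesis .
qed

lemma has_sum_exp_majorant:
  "((\<lambda>n. y ^ n / fact n * exp y powr (p - 1)) has_sum exp (p * y)) UNIV"
  and norm_summable_exp_majorant:
  "(\<lambda>n. norm (y ^ n / fact n * exp y powr (p - 1))) summable_on UNIV" for y p :: real
proof -
  have s: "summable (\<lambda>n. norm (y ^ n / fact n))"
    using summable_norm_exp[of y] by (simp add: field_simps)
  have "(\<lambda>n. y ^ n / fact n) sums exp y"
    using exp_converges[of y] by (simp add: field_simps)
  from norm_summable_imp_has_sum[OF s this]
  have "((\<lambda>n. y ^ n / fact n * exp y powr (p - 1)) has_sum (exp y * exp y powr (p - 1))) UNIV"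
    by (rule has_sum_cmult_left)
  also have "exp y * exp y powr (p - 1) = exp (p * y)"
    by (simp add: exp_powr_real exp_add[symmetric] algebra_simps)
  finally show "((\<lambda>n. y ^ n / fact n * exp y powr (p - 1)) has_sum exp (p * y)) UNIV" .
  have "(\<lambda>n. norm (y ^ n / fact n)) summable_on UNIV"
    using norm_summable_imp_summable_on[of "\<lambda>n. norm (y ^ n / fact n)"] s by simp
  then show "(\<lambda>n. norm (y ^ n / fact n * exp y powr (p - 1))) summable_on UNIV"
    unfolding norm_mult by (rule summable_on_cmult_left)
qed

lemma mfact_powr: "mfact \<alpha> powr u = (\<Prod>j\<in>UNIV. fact (\<alpha> $ j) powr u)"
  unfolding mfact_def by (simp add: prod_powr_distrib)

lemma norm_e_monom: "norm (e_monom \<alpha> z) = mpower (\<chi> j. norm (z $ j)) \<alpha> * mfact \<alpha> powr (- 1 / 2)"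
proof -
  have "mfact \<alpha> powr (- (1 / 2)) = 1 / sqrt (mfact \<alpha>)"
    using mfact_pos[of \<alpha>] by (simp only: powr_minus_divide powr_half_sqrt less_imp_le)
  then show ?thesis
    using mfact_pos[of \<alpha>] by (simp add: e_monom_def norm_divide norm_mpower)
qed

lemma e_monom_eq: "c * e_monom \<alpha> z = c / complex_of_real (sqrt (mfact \<alpha>)) * mpower z \<alpha>"
  by (simp add: e_monom_def)

text \<open>\<open>p\<close> collects the exponents of \<alpha>! from the coefficient and from the
  normalisation of the monomial; the bound on \<open>s\<close> says p >= 1.\<close>

lemma coeff_term_majorant:
  fixes z :: "complex ^ 'd"
  assumes c: "norm (c \<alpha>) \<le> C * (mpower r \<alpha> * mfact \<alpha> powr s)" and C: "0 \<le> C"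
    and r: "r \<in> pos_vecs" and s: "s \<le> - 1 / 2" and p: "p = 1 / 2 - s"
  defines "y \<equiv> \<lambda>j. (r $ j * norm (z $ j)) powr (1 / p)"
  shows "norm (c \<alpha> * e_monom \<alpha> z) \<le> C * (\<Prod>j\<in>UNIV. y j ^ (\<alpha> $ j) / fact (\<alpha> $ j) * exp (y j) powr (p - 1))"
proof -
  have p1: "1 \<le> p" using s p by simp
  have rz: "0 \<le> r $ j * norm (z $ j)" for j using r by (simp add: pos_vecs_def less_imp_le)
  have "norm (c \<alpha> * e_monom \<alpha> z)
      \<le> C * (mpower r \<alpha> * mfact \<alpha> powr s) * (mpower (\<chi> j. norm (z $ j)) \<alpha> * mfact \<alpha> powr (- 1 / 2))"
    unfolding norm_mult norm_e_monom
    by (intro mult_right_mono c) (auto simp: mpower_def intro!: prod_nonneg mult_nonneg_nonneg)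
  also have "\<dots> = C * (mpower (\<chi> j. r $ j * norm (z $ j)) \<alpha> * mfact \<alpha> powr (- p))"
  proof -
    have powr_p: "mfact \<alpha> powr (- p) = mfact \<alpha> powr s * mfact \<alpha> powr (- 1 / 2)"
      using p by (simp add: powr_add[symmetric])
    have mpower_rz: "mpower (\<chi> j. r $ j * norm (z $ j)) \<alpha> = mpower r \<alpha> * mpower (\<chi> j. norm (z $ j)) \<alpha>"
      by (simp add: mpower_def power_mult_distrib prod.distrib)
    show ?thesis unfolding powr_p mpower_rz by (simp only: mult_ac)
  qed
  also have "\<dots> = C * (\<Prod>j\<in>UNIV. (r $ j * norm (z $ j)) ^ (\<alpha> $ j) * fact (\<alpha> $ j) powr (- p))"
    by (simp add: mpower_def mfact_powr prod.distrib)
  also have "\<dots> \<le> C * (\<Prod>j\<in>UNIV. y j ^ (\<alpha> $ j) / fact (\<alpha> $ j) * exp (y j) powr (p - 1))"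
    unfolding y_def using rz C by (intro mult_left_mono prod_mono conjI powr_term_le p1) auto
  finally show ?thesis .
qed

lemma has_sum_prod_majorant:
  "((\<lambda>\<alpha> :: nat ^ 'd. C * (\<Prod>j\<in>UNIV. y j ^ (\<alpha> $ j) / fact (\<alpha> $ j) * exp (y j) powr (p - 1))) has_sum
     (C * exp (\<Sum>j\<in>UNIV. p * y j))) UNIV" for y :: "'d::finite \<Rightarrow> real" and C :: real
  unfolding exp_sum[OF finite]
  by (intro has_sum_cmult_right has_sum_prod_vec has_sum_exp_majorant norm_summable_exp_majorant)

lemma growth_of_coeffs:
  assumes F: "((\<lambda>\<alpha>. c \<alpha> * e_monom \<alpha> z) has_sum F) UNIV"
    and c: "\<And>\<alpha>. norm (c \<alpha>) \<le> C * (mpower r \<alpha> * mfact \<alpha> powr s)" and C: "0 \<le> C"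
    and r: "r \<in> pos_vecs" and s: "s \<le> - 1 / 2" and p: "p = 1 / 2 - s"
  shows "norm F \<le> C * exp (\<Sum>j\<in>UNIV. p * (r $ j * norm (z $ j)) powr (1 / p))"
proof -
  have "(\<lambda>\<alpha>. norm (c \<alpha> * e_monom \<alpha> z)) summable_on UNIV"
    using has_sum_imp_summable[OF F] by (simp add: summable_on_iff_abs_summable_on_complex)
  then have "norm F \<le> (\<Sum>\<^sub>\<infinity>\<alpha>. norm (c \<alpha> * e_monom \<alpha> z))"
    by (intro norm_has_sum_bound[OF _ F] has_sum_infsum)
  also have "\<dots> \<le> C * exp (\<Sum>j\<in>UNIV. p * (r $ j * norm (z $ j)) powr (1 / p))"
    by (rule has_sum_mono[OF has_sum_infsum has_sum_prod_majorant])
      (fact, rule coeff_term_majorant[OF c C r s p])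
  finally show ?thesis .
qed

text \<open>For \<open>n > 0\<close> the radius \<open>(n / (\<rho> * r)) powr (1 / \<rho>)\<close> minimises \<open>exp (r * R powr \<rho>) / R ^ n\<close>.\<close>

lemma Cauchy_radius:
  fixes \<rho> r :: real and n :: nat
  assumes \<rho>: "0 < \<rho>" and r: "0 < r"
  obtains R where "0 < R"
    "exp (r * R powr \<rho>) \<le> exp r * (((\<rho> * r * exp 1) powr (1 / \<rho>)) ^ n * fact n powr (- 1 / \<rho>)) * R ^ n"
proof (cases "n = 0")
  case True
  \<comment> \<open>The minimising radius would be 0 here. With radius 1 the estimate is an
    equality, which is the origin of the factor \<open>exp r\<close>.\<close>
  then show ?thesis by (intro that[of 1]) auto
next
  case False
  define R where "R = (n / (\<rho> * r)) powr (1 / \<rho>)"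
  let ?Q = "(\<rho> * r * exp 1) powr (1 / \<rho>)"
  have n: "0 < real n" using False by simp
  have R: "0 < R" using n \<rho> r by (simp add: R_def)
  have "r * R powr \<rho> = n / \<rho>" using n \<rho> r by (simp add: R_def powr_powr)
  have "?Q ^ n * R ^ n = ((\<rho> * r * exp 1) * (n / (\<rho> * r))) powr (n / \<rho>)"
    using \<rho> r n by (simp add: R_def powr_mult[symmetric] power_mult_distrib[symmetric] powr_realpow[symmetric] powr_powr)
  also have "(\<rho> * r * exp 1) * (n / (\<rho> * r)) = exp 1 * n" using \<rho> r by simp
  also have "(exp 1 * n) powr (n / \<rho>) = exp (n / \<rho>) * n powr (n / \<rho>)"
    by (simp add: powr_mult exp_powr_real)
  finally have QR: "?Q ^ n * R ^ n = exp (n / \<rho>) * n powr (n / \<rho>)" .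
  \<comment> \<open>The elementary bound n! <= n^n replaces Stirling's formula; the exponential is
    already contained in \<open>?Q\<close>.\<close>
  have "fact n powr (1 / \<rho>) \<le> (real n ^ n) powr (1 / \<rho>)"
    using \<rho> fact_le_power[of n, where ?'a = real] by (intro powr_mono2) auto
  also have "\<dots> = n powr (n / \<rho>)"
    using n by (simp add: powr_realpow[symmetric] powr_powr)
  finally have "1 \<le> fact n powr (- 1 / \<rho>) * n powr (n / \<rho>)"
    by (simp add: powr_minus field_simps)
  then have "exp (n / \<rho>) \<le> exp (n / \<rho>) * (fact n powr (- 1 / \<rho>) * n powr (n / \<rho>))" by simp
  also have "\<dots> = fact n powr (- 1 / \<rho>) * (?Q ^ n * R ^ n)"
    unfolding QR by (simp only: mult_ac)
  also have "\<dots> \<le> exp r * (fact n powr (- 1 / \<rho>) * (?Q ^ n * R ^ n))"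
  proof -
    have "1 \<le> exp r" "0 \<le> fact n powr (- 1 / \<rho>) * (?Q ^ n * R ^ n)" using r R by auto
    from mult_right_mono[OF this] show ?thesis by simp
  qed
  finally have "exp (r * R powr \<rho>) \<le> exp r * (?Q ^ n * fact n powr (- 1 / \<rho>)) * R ^ n"
    by (simp only: \<open>r * R powr \<rho> = n / \<rho>\<close> mult_ac)
  with R show ?thesis by (rule that)
qed

text \<open>The exponent is a sum over coordinates, so the radius of the polydisc can be optimised
  separately in each, depending on \<alpha>_j.\<close>

lemma coeffs_of_growth:
  fixes F :: "complex ^ 'd \<Rightarrow> complex"
  assumes cb: "Cauchy_bounded F a" and \<rho>: "0 < \<rho>" and r: "r \<in> pos_vecs" and C: "0 \<le> C"
    and F: "\<And>z. norm (F z) \<le> C * exp (\<Sum>j\<in>UNIV. r $ j * norm (z $ j) powr \<rho>)"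
  shows "norm (a \<alpha>) \<le> C * exp (\<Sum>j\<in>UNIV. r $ j) *
    (mpower (\<chi> j. (\<rho> * r $ j * exp 1) powr (1 / \<rho>)) \<alpha> * mfact \<alpha> powr (- 1 / \<rho>))"
proof -
  let ?Q = "\<lambda>j. (\<rho> * r $ j * exp 1) powr (1 / \<rho>)"
  have "\<forall>j. \<exists>R>0. exp (r $ j * R powr \<rho>)
      \<le> exp (r $ j) * (?Q j ^ (\<alpha> $ j) * fact (\<alpha> $ j) powr (- 1 / \<rho>)) * R ^ (\<alpha> $ j)"
  proof
    fix j
    show "\<exists>R>0. exp (r $ j * R powr \<rho>)
      \<le> exp (r $ j) * (?Q j ^ (\<alpha> $ j) * fact (\<alpha> $ j) powr (- 1 / \<rho>)) * R ^ (\<alpha> $ j)"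
      by (rule Cauchy_radius[OF \<rho>, of "r $ j" "\<alpha> $ j"]) (use r in \<open>auto simp: pos_vecs_def\<close>)
  qed
  then obtain R' where R': "\<And>j. 0 < R' j" "\<And>j. exp (r $ j * R' j powr \<rho>)
      \<le> exp (r $ j) * (?Q j ^ (\<alpha> $ j) * fact (\<alpha> $ j) powr (- 1 / \<rho>)) * R' j ^ (\<alpha> $ j)"
    by metis
  define R :: "real ^ 'd" where "R = (\<chi> j. R' j)"
  have R: "R \<in> pos_vecs" using R'(1) by (simp add: R_def pos_vecs_def)
  let ?M = "C * exp (\<Sum>j\<in>UNIV. r $ j * R $ j powr \<rho>)"
  have "norm (F w) \<le> ?M" if w: "\<forall>j. norm (w $ j) \<le> R $ j" for w
  proof -
    have "(\<Sum>j\<in>UNIV. r $ j * norm (w $ j) powr \<rho>) \<le> (\<Sum>j\<in>UNIV. r $ j * R $ j powr \<rho>)"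
      using w r \<rho> by (intro sum_mono mult_left_mono powr_mono2) (auto simp: pos_vecs_def less_imp_le)
    then have "C * exp (\<Sum>j\<in>UNIV. r $ j * norm (w $ j) powr \<rho>) \<le> ?M"
      using C by (intro mult_left_mono) auto
    with F[of w] show ?thesis by (rule order_trans)
  qed
  then have "norm (a \<alpha>) * mpower R \<alpha> \<le> ?M"
    using cb R unfolding Cauchy_bounded_def by blast
  also have "\<dots> \<le> C * (\<Prod>j\<in>UNIV. exp (r $ j) * (?Q j ^ (\<alpha> $ j) * fact (\<alpha> $ j) powr (- 1 / \<rho>)) * R $ j ^ (\<alpha> $ j))"
    unfolding exp_sum[OF finite] using C R'(2) by (intro mult_left_mono prod_mono) (auto simp: R_def)
  also have "\<dots> = C * exp (\<Sum>j\<in>UNIV. r $ j) *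
    (mpower (\<chi> j. ?Q j) \<alpha> * mfact \<alpha> powr (- 1 / \<rho>)) * mpower R \<alpha>"
    by (simp add: exp_sum mpower_def mfact_powr prod.distrib mult_ac)
  finally show ?thesis using mpower_pos[OF R, of \<alpha>] by (simp add: mult_le_cancel_right)
qed

section \<open>The Bargmann projection as a multiplier\<close>

lemma radial_kernel_indicator_polydisc:
  "radial_kernel (indicator {w :: complex ^ 'd. \<forall>j. norm (w $ j) \<le> 1}) (\<chi> j. 1) (\<chi> j. 1) 1 1"
proof
  have "closed {w :: complex ^ 'd. \<forall>j. norm (w $ j) \<le> 1}"
    using compact_imp_closed[OF compact_closed_polydisc[of "\<chi> j. 1"]] by simp
  then show "(indicator {w :: complex ^ 'd. \<forall>j. norm (w $ j) \<le> 1} :: _ \<Rightarrow> real) \<in> borel_measurable borel"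
    by simp
qed (auto simp: pos_vecs_def indicator_def norm_mult less_imp_le)

lemma entire_of_has_sum_e_monom:
  assumes "\<And>z. ((\<lambda>\<alpha>. c \<alpha> * e_monom \<alpha> z) has_sum F z) UNIV"
  shows "F \<in> entire"
  using assms unfolding e_monom_eq by (rule entire_of_has_sum)

text \<open>Integration against a conjugate monomial over the unit polydisc gives the coefficient
  times a positive moment.\<close>

lemma power_series_unique:
  assumes c: "\<And>z. ((\<lambda>\<alpha>. c \<alpha> * e_monom \<alpha> z) has_sum F z) UNIV"
    and c': "\<And>z. ((\<lambda>\<alpha>. c' \<alpha> * e_monom \<alpha> z) has_sum F z) UNIV"
  shows "c = c'"
proof
  fix \<beta>
  interpret radial_kernel "indicator {w :: complex ^ 'a. \<forall>j. norm (w $ j) \<le> 1}" "\<chi> j. 1" "\<chi> j. 1" 1 1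
    by (rule radial_kernel_indicator_polydisc)
  have cont: "continuous_on UNIV F"
    by (rule entire_imp_continuous_on[OF entire_of_has_sum_e_monom[OF c]])
  show "c \<beta> = c' \<beta>"
    using coefficient_integral[OF c cont, of \<beta>] coefficient_integral[OF c' cont, of \<beta>] moment_pos[of \<beta>]
    by simp
qed

lemma power_series_eqI:
  assumes "\<And>z. ((\<lambda>\<alpha>. c \<alpha> * e_monom \<alpha> z) has_sum F z) UNIV"
  shows "power_series F = c"
  unfolding power_series_def
proof (rule the_equality)
  show "\<forall>z. ((\<lambda>\<alpha>. c \<alpha> * e_monom \<alpha> z) has_sum F z) UNIV" using assms by blast
  fix c' assume "\<forall>z. ((\<lambda>\<alpha>. c' \<alpha> * e_monom \<alpha> z) has_sum F z) UNIV"
  then show "c' = c" using assms by (intro power_series_unique[of c' F c]) auto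
qed

text \<open>Cauchy's estimates concern the coefficients of the plain monomials, which differ from
  those of \<open>e_monom\<close> by sqrt(\<alpha>!).\<close>

lemma
  assumes F: "F \<in> entire"
  shows has_sum_power_series: "((\<lambda>\<alpha>. power_series F \<alpha> * e_monom \<alpha> z) has_sum F z) UNIV"
    and Cauchy_bounded_power_series: "Cauchy_bounded F (\<lambda>\<alpha>. power_series F \<alpha> / complex_of_real (sqrt (mfact \<alpha>)))"
proof -
  obtain a where a: "\<And>z. ((\<lambda>\<alpha>. a \<alpha> * mpower z \<alpha>) has_sum F z) UNIV" and cb: "Cauchy_bounded F a"
    using entire_expansion[OF F] by blast
  let ?c = "\<lambda>\<alpha>. a \<alpha> * complex_of_real (sqrt (mfact \<alpha>))"
  have nz: "sqrt (mfact \<alpha>) \<noteq> 0" for \<alpha> :: "nat ^ 'a" using mfact_pos[of \<alpha>] by simp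
  have c: "((\<lambda>\<alpha>. ?c \<alpha> * e_monom \<alpha> z) has_sum F z) UNIV" for z
    using a[of z] nz by (simp add: e_monom_def)
  have ps: "power_series F = ?c" by (rule power_series_eqI[OF c])
  show "((\<lambda>\<alpha>. power_series F \<alpha> * e_monom \<alpha> z) has_sum F z) UNIV"
    unfolding ps by (rule c)
  have "(\<lambda>\<alpha>. power_series F \<alpha> / complex_of_real (sqrt (mfact \<alpha>))) = a"
    using nz by (simp add: ps)
  then show "Cauchy_bounded F (\<lambda>\<alpha>. power_series F \<alpha> / complex_of_real (sqrt (mfact \<alpha>)))"
    using cb by simp
qed

lemma power_series_inject:
  assumes "F \<in> entire" "G \<in> entire" "power_series F = power_series G"
  shows "F = G"
proof
  fix z
  show "F z = G z"
    using has_sum_power_series[OF assms(1), of z] has_sum_power_series[OF assms(2), of z]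
    unfolding assms(3) by (rule has_sum_unique)
qed

text \<open>Covers all p > 0, where \<open>powr_term_le\<close> needs p >= 1: replacing x by 2 * x
  leaves a geometric factor, and the rest is bounded uniformly in n.\<close>

lemma norm_summable_power_fact_powr:
  fixes x p :: real
  assumes x: "0 \<le> x" and p: "0 < p"
  shows "(\<lambda>n. norm (x ^ n * fact n powr (- p))) summable_on UNIV"
proof -
  let ?y = "(2 * x) powr (1 / p)"
  have "(\<lambda>n. (1 / 2) ^ n * exp ?y powr p) summable_on UNIV"
    by (intro summable_on_cmult_left) (simp add: summable_on_UNIV_nonneg_real_iff)
  then show ?thesis
  proof (rule summable_on_comparison_test)
    fix n
    have "x ^ n * fact n powr (- p) = (1 / 2) ^ n * ((2 * x) ^ n * fact n powr (- p))"
      by (simp add: power_mult_distrib power_divide)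
    also have "\<dots> = (1 / 2) ^ n * (?y ^ n / fact n) powr p"
      using x p by (subst power_mult_fact_powr) auto
    also have "\<dots> \<le> (1 / 2) ^ n * exp ?y powr p"
      using p power_over_fact_le_exp[of ?y n] by (intro mult_left_mono powr_mono2) auto
    finally show "norm (x ^ n * fact n powr (- p)) \<le> (1 / 2) ^ n * exp ?y powr p"
      using x by simp
  qed simp
qed

text \<open>For s < 1/2 the factor 1/sqrt(\<alpha>!) of the monomials outweighs the weight, so every
  formal series in the space converges everywhere.\<close>

lemma banach_imp_entire:
  assumes r: "r \<in> pos_vecs" and c: "c \<in> banach s r" and s: "s < 1 / 2"
  obtains F where "F \<in> entire" "power_series F = c"
proof -
  obtain C where C: "0 < C" "\<And>\<alpha>. norm (c \<alpha>) \<le> C * weight s r \<alpha>"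
    using c unfolding banach_iff[OF r] lesssim_def by blast
  have "(\<lambda>\<alpha>. c \<alpha> * e_monom \<alpha> z) summable_on UNIV" for z
  proof (rule abs_summable_summable, rule summable_on_comparison_test)
    let ?g = "\<lambda>j n. (r $ j * norm (z $ j)) ^ n * fact n powr (- (1 / 2 - s))"
    have "(\<lambda>\<alpha>. norm (\<Prod>j\<in>UNIV. ?g j (\<alpha> $ j))) summable_on UNIV"
      using r s by (intro abs_summable_prod_vec norm_summable_power_fact_powr)
        (auto simp: pos_vecs_def less_imp_le)
    then show "(\<lambda>\<alpha>. C * norm (\<Prod>j\<in>UNIV. ?g j (\<alpha> $ j))) summable_on UNIV"
      by (rule summable_on_cmult_right)
    fix \<alpha>
    have "norm (c \<alpha> * e_monom \<alpha> z) \<le> C * weight s r \<alpha> * (mpower (\<chi> j. norm (z $ j)) \<alpha> * mfact \<alpha> powr (- 1 / 2))"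
      unfolding norm_mult norm_e_monom
      by (intro mult_right_mono C) (auto simp: mpower_def intro!: prod_nonneg mult_nonneg_nonneg)
    also have "\<dots> = C * (mpower (\<chi> j. r $ j * norm (z $ j)) \<alpha> * mfact \<alpha> powr (- (1 / 2 - s)))"
    proof -
      have powr_p: "mfact \<alpha> powr (- (1 / 2 - s)) = mfact \<alpha> powr s * mfact \<alpha> powr (- 1 / 2)"
        by (simp add: powr_add[symmetric])
      show ?thesis unfolding powr_p weight_def mpower_vec_times
        using mpower_vec_times[of r "\<chi> j. norm (z $ j)" \<alpha>] by (simp add: mult_ac)
    qed
    also have "\<dots> = C * (\<Prod>j\<in>UNIV. ?g j (\<alpha> $ j))"
      by (simp add: mpower_def mfact_powr prod.distrib)
    finally show "norm (c \<alpha> * e_monom \<alpha> z) \<le> C * norm (\<Prod>j\<in>UNIV. ?g j (\<alpha> $ j))"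
      using C(1) by (simp add: order_trans[OF _ mult_left_mono[OF abs_ge_self]])
  qed simp
  then have F: "((\<lambda>\<alpha>. c \<alpha> * e_monom \<alpha> z) has_sum (\<Sum>\<^sub>\<infinity>\<alpha>. c \<alpha> * e_monom \<alpha> z)) UNIV" for z
    by (rule has_sum_infsum)
  from that[OF entire_of_has_sum_e_monom[OF F] power_series_eqI[OF F]] show thesis .
qed

section \<open>Growth order and coefficient decay\<close>

text \<open>Here p = 1/\<rho>, hence p * (r |z|)^(1/p) = (r^\<rho>/\<rho>) |z|^\<rho>; the condition
  \<sigma> <= 1 yields p >= 1.\<close>

lemma coeff_bound_imp_growth:
  assumes F: "F \<in> entire" and r: "r \<in> pos_vecs" and \<sigma>: "0 < \<sigma>" "\<sigma> \<le> 1"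
    and c: "(\<lambda>\<alpha>. norm (power_series F \<alpha>)) \<lesssim> (\<lambda>\<alpha>. mpower r \<alpha> * mfact \<alpha> powr (- 1 / (2 * \<sigma>)))"
  defines "\<rho> \<equiv> 2 * \<sigma> / (\<sigma> + 1)"
  shows "(\<lambda>z. norm (F z)) \<lesssim> (\<lambda>z. exp (\<Sum>j\<in>UNIV. (\<chi> j. r $ j powr \<rho> / \<rho>) $ j * norm (z $ j) powr \<rho>))"
proof -
  obtain C where C: "0 < C" "\<And>\<alpha>. norm (power_series F \<alpha>) \<le> C * (mpower r \<alpha> * mfact \<alpha> powr (- 1 / (2 * \<sigma>)))"
    using c unfolding lesssim_def by blast
  have p: "1 / \<rho> = 1 / 2 - (- 1 / (2 * \<sigma>))" using \<sigma> by (simp add: \<rho>_def field_simps)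
  have s: "- 1 / (2 * \<sigma>) \<le> - 1 / 2" using \<sigma> by (simp add: field_simps)
  have "norm (F z) \<le> C * exp (\<Sum>j\<in>UNIV. (\<chi> j. r $ j powr \<rho> / \<rho>) $ j * norm (z $ j) powr \<rho>)" for z
  proof -
    have "norm (F z) \<le> C * exp (\<Sum>j\<in>UNIV. 1 / \<rho> * (r $ j * norm (z $ j)) powr (1 / (1 / \<rho>)))"
      by (rule growth_of_coeffs[OF has_sum_power_series[OF F] C(2) less_imp_le[OF C(1)] r s p])
    also have "(\<Sum>j\<in>UNIV. 1 / \<rho> * (r $ j * norm (z $ j)) powr (1 / (1 / \<rho>)))
        = (\<Sum>j\<in>UNIV. (\<chi> j. r $ j powr \<rho> / \<rho>) $ j * norm (z $ j) powr \<rho>)"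
      using r by (intro sum.cong) (auto simp: powr_mult pos_vecs_def less_imp_le)
    finally show ?thesis .
  qed
  with C(1) show ?thesis unfolding lesssim_def by blast
qed

lemma growth_imp_coeff_bound:
  assumes F: "F \<in> entire" and r: "r \<in> pos_vecs" and \<sigma>: "0 < \<sigma>"
  defines "\<rho> \<equiv> 2 * \<sigma> / (\<sigma> + 1)"
  assumes g: "(\<lambda>z. norm (F z)) \<lesssim> (\<lambda>z. exp (\<Sum>j\<in>UNIV. r $ j * norm (z $ j) powr \<rho>))"
  shows "(\<lambda>\<alpha>. norm (power_series F \<alpha>)) \<lesssim>
    (\<lambda>\<alpha>. mpower (\<chi> j. (\<rho> * r $ j * exp 1) powr (1 / \<rho>)) \<alpha> * mfact \<alpha> powr (- 1 / (2 * \<sigma>)))"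
proof -
  obtain C where C: "0 < C" "\<And>z. norm (F z) \<le> C * exp (\<Sum>j\<in>UNIV. r $ j * norm (z $ j) powr \<rho>)"
    using g unfolding lesssim_def by blast
  have \<rho>: "0 < \<rho>" using \<sigma> by (simp add: \<rho>_def)
  \<comment> \<open>The summand 1/2 comes from returning to normalised monomials.\<close>
  have p: "- 1 / \<rho> + 1 / 2 = - 1 / (2 * \<sigma>)" using \<sigma> by (simp add: \<rho>_def field_simps)
  let ?Q = "\<chi> j. (\<rho> * r $ j * exp 1) powr (1 / \<rho>)" and ?C = "C * exp (\<Sum>j\<in>UNIV. r $ j)"
  have "norm (power_series F \<alpha>) \<le> ?C * (mpower ?Q \<alpha> * mfact \<alpha> powr (- 1 / (2 * \<sigma>)))" for \<alpha>
  proof -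
    have m: "0 < mfact \<alpha>" by (rule mfact_pos)
    have "norm (power_series F \<alpha> / complex_of_real (sqrt (mfact \<alpha>))) \<le> ?C * (mpower ?Q \<alpha> * mfact \<alpha> powr (- 1 / \<rho>))"
      by (rule coeffs_of_growth[OF Cauchy_bounded_power_series[OF F] \<rho> r less_imp_le[OF C(1)] C(2)])
    then have "norm (power_series F \<alpha>) \<le> ?C * (mpower ?Q \<alpha> * mfact \<alpha> powr (- 1 / \<rho>)) * sqrt (mfact \<alpha>)"
      using m by (simp add: norm_divide divide_le_eq)
    also have "sqrt (mfact \<alpha>) = mfact \<alpha> powr (1 / 2)" using m by (simp add: powr_half_sqrt)
    also have "?C * (mpower ?Q \<alpha> * mfact \<alpha> powr (- 1 / \<rho>)) * mfact \<alpha> powr (1 / 2)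
        = ?C * (mpower ?Q \<alpha> * mfact \<alpha> powr (- 1 / (2 * \<sigma>)))"
      unfolding p[symmetric] powr_add by (simp only: mult_ac)
    finally show ?thesis .
  qed
  moreover have "0 < ?C" using C(1) by simp
  ultimately show ?thesis unfolding lesssim_def by blast
qed

text \<open>The first two vectors are the changes of radius from decay to growth and back; the
  fourth and the third are preimages of \<open>r\<close> under the first and the second.\<close>

lemma powr_pos_vecs:
  assumes "r \<in> pos_vecs" "0 < \<rho>"
  shows "(\<chi> j. r $ j powr \<rho> / \<rho>) \<in> pos_vecs" "(\<chi> j. (\<rho> * r $ j * exp 1) powr (1 / \<rho>)) \<in> pos_vecs"
    "(\<chi> j. r $ j powr \<rho> / (\<rho> * exp 1)) \<in> pos_vecs" "(\<chi> j. (\<rho> * r $ j) powr (1 / \<rho>)) \<in> pos_vecs"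
  using assms by (auto simp: pos_vecs_def less_imp_neq[symmetric])

lemma A_flat_iff_growth:
  assumes F: "F \<in> entire" and \<sigma>: "0 < \<sigma>" "\<sigma> \<le> 1"
  shows "power_series F \<in> A_flat \<sigma> \<longleftrightarrow> (\<exists>r\<in>pos_vecs. (\<lambda>z. norm (F z)) \<lesssim>
    (\<lambda>z. exp (\<Sum>j\<in>UNIV. r $ j * norm (z $ j) powr (2 * \<sigma> / (\<sigma> + 1)))))"
proof -
  have \<rho>: "0 < 2 * \<sigma> / (\<sigma> + 1)" using \<sigma> by simp
  show ?thesis
    unfolding A_flat_def mem_Collect_eq
  proof (intro iffI; elim bexE)
    fix r :: "real ^ 'a" assume r: "r \<in> pos_vecs"
      and c: "(\<lambda>\<alpha>. norm (power_series F \<alpha>)) \<lesssim> (\<lambda>\<alpha>. mpower r \<alpha> * mfact \<alpha> powr (- 1 / (2 * \<sigma>)))"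
    show "\<exists>r\<in>pos_vecs. (\<lambda>z. norm (F z)) \<lesssim> (\<lambda>z. exp (\<Sum>j\<in>UNIV. r $ j * norm (z $ j) powr (2 * \<sigma> / (\<sigma> + 1))))"
      using coeff_bound_imp_growth[OF F r \<sigma> c] powr_pos_vecs(1)[OF r \<rho>] by (rule bexI)
  next
    fix r :: "real ^ 'a" assume r: "r \<in> pos_vecs"
      and g: "(\<lambda>z. norm (F z)) \<lesssim> (\<lambda>z. exp (\<Sum>j\<in>UNIV. r $ j * norm (z $ j) powr (2 * \<sigma> / (\<sigma> + 1))))"
    show "\<exists>r\<in>pos_vecs. (\<lambda>\<alpha>. norm (power_series F \<alpha>)) \<lesssim> (\<lambda>\<alpha>. mpower r \<alpha> * mfact \<alpha> powr (- 1 / (2 * \<sigma>)))"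
      using growth_imp_coeff_bound[OF F r \<sigma>(1) g] powr_pos_vecs(2)[OF r \<rho>] by (rule bexI)
  qed
qed

text \<open>With "for every r" both changes of radius must be onto, so the hypothesis is used at the
  radius that is carried exactly to the given one.\<close>

lemma A0_flat_iff_growth:
  assumes F: "F \<in> entire" and \<sigma>: "0 < \<sigma>" "\<sigma> \<le> 1"
  shows "power_series F \<in> A0_flat \<sigma> \<longleftrightarrow> (\<forall>r\<in>pos_vecs. (\<lambda>z. norm (F z)) \<lesssim>
    (\<lambda>z. exp (\<Sum>j\<in>UNIV. r $ j * norm (z $ j) powr (2 * \<sigma> / (\<sigma> + 1)))))"
proof -
  define \<rho> where "\<rho> = 2 * \<sigma> / (\<sigma> + 1)"
  have \<rho>: "0 < \<rho>" using \<sigma> by (simp add: \<rho>_def)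
  have 1: "(\<chi> j. (\<chi> j. (\<rho> * r $ j) powr (1 / \<rho>)) $ j powr \<rho> / \<rho>) = r" if "r \<in> pos_vecs" for r :: "real ^ 'a"
    using that \<rho> by (auto simp: vec_eq_iff pos_vecs_def powr_powr less_imp_le)
  have 2: "(\<chi> j. (\<rho> * (\<chi> j. r $ j powr \<rho> / (\<rho> * exp 1)) $ j * exp 1) powr (1 / \<rho>)) = r"
    if "r \<in> pos_vecs" for r :: "real ^ 'a"
    using that \<rho> by (auto simp: vec_eq_iff pos_vecs_def powr_powr less_imp_le)
  show ?thesis
    unfolding A0_flat_def mem_Collect_eq \<rho>_def[symmetric]
  proof (intro iffI ballI)
    fix r :: "real ^ 'a" assume r: "r \<in> pos_vecs"
    assume *: "\<forall>r\<in>pos_vecs. (\<lambda>\<alpha>. norm (power_series F \<alpha>)) \<lesssim> (\<lambda>\<alpha>. mpower r \<alpha> * mfact \<alpha> powr (- 1 / (2 * \<sigma>)))"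
    show "(\<lambda>z. norm (F z)) \<lesssim> (\<lambda>z. exp (\<Sum>j\<in>UNIV. r $ j * norm (z $ j) powr \<rho>))"
      using coeff_bound_imp_growth[OF F powr_pos_vecs(4)[OF r \<rho>] \<sigma> *[rule_format, OF powr_pos_vecs(4)[OF r \<rho>]], folded \<rho>_def]
      unfolding 1[OF r] .
  next
    fix r :: "real ^ 'a" assume r: "r \<in> pos_vecs"
    assume *: "\<forall>r\<in>pos_vecs. (\<lambda>z. norm (F z)) \<lesssim> (\<lambda>z. exp (\<Sum>j\<in>UNIV. r $ j * norm (z $ j) powr \<rho>))"
    show "(\<lambda>\<alpha>. norm (power_series F \<alpha>)) \<lesssim> (\<lambda>\<alpha>. mpower r \<alpha> * mfact \<alpha> powr (- 1 / (2 * \<sigma>)))"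
      using growth_imp_coeff_bound[OF F powr_pos_vecs(3)[OF r \<rho>] \<sigma>(1), folded \<rho>_def,
          OF *[rule_format, OF powr_pos_vecs(3)[OF r \<rho>]]]
      unfolding 2[OF r] .
  qed
qed

section \<open>Reduction of the projection to a radial kernel\<close>

lemma power2_norm_vec: "(norm (w :: complex ^ 'd))\<^sup>2 = (\<Sum>j\<in>UNIV. (norm (w $ j))\<^sup>2)"
  by (simp add: norm_vec_def L2_set_def sum_nonneg)

lemma R_inf_radial_kernel:
  fixes h :: "complex ^ 'd \<Rightarrow> real"
  assumes "h \<in> R_inf"
  obtains k t T lo B where "radial_kernel k t T lo B"
    and "\<And>F z. continuous_on UNIV F \<Longrightarrow> Pi_A (\<lambda>w. F w * of_real (h w)) z =
      (LINT w|lborel. of_real (k w) * (F w * exp (\<Sum>j\<in>UNIV. z $ j * cnj (w $ j))))"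
proof -
  obtain t1 t2 where t1: "t1 \<in> pos_vecs" and t2: "t2 \<in> pos_vecs" and h: "h \<in> R_inf_on t1 t2"
    using assms unfolding R_inf_def by blast
  then have hm [measurable]: "h \<in> borel_measurable lebesgue" by (simp add: R_inf_on_def)
  obtain B f c where B: "AE z in lborel. \<bar>h z\<bar> \<le> B" and h0: "AE z in lborel. 0 \<le> h z"
    and hs: "AE z in lborel. z \<notin> closure (polydisc t2) \<longrightarrow> h z = 0"
    and hf: "AE z in lborel. h z = f (\<chi> j. norm (z $ j) :: real ^ 'd)"
    and c: "0 < c" "AE z in lborel. z \<in> polydisc t1 \<longrightarrow> c \<le> h z"
    using h unfolding R_inf_on_def AE_completion_iff by blast
  \<comment> \<open>Passing to a Borel representative moves the integrals to \<open>lborel\<close>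
    and keeps compositions with rotations measurable.\<close>
  obtain h' where [measurable]: "h' \<in> borel_measurable lborel" and hh': "AE z in lborel. h z = h' z"
    using completion_ex_borel_measurable_real[OF hm] by blast
  have [measurable]: "h' \<in> borel_measurable borel" using \<open>h' \<in> borel_measurable lborel\<close> by simp
  define k where "k w = h' w * exp (- (norm w)\<^sup>2) / pi ^ CARD('d)" for w
  \<comment> \<open>The lower bound of \<open>h\<close> times the smallest possible value of the
    Gaussian on the polydisc of radius \<open>t1\<close>.\<close>
  define lo where "lo = c * exp (- (\<Sum>j\<in>UNIV. (t1 $ j)\<^sup>2)) / pi ^ CARD('d)"
  have "radial_kernel k t1 t2 lo (\<bar>B\<bar> / pi ^ CARD('d))"
  proof
    show "k \<in> borel_measurable borel" unfolding k_def by measurable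
    show "AE w in lborel. 0 \<le> k w"
      using h0 hh' by eventually_elim (simp add: k_def)
    show "AE w in lborel. k w \<le> \<bar>B\<bar> / pi ^ CARD('d)"
      using B h0 hh'
    proof eventually_elim
      case (elim w)
      have "h' w * exp (- (norm w)\<^sup>2) \<le> \<bar>B\<bar> * 1" using elim by (intro mult_mono) auto
      then show ?case unfolding k_def by (intro divide_right_mono) auto
    qed
    have "closure (polydisc t2) \<subseteq> {w. \<forall>j. norm (w $ j) \<le> t2 $ j}"
      by (rule closure_minimal[OF _ compact_imp_closed[OF compact_closed_polydisc]])
        (auto simp: polydisc_def less_imp_le)
    then have "w \<notin> closure (polydisc t2)" if "\<not> (\<forall>j. norm (w $ j) \<le> t2 $ j)" for w
      using that by blast
    then show "AE w in lborel. \<not> (\<forall>j. norm (w $ j) \<le> t2 $ j) \<longrightarrow> k w = 0"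
      using hs hh' by (auto simp: k_def elim: eventually_elim2)
    show "AE w in lborel. (\<forall>j. norm (w $ j) < t1 $ j) \<longrightarrow> lo \<le> k w"
      using c(2) hh'
    proof eventually_elim
      case (elim w)
      show ?case
      proof
        assume w: "\<forall>j. norm (w $ j) < t1 $ j"
        then have "(norm w)\<^sup>2 \<le> (\<Sum>j\<in>UNIV. (t1 $ j)\<^sup>2)"
          unfolding power2_norm_vec by (intro sum_mono power_mono) (auto simp: less_imp_le)
        then have "c * exp (- (\<Sum>j\<in>UNIV. (t1 $ j)\<^sup>2)) \<le> h' w * exp (- (norm w)\<^sup>2)"
          using elim w c(1) by (intro mult_mono) (auto simp: polydisc_def)
        then show "lo \<le> k w" unfolding lo_def k_def by (intro divide_right_mono) auto
      qed
    qed
    show "0 < lo" using c(1) by (simp add: lo_def)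
    fix \<omega> :: "complex ^ 'd" assume \<omega>: "\<And>j. norm (\<omega> $ j) = 1"
    have U: "orthogonal_transformation (\<lambda>w. \<omega> * w)" by (rule rotation_orthogonal[OF \<omega>])
    have m: "(\<lambda>w. \<omega> * w) \<in> measurable lborel borel"
      using orthogonal_transformation_linear[OF U]
      by (simp, intro borel_measurable_continuous_onI linear_continuous_on linear_conv_bounded_linear[THEN iffD1])
    have P: "AE w in lborel. h' w = f (\<chi> j. norm (w $ j))"
      using hh' hf by eventually_elim simp
    \<comment> \<open>The almost everywhere identity is pulled back along the rotation, which
      preserves the measure; both sides are then compared with the same value of
      \<open>f\<close>.\<close>
    have "AE w in lborel. h' (\<omega> * w) = f (\<chi> j. norm ((\<omega> * w) $ j))"
      by (rule AE_distrD[OF m]) (simp only: distr_lborel_orthogonal_transformation[OF U] P)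
    then show "AE w in lborel. k (\<omega> * w) = k w"
      using P
    proof eventually_elim
      case (elim w)
      have "norm (\<omega> * w) = norm w" using U by (simp add: orthogonal_transformation)
      then show ?case using elim by (simp add: k_def norm_mult \<omega>)
    qed
  qed (fact t1 t2)+
  moreover have "Pi_A (\<lambda>w. F w * of_real (h w)) z =
      (LINT w|lborel. of_real (k w) * (F w * exp (\<Sum>j\<in>UNIV. z $ j * cnj (w $ j))))"
    if F: "continuous_on UNIV F" for F z
  proof -
    have [measurable]: "F \<in> borel_measurable borel" by (rule borel_measurable_continuous_onI[OF F])
    have E [measurable]: "(\<lambda>w. exp (\<Sum>j\<in>UNIV. z $ j * cnj (w $ j)) :: complex) \<in> borel_measurable borel"
      by (intro borel_measurable_continuous_onI continuous_intros)
    let ?E = "\<lambda>w. exp ((\<Sum>j\<in>UNIV. z $ j * cnj (w $ j)) - of_real ((norm w)\<^sup>2)) :: complex"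
    have E' [measurable]: "?E \<in> borel_measurable borel"
      by (intro borel_measurable_continuous_onI continuous_intros)
    have [measurable]: "(\<lambda>w. exp ((\<Sum>j\<in>UNIV. z $ j * cnj (w $ j)) - (complex_of_real (norm w))\<^sup>2)) \<in> borel_measurable borel"
      using E' by simp
    have "(LINT w|lebesgue. F w * of_real (h w) * ?E w) = (LINT w|lebesgue. F w * of_real (h' w) * ?E w)"
    proof (rule integral_cong_AE)
      have "F \<in> borel_measurable lebesgue" "?E \<in> borel_measurable lebesgue" "h' \<in> borel_measurable lebesgue"
        by (auto intro!: measurable_completion)
      then show "(\<lambda>w. F w * of_real (h w) * ?E w) \<in> borel_measurable lebesgue"
        "(\<lambda>w. F w * of_real (h' w) * ?E w) \<in> borel_measurable lebesgue"
        using hm by measurable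
      show "AE w in lebesgue. F w * of_real (h w) * ?E w = F w * of_real (h' w) * ?E w"
        unfolding AE_completion_iff using hh' by eventually_elim simp
    qed
    also have "\<dots> = (LINT w|lborel. F w * of_real (h' w) * ?E w)"
      by (rule integral_completion) measurable
    finally have "Pi_A (\<lambda>w. F w * of_real (h w)) z =
        (LINT w|lborel. 1 / of_real (pi ^ CARD('d)) * (F w * of_real (h' w) * ?E w))"
      unfolding Pi_A_def by (simp only: integral_mult_right_zero)
    also have "\<dots> = (LINT w|lborel. of_real (k w) * (F w * exp (\<Sum>j\<in>UNIV. z $ j * cnj (w $ j))))"
    proof (rule Bochner_Integration.integral_cong[OF refl])
      fix w
      have "?E w = exp (\<Sum>j\<in>UNIV. z $ j * cnj (w $ j)) * of_real (exp (- (norm w)\<^sup>2))"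
        by (simp only: exp_diff exp_of_real exp_minus of_real_inverse divide_inverse)
      then show "1 / of_real (pi ^ CARD('d)) * (F w * of_real (h' w) * ?E w)
          = of_real (k w) * (F w * exp (\<Sum>j\<in>UNIV. z $ j * cnj (w $ j)))"
        by (simp add: k_def)
    qed
    finally show ?thesis .
  qed
  ultimately show thesis by (rule that)
qed

section \<open>From multipliers to homeomorphisms\<close>

text \<open>The topologies on functions are pullbacks along \<open>power_series\<close>, which is
  injective on entire functions, so continuity is tested on coefficients. Surjectivity onto
  \<open>T1\<close> allows the inverse \<open>L'\<close> to be lifted to functions.\<close>

lemma homeomorphic_map_entire_topology:
  assumes hom: "homeomorphic_maps T1 T2 L L'"
    and \<Phi>: "\<And>F. F \<in> entire \<Longrightarrow> \<Phi> F \<in> entire" "\<And>F. F \<in> entire \<Longrightarrow> power_series (\<Phi> F) = L (power_series F)"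
    and surj: "\<And>c. c \<in> topspace T1 \<Longrightarrow> \<exists>F\<in>entire. power_series F = c"
  shows "homeomorphic_map (entire_topology T1) (entire_topology T2) \<Phi>"
proof -
  have L: "continuous_map T1 T2 L" and L': "continuous_map T2 T1 L'"
    and LL': "\<And>c. c \<in> topspace T1 \<Longrightarrow> L' (L c) = c" "\<And>c. c \<in> topspace T2 \<Longrightarrow> L (L' c) = c"
    using hom by (auto simp: homeomorphic_maps_def)
  define \<Psi> where "\<Psi> G = (SOME F. F \<in> entire \<and> power_series F = L' (power_series G))" for G
  have \<Psi>: "\<Psi> G \<in> entire" "power_series (\<Psi> G) = L' (power_series G)" if "power_series G \<in> topspace T2" for G
  proof -
    have "L' (power_series G) \<in> topspace T1" using L' that by (auto simp: continuous_map_def)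
    then have "\<exists>F. F \<in> entire \<and> power_series F = L' (power_series G)" using surj by blast
    from someI_ex[OF this] show "\<Psi> G \<in> entire" "power_series (\<Psi> G) = L' (power_series G)"
      unfolding \<Psi>_def by auto
  qed
  have "homeomorphic_maps (entire_topology T1) (entire_topology T2) \<Phi> \<Psi>"
    unfolding homeomorphic_maps_def
  proof (intro conjI ballI)
    have "continuous_map (entire_topology T1) T2 (power_series \<circ> \<Phi>)"
      by (rule continuous_map_eq[OF continuous_map_pullback[OF L, of entire power_series, folded entire_topology_def]])
        (auto simp: topspace_entire_topology \<Phi>)
    then show "continuous_map (entire_topology T1) (entire_topology T2) \<Phi>"
      unfolding entire_topology_def[of T2]
      by (rule continuous_map_pullback') (auto simp: topspace_entire_topology \<Phi>)
    have "continuous_map (entire_topology T2) T1 (power_series \<circ> \<Psi>)"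
      by (rule continuous_map_eq[OF continuous_map_pullback[OF L', of entire power_series, folded entire_topology_def]])
        (auto simp: topspace_entire_topology \<Psi>)
    then show "continuous_map (entire_topology T2) (entire_topology T1) \<Psi>"
      unfolding entire_topology_def[of T1]
      by (rule continuous_map_pullback') (auto simp: topspace_entire_topology \<Psi>)
  next
    fix F assume "F \<in> topspace (entire_topology T1)"
    then have F: "F \<in> entire" "power_series F \<in> topspace T1" by (auto simp: topspace_entire_topology)
    have "power_series (\<Phi> F) \<in> topspace T2" using L F by (auto simp: \<Phi> continuous_map_def)
    from \<Psi>[OF this] show "\<Psi> (\<Phi> F) = F"
      using F by (intro power_series_inject) (auto simp: \<Phi> LL')
  next
    fix G assume "G \<in> topspace (entire_topology T2)"
    then have G: "G \<in> entire" "power_series G \<in> topspace T2" by (auto simp: topspace_entire_topology)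
    from \<Psi>[OF G(2)] show "\<Phi> (\<Psi> G) = G"
      using G by (intro power_series_inject) (auto simp: \<Phi> LL')
  qed
  then show ?thesis unfolding homeomorphic_map_maps by blast
qed

text \<open>The inverse sequence shifts the exponent back by \<open>u\<close>. The vectors
  \<open>q\<close> and \<open>q'\<close> may be unrelated, since both limits range over all
  radii.\<close>

lemma homeomorphic_maps_diagonal:
  assumes m: "diagonal_multiplier m C q u" and m': "diagonal_multiplier (\<lambda>\<alpha>. inverse (m \<alpha>)) C' q' (- u)"
    and nz: "\<And>\<alpha>. m \<alpha> \<noteq> 0"
  shows "homeomorphic_maps (inductive_limit_topology s) (inductive_limit_topology (s + u))
      (\<lambda>c \<alpha>. m \<alpha> * c \<alpha>) (\<lambda>c \<alpha>. inverse (m \<alpha>) * c \<alpha>)"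
    and "homeomorphic_maps (projective_limit_topology s) (projective_limit_topology (s + u))
      (\<lambda>c \<alpha>. m \<alpha> * c \<alpha>) (\<lambda>c \<alpha>. inverse (m \<alpha>) * c \<alpha>)"
proof -
  interpret M: diagonal_multiplier m C q u by (rule m)
  interpret M': diagonal_multiplier "\<lambda>\<alpha>. inverse (m \<alpha>)" C' q' "- u" by (rule m')
  show "homeomorphic_maps (inductive_limit_topology s) (inductive_limit_topology (s + u))
      (\<lambda>c \<alpha>. m \<alpha> * c \<alpha>) (\<lambda>c \<alpha>. inverse (m \<alpha>) * c \<alpha>)"
    using M.continuous_map_inductive[of s] M'.continuous_map_inductive[of "s + u"] nz
    by (simp add: homeomorphic_maps_def M.L_def[abs_def] M'.L_def[abs_def] mult.assoc[symmetric])
  show "homeomorphic_maps (projective_limit_topology s) (projective_limit_topology (s + u))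
      (\<lambda>c \<alpha>. m \<alpha> * c \<alpha>) (\<lambda>c \<alpha>. inverse (m \<alpha>) * c \<alpha>)"
    using M.continuous_map_projective[of s] M'.continuous_map_projective[of "s + u"] nz
    by (simp add: homeomorphic_maps_def M.L_def[abs_def] M'.L_def[abs_def] mult.assoc[symmetric])
qed

lemma (in radial_kernel) diagonal_multiplier_moment:
  obtains C q where "diagonal_multiplier (\<lambda>\<beta>. of_real (moment \<beta>)) C q (- 1)"
proof -
  obtain C where C: "0 < C" "\<And>\<beta>. moment \<beta> \<le> C * (mpower (\<chi> j. T $ j ^ 2) \<beta> * mfact \<beta> powr (- 1))"
    by (rule moment_upper) blast
  have T2: "(\<chi> j. T $ j ^ 2) \<in> pos_vecs"
    using T by (simp add: pos_vecs_def) (metis less_irrefl)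
  have "diagonal_multiplier (\<lambda>\<beta>. of_real (moment \<beta>)) C (\<chi> j. T $ j ^ 2) (- 1)"
  proof
    show "norm (complex_of_real (moment \<beta>)) \<le> C * (mpower (\<chi> j. T $ j ^ 2) \<beta> * mfact \<beta> powr (- 1))" for \<beta>
      using C(2)[of \<beta>] moment_pos[of \<beta>] by (simp only: norm_of_real abs_of_pos)
  qed (fact C(1) T2)+
  then show thesis by (rule that)
qed

lemma (in radial_kernel) diagonal_multiplier_inverse_moment:
  obtains C q where "diagonal_multiplier (\<lambda>\<beta>. inverse (of_real (moment \<beta>))) C q 1"
proof -
  obtain C where C: "0 < C" "\<And>\<beta>. C * (mpower (\<chi> j. (t $ j / 2) ^ 2) \<beta> * mfact \<beta> powr (- 1)) \<le> moment \<beta>"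
    by (rule moment_lower) blast
  let ?q = "\<chi> j. (t $ j / 2) ^ 2"
  have tj: "0 < t $ j" for j using t by (simp add: pos_vecs_def)
  have q: "?q \<in> pos_vecs" unfolding pos_vecs_def using tj by (auto simp: less_imp_neq[symmetric])
  have "diagonal_multiplier (\<lambda>\<beta>. inverse (of_real (moment \<beta>))) (1 / C) (\<chi> j. inverse (?q $ j)) 1"
  proof
    fix \<beta>
    have "0 < C * (mpower ?q \<beta> * mfact \<beta> powr (- 1))"
      using mfact_pos[of \<beta>] by (intro mult_pos_pos C(1) mpower_pos[OF q]) simp
    then have "inverse (moment \<beta>) \<le> inverse (C * (mpower ?q \<beta> * mfact \<beta> powr (- 1)))"
      using C(2) by (intro le_imp_inverse_le)
    also have "\<dots> = 1 / C * (mpower (\<chi> j. inverse (?q $ j)) \<beta> * mfact \<beta> powr 1)"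
    proof -
      have "mpower (\<chi> j. inverse (?q $ j)) \<beta> = inverse (mpower ?q \<beta>)"
        by (simp add: mpower_def power_inverse prod_inversef[symmetric] comp_def)
      then show ?thesis using mfact_pos[of \<beta>]
        by (simp only: mfact_powr_minus_one powr_one less_imp_le inverse_mult_distrib inverse_divide div_by_1 mult_1_left
            inverse_eq_divide[of C] mult.assoc)
    qed
    finally show "norm (inverse (complex_of_real (moment \<beta>)))
        \<le> 1 / C * (mpower (\<chi> j. inverse (?q $ j)) \<beta> * mfact \<beta> powr 1)"
      using moment_pos[of \<beta>] by (simp only: norm_inverse norm_of_real abs_of_pos)
  qed (use C q in \<open>auto simp: pos_vecs_def\<close>)
  then show thesis by (rule that)
qed

theorem theorem3p5:
  fixes h :: "complex ^ 'd \<Rightarrow> real" and \<sigma> \<sigma>\<^sub>0 :: real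
  assumes "h \<in> R_inf" and "1 / 2 < \<sigma>" and "\<sigma> < 1" and "\<sigma>\<^sub>0 = \<sigma> / (2 * \<sigma> - 1)"
  shows
    "(\<forall>F\<in>entire.
       (power_series F \<in> A_flat \<sigma> \<longleftrightarrow>
         (\<exists>r\<in>pos_vecs. (\<lambda>z. norm (F z)) \<lesssim>
           (\<lambda>z. exp (\<Sum>j\<in>UNIV. r $ j * norm (z $ j) powr (2 * \<sigma> / (\<sigma> + 1)))))) \<and>
       (power_series F \<in> A_flat \<sigma> \<longleftrightarrow>
         (\<exists>F\<^sub>0\<in>entire. power_series F\<^sub>0 \<in> A0_flat' \<sigma>\<^sub>0 \<and> F = Pi_A (\<lambda>w. F\<^sub>0 w * of_real (h w)))) \<and>
       (power_series F \<in> A0_flat \<sigma> \<longleftrightarrow>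
         (\<forall>r\<in>pos_vecs. (\<lambda>z. norm (F z)) \<lesssim>
           (\<lambda>z. exp (\<Sum>j\<in>UNIV. r $ j * norm (z $ j) powr (2 * \<sigma> / (\<sigma> + 1)))))) \<and>
       (power_series F \<in> A0_flat \<sigma> \<longleftrightarrow>
         (\<exists>F\<^sub>0\<in>entire. power_series F\<^sub>0 \<in> A_flat' \<sigma>\<^sub>0 \<and> F = Pi_A (\<lambda>w. F\<^sub>0 w * of_real (h w))))) \<and>
     homeomorphic_map (A0_flat'_space \<sigma>\<^sub>0) (A_flat_space \<sigma>)
       (\<lambda>F. Pi_A (\<lambda>w. F w * of_real (h w))) \<and>
     homeomorphic_map (A_flat'_space \<sigma>\<^sub>0) (A0_flat_space \<sigma>)
       (\<lambda>F. Pi_A (\<lambda>w. F w * of_real (h w)))"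
proof -
  let ?\<Phi> = "\<lambda>F. Pi_A (\<lambda>w. F w * of_real (h w))"
  obtain k t T lo B where "radial_kernel k t T lo B"
    and Pi: "\<And>F z. continuous_on UNIV F \<Longrightarrow> ?\<Phi> F z =
      (LINT w|lborel. of_real (k w) * (F w * exp (\<Sum>j\<in>UNIV. z $ j * cnj (w $ j))))"
    by (rule R_inf_radial_kernel[OF assms(1)]) blast
  then interpret radial_kernel k t T lo B by simp
  let ?m = "\<lambda>\<beta>. complex_of_real (moment \<beta>)"
  obtain C q where m: "diagonal_multiplier ?m C q (- 1)"
    by (rule diagonal_multiplier_moment)
  obtain C' q' where m': "diagonal_multiplier (\<lambda>\<beta>. inverse (?m \<beta>)) C' q' 1"
    by (rule diagonal_multiplier_inverse_moment)
  have nz: "?m \<beta> \<noteq> 0" for \<beta> using moment_pos[of \<beta>] by simp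
  have sum\<Phi>: "((\<lambda>\<beta>. ?m \<beta> * power_series F \<beta> * e_monom \<beta> z) has_sum ?\<Phi> F z) UNIV" if "F \<in> entire" for F z
    unfolding Pi[OF entire_imp_continuous_on[OF that]]
    by (rule has_sum_projection[OF has_sum_power_series[OF that] entire_imp_continuous_on[OF that]])
  have \<Phi>: "?\<Phi> F \<in> entire" "power_series (?\<Phi> F) = (\<lambda>\<beta>. ?m \<beta> * power_series F \<beta>)" if "F \<in> entire" for F
    using entire_of_has_sum_e_monom[OF sum\<Phi>[OF that]] power_series_eqI[OF sum\<Phi>[OF that]] by auto
  define s where "s = 1 / (2 * \<sigma>\<^sub>0)"
  have s_eq: "s = (2 * \<sigma> - 1) / (2 * \<sigma>)" by (simp add: s_def assms(4))
  then have s: "s + - 1 = - 1 / (2 * \<sigma>)"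
    using assms(2) by (auto simp: field_simps)
  \<comment> \<open>This is where \<sigma> < 1 enters: every series in the primed spaces is then
    entire.\<close>
  have s_less: "s < 1 / 2"
    unfolding s_eq using assms(2,3) by (simp add: divide_less_eq)
  \<comment> \<open>The premise on the inverse is left open because it carries the exponent
    \<open>- (- 1)\<close>, which simplification later matches with \<open>m'\<close>.\<close>
  note hom = homeomorphic_maps_diagonal[OF m _ nz, of C' q' s, unfolded s]
  have surj: "\<exists>F\<in>entire. power_series F = c" if "c \<in> banach s r" "r \<in> pos_vecs" for c and r :: "real ^ 'd"
    using banach_imp_entire[OF that(2,1) s_less] by metis
  have one: "(\<chi> j. 1) \<in> (pos_vecs :: (real ^ 'd) set)" by (simp add: pos_vecs_def)
  have h1: "homeomorphic_map (A0_flat'_space \<sigma>\<^sub>0) (A_flat_space \<sigma>) ?\<Phi>"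
    unfolding A0_flat'_space_def A_flat_space_def s_def[symmetric]
    by (rule homeomorphic_map_entire_topology[OF hom(1) \<Phi>])
      (use m' surj in \<open>auto simp: topspace_inductive_limit_topology\<close>)
  have h2: "homeomorphic_map (A_flat'_space \<sigma>\<^sub>0) (A0_flat_space \<sigma>) ?\<Phi>"
    unfolding A_flat'_space_def A0_flat_space_def s_def[symmetric]
    by (rule homeomorphic_map_entire_topology[OF hom(2) \<Phi>])
      (use m' surj one in \<open>auto simp: topspace_projective_limit_topology\<close>)
  \<comment> \<open>Condition (3) describes the image of the homeomorphism, so it follows from
    (ii).\<close>
  have range1: "power_series F \<in> A_flat \<sigma> \<longleftrightarrow> (\<exists>F\<^sub>0\<in>entire. power_series F\<^sub>0 \<in> A0_flat' \<sigma>\<^sub>0 \<and> F = ?\<Phi> F\<^sub>0)"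
    if "F \<in> entire" for F
    using that homeomorphic_imp_surjective_map[OF h1, unfolded topspace_spaces] by blast
  have range2: "power_series F \<in> A0_flat \<sigma> \<longleftrightarrow> (\<exists>F\<^sub>0\<in>entire. power_series F\<^sub>0 \<in> A_flat' \<sigma>\<^sub>0 \<and> F = ?\<Phi> F\<^sub>0)"
    if "F \<in> entire" for F
    using that homeomorphic_imp_surjective_map[OF h2, unfolded topspace_spaces] by blast
  have \<sigma>: "0 < \<sigma>" "\<sigma> \<le> 1" using assms(2,3) by auto
  show ?thesis
    by (intro conjI ballI h1 h2 A_flat_iff_growth A0_flat_iff_growth range1 range2 \<sigma>; assumption)
qed

end
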